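(* Every supermatrix $M\in \mathrm{SO}_0(m|2n)(\Lambda_N)$ can be written as $$M=e^{X}e^{Y}e^{\mathbf Z},\qquad X\in \mathfrak{so}(m)\times[\mathfrak{sp}_\Omega(2n)\cap\mathfrak{so}(2n)],\quad Y\in\{0_m\}\times[\mathfrak{sp}_\Omega(2n)\cap \mathrm{Sym}(2n)],\quad \mathbf Z\in\mathfrak{so}_0(m|2n)(\Lambda_N^+).$$ Moreover, the elements $Y$ and $\mathbf Z$ are unique.
   Context: Let $m,n,N\in\mathbb N=\{1,2,\dots\}$. $\Lambda_N$ is the real Grassmann algebra with generators $f_1,\dots,f_N$, $f_jf_k+f_kf_j=0$, and basis $f_A=f_{j_1}\cdots f_{j_k}$ for $A=\{j_1<\dots<j_k\}\subset\{1,\dots,N\}$, $f_\emptyset=1$. $\Lambda_N^{(ev)}$ (resp. $\Lambda_N^{(odd)}$) is the span of the $f_A$ with $|A|$ even (resp. odd); $\Lambda_N^{+}$ is the span of the $f_A$ with $|A|\ge1$. $\mathrm{Mat}(m|2n)(\Lambda_N)$ is the finite-dimensional real algebra of supermatrices $M=\begin{pmatrix}A&B'\\C'&D\end{pmatrix}$ with $A\in(\Lambda_N^{(ev)})^{m\times m}$, $B'\in(\Lambda_N^{(odd)})^{m\times 2n}$, $C'\in(\Lambda_N^{(odd)})^{2n\times m}$, $D\in(\Lambda_N^{(ev)})^{2n\times 2n}$; $\mathrm{Mat}(m|2n)(\Lambda_N^+)$ is the subset with all entries in $\Lambda_N^+$. $\exp(M)=e^M=\sum_{j\ge0}M^j/j!$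 (convergent). Supertranspose: $M^{ST}=\begin{pmatrix}A^T&C'^{T}\\-B'^{T}&D^T\end{pmatrix}$. For invertible $M$, $\mathrm{sdet}(M)=\det(A-B'D^{-1}C')\det(D)^{-1}$. $\Omega_{2n}$ is the $2n\times2n$ block diagonal matrix with $n$ diagonal blocks $\begin{pmatrix}0&1\\-1&0\end{pmatrix}$ and $\mathbf Q=\begin{pmatrix}I_m&0\\0&-\frac12\Omega_{2n}\end{pmatrix}$. $\mathrm O_0=\{M\in\mathrm{Mat}(m|2n)(\Lambda_N):M^{ST}\mathbf QM-\mathbf Q=0\}$ (its elements are invertible), $\mathrm{SO}_0=\mathrm{SO}_0(m|2n)(\Lambda_N)=\{M\in\mathrm O_0:\mathrm{sdet}(M)=1\}$. $\mathfrak{so}_0=\{X\in\mathrm{Mat}(m|2n)(\Lambda_N):X^{ST}\mathbf Q+\mathbf QX=0\}$ and $\mathfrak{so}_0(m|2n)(\Lambda_N^+)=\mathfrak{so}_0\cap\mathrm{Mat}(m|2n)(\Lambda_N^+)$. $\mathfrak{so}(p)$ is the set of real antisymmetric $p\times p$ matrices, $\mathrm{Sym}(p)$ the set of real symmetric ones, $\mathfrak{sp}_\Omega(2n)=\{D_0\in\mathbb R^{2n\times2n}:D_0^T\Omega_{2n}+\Omega_{2n}D_0=0\}$. A product $\mathcal S_1\times\mathcal S_2$ of sets of real $m\times m$ and $2n\times2n$ matrices is identified with the set of block diagonal supermatrices $\begin{pmatrix}X_0&0\\0&Y_0\end{pmatrix}$, $X_0\in\mathcal S_1$, $Y_0\in\mathcal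 S_2$; $0_m$ is the zero $m\times m$ matrix. *)

theory Defs
  imports Complex_Main "Jordan_Normal_Form.Determinant"
begin

subsection \<open>The Grassmann algebra\<close>

text \<open>
  The type below is an ambient real algebra on countably many anticommuting generators
  \<open>f\<^sub>j\<close>, \<open>j :: nat\<close>: an element is its family of coefficients with respect to the
  monomials \<open>f\<^sub>A\<close>, \<open>A\<close> a finite set of naturals.  The Grassmann algebra \<open>\<Lambda>\<^sub>N\<close> is its
  subalgebra spanned by the \<open>f\<^sub>A\<close> with \<open>A \<subseteq> {1..N}\<close>.
\<close>

typedef grassmann = "{x :: nat set \<Rightarrow> real. \<forall>A. infinite A \<longrightarrow> x A = 0}"
  morphisms gcoeff Abs_grassmann
  by (rule exI[of _ "\<lambda>_. 0"]) simp

setup_lifting type_definition_grassmann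

lemma gcoeff_infinite [simp]: "infinite A \<Longrightarrow> gcoeff x A = 0"
  using gcoeff[of x] by simp

lemma grassmann_eqI: "(\<And>A. finite A \<Longrightarrow> gcoeff x A = gcoeff y A) \<Longrightarrow> x = y"
  by (metis gcoeff_infinite gcoeff_inject ext)

text \<open>
  For disjoint \<open>B\<close> and \<open>C\<close>, reordering \<open>f\<^sub>B f\<^sub>C\<close> increasingly takes one transposition
  for every pair \<open>(b, c) \<in> B \<times> C\<close> with \<open>c < b\<close>.
\<close>

definition inversions :: "nat set \<Rightarrow> nat set \<Rightarrow> (nat \<times> nat) set" where
  "inversions B C = {(b, c). b \<in> B \<and> c \<in> C \<and> c < b}"

definition shuffle_sign :: "nat set \<Rightarrow> nat set \<Rightarrow> real" where
  "shuffle_sign B C = (- 1) ^ card (inversions B C)"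

lemma finite_inversions: "finite B \<Longrightarrow> finite C \<Longrightarrow> finite (inversions B C)"
  by (rule finite_subset[of _ "B \<times> C"]) (auto simp: inversions_def)

lemma shuffle_sign_Un_left:
  assumes "finite B" "finite C" "finite D" "B \<inter> C = {}"
  shows "shuffle_sign (B \<union> C) D = shuffle_sign B D * shuffle_sign C D"
proof -
  have "inversions (B \<union> C) D = inversions B D \<union> inversions C D"
    by (auto simp: inversions_def)
  moreover have "inversions B D \<inter> inversions C D = {}"
    using assms by (auto simp: inversions_def)
  ultimately show ?thesis
    using assms by (simp add: shuffle_sign_def card_Un_disjoint finite_inversions power_add)
qed

lemma shuffle_sign_Un_right:
  assumes "finite B" "finite C" "finite D" "C \<inter> D = {}"
  shows "shuffle_sign B (C \<union> D) = shuffle_sign B C * shuffle_sign B D"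
proof -
  have "inversions B (C \<union> D) = inversions B C \<union> inversions B D"
    by (auto simp: inversions_def)
  moreover have "inversions B C \<inter> inversions B D = {}"
    using assms by (auto simp: inversions_def)
  ultimately show ?thesis
    using assms by (simp add: shuffle_sign_def card_Un_disjoint finite_inversions power_add)
qed

lemma shuffle_sign_empty [simp]: "shuffle_sign {} C = 1" "shuffle_sign B {} = 1"
  by (simp_all add: shuffle_sign_def inversions_def)

lemma abs_shuffle_sign [simp]: "\<bar>shuffle_sign B C\<bar> = 1"
  by (simp add: shuffle_sign_def power_abs)

lemma shuffle_sign_swap:
  assumes "finite B" "finite C" "B \<inter> C = {}"
  shows "shuffle_sign C B = (- 1) ^ (card B * card C) * shuffle_sign B C"
proof -
  have un: "B \<times> C = inversions B C \<union> prod.swap ` inversions C B"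
    using assms(3) by (auto simp: inversions_def image_iff not_less le_less)
  have "inversions B C \<inter> prod.swap ` inversions C B = {}"
    by (auto simp: inversions_def)
  then have "card (B \<times> C) = card (inversions B C) + card (prod.swap ` inversions C B)"
    unfolding un using assms by (intro card_Un_disjoint) (auto simp: finite_inversions)
  then have "card B * card C = card (inversions B C) + card (inversions C B)"
    by (simp add: card_cartesian_product card_image)
  then show ?thesis
    by (auto simp: shuffle_sign_def uminus_power_if)
qed

instantiation grassmann :: real_algebra_1
begin

lift_definition zero_grassmann :: grassmann is "\<lambda>_. 0" by simp
lift_definition one_grassmann :: grassmann is "\<lambda>A. if A = {} then 1 else 0" by auto
lift_definition plus_grassmann :: "grassmann \<Rightarrow> grassmann \<Rightarrow> grassmann"
  is "\<lambda>x y A. x A + y A" by simp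
lift_definition minus_grassmann :: "grassmann \<Rightarrow> grassmann \<Rightarrow> grassmann"
  is "\<lambda>x y A. x A - y A" by simp
lift_definition uminus_grassmann :: "grassmann \<Rightarrow> grassmann"
  is "\<lambda>x A. - x A" by simp
lift_definition scaleR_grassmann :: "real \<Rightarrow> grassmann \<Rightarrow> grassmann"
  is "\<lambda>r x A. r * x A" by simp
lift_definition times_grassmann :: "grassmann \<Rightarrow> grassmann \<Rightarrow> grassmann"
  is "\<lambda>x y A. \<Sum>B\<in>Pow A. shuffle_sign B (A - B) * x B * y (A - B)" by simp

instance
proof
  fix x y z :: grassmann and a b :: real
  show "x + y + z = x + (y + z)" "x + y = y + x" "0 + x = x" "- x + x = 0" "x - y = x + - y"
    by (transfer; simp add: fun_eq_iff)+
  show "a *\<^sub>R (x + y) = a *\<^sub>R x + a *\<^sub>R y" "(a + b) *\<^sub>R x = a *\<^sub>R x + b *\<^sub>R x"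
    "a *\<^sub>R b *\<^sub>R x = (a * b) *\<^sub>R x" "1 *\<^sub>R x = x"
    by (transfer; simp add: fun_eq_iff algebra_simps)+
  show "(x + y) * z = x * z + y * z" "x * (y + z) = x * y + x * z"
    by (transfer; simp add: fun_eq_iff algebra_simps sum.distrib)+
  show "a *\<^sub>R x * y = a *\<^sub>R (x * y)" "x * a *\<^sub>R y = a *\<^sub>R (x * y)"
    by (transfer; simp add: fun_eq_iff algebra_simps sum_distrib_left)+
  show "(0 :: grassmann) \<noteq> 1"
    by transfer (auto simp: fun_eq_iff)
  show "1 * x = x"
  proof (rule grassmann_eqI)
    fix A :: "nat set" assume A: "finite A"
    have "gcoeff (1 * x) A = (\<Sum>B\<in>Pow A. if B = {} then gcoeff x A else 0)"
      unfolding times_grassmann.rep_eq one_grassmann.rep_eq by (rule sum.cong) auto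
    also have "\<dots> = gcoeff x A" using A by (simp add: sum.delta)
    finally show "gcoeff (1 * x) A = gcoeff x A" .
  qed
  show "x * 1 = x"
  proof (rule grassmann_eqI)
    fix A :: "nat set" assume A: "finite A"
    have "gcoeff (x * 1) A = (\<Sum>B\<in>Pow A. if B = A then gcoeff x A else 0)"
      unfolding times_grassmann.rep_eq one_grassmann.rep_eq by (rule sum.cong) auto
    also have "\<dots> = gcoeff x A" using A by (simp add: sum.delta)
    finally show "gcoeff (x * 1) A = gcoeff x A" .
  qed
  show "x * y * z = x * (y * z)"
  proof (rule grassmann_eqI)
    fix A :: "nat set" assume A: "finite A"
    let ?s = shuffle_sign
    have fin: "finite B" if "B \<subseteq> A" for B using A that by (rule rev_finite_subset)
    have "gcoeff (x * y * z) A = (\<Sum>B\<in>Pow A. \<Sum>C\<in>Pow B.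
        ?s B (A - B) * ?s C (B - C) * (gcoeff x C * gcoeff y (B - C) * gcoeff z (A - B)))"
      unfolding times_grassmann.rep_eq
      by (simp add: sum_distrib_left sum_distrib_right mult_ac)
    also have "\<dots> = (\<Sum>(B, C)\<in>Sigma (Pow A) Pow.
        ?s B (A - B) * ?s C (B - C) * (gcoeff x C * gcoeff y (B - C) * gcoeff z (A - B)))"
      using A fin by (subst sum.Sigma) auto
    also have "\<dots> = (\<Sum>(B, C)\<in>Sigma (Pow A) (\<lambda>B. Pow (A - B)).
        ?s B (A - B) * ?s C (A - B - C) * (gcoeff x B * gcoeff y C * gcoeff z (A - B - C)))"
    proof (rule sum.reindex_bij_witness[where
          i = "\<lambda>(B, C). (B \<union> C, B)" and j = "\<lambda>(B, C). (C, B - C)"])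
      fix p assume "p \<in> Sigma (Pow A) Pow"
      then obtain B C where p: "p = (B, C)" and BC: "B \<subseteq> A" "C \<subseteq> B" by auto
      have *: "finite C" "finite (B - C)" "finite (A - B)" using BC fin by auto
      have eq: "(B - C) \<union> (A - B) = A - C" "(B - C) \<inter> (A - B) = {}" using BC by auto
      have "?s B (A - B) = ?s C (A - B) * ?s (B - C) (A - B)"
        using shuffle_sign_Un_left[of C "B - C" "A - B"] * BC by (simp add: Un_absorb1)
      moreover have "?s C (A - C) = ?s C (B - C) * ?s C (A - B)"
        using shuffle_sign_Un_right[of C "B - C" "A - B"] * BC
        by (simp add: eq)
      moreover have "A - C - (B - C) = A - B" using BC by auto
      ultimately show "(case case p of (B, C) \<Rightarrow> (C, B - C) of (B, C) \<Rightarrow>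
            ?s B (A - B) * ?s C (A - B - C) * (gcoeff x B * gcoeff y C * gcoeff z (A - B - C))) =
          (case p of (B, C) \<Rightarrow>
            ?s B (A - B) * ?s C (B - C) * (gcoeff x C * gcoeff y (B - C) * gcoeff z (A - B)))"
        by (simp add: p)
    qed auto
    also have "\<dots> = (\<Sum>B\<in>Pow A. \<Sum>C\<in>Pow (A - B).
        ?s B (A - B) * ?s C (A - B - C) * (gcoeff x B * gcoeff y C * gcoeff z (A - B - C)))"
      using A by (subst sum.Sigma) auto
    also have "\<dots> = gcoeff (x * (y * z)) A"
      unfolding times_grassmann.rep_eq
      by (simp add: sum_distrib_left sum_distrib_right mult_ac)
    finally show "gcoeff (x * y * z) A = gcoeff (x * (y * z)) A" .
  qed
qed

end

lift_definition gmon :: "nat set \<Rightarrow> grassmann" is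
  "\<lambda>A B. if finite A \<and> B = A then 1 else 0" by auto

abbreviation gen :: "nat \<Rightarrow> grassmann" where
  "gen j \<equiv> gmon {j}"

lemma gmon_mult:
  assumes "finite A" "finite B"
  shows "gmon A * gmon B = (if A \<inter> B = {} then shuffle_sign A B *\<^sub>R gmon (A \<union> B) else 0)"
proof (rule grassmann_eqI)
  fix C :: "nat set" assume C: "finite C"
  have "gcoeff (gmon A * gmon B) C =
      (\<Sum>D\<in>Pow C. if D = A then (if C - A = B then shuffle_sign A B else 0) else 0)"
    unfolding times_grassmann.rep_eq gmon.rep_eq using assms by (intro sum.cong) auto
  also have "\<dots> = (if A \<subseteq> C \<and> C - A = B then shuffle_sign A B else 0)"
    using C by (subst sum.delta) auto
  also have "\<dots> = gcoeff (if A \<inter> B = {} then shuffle_sign A B *\<^sub>R gmon (A \<union> B) else 0) C"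
    using assms by (auto simp: scaleR_grassmann.rep_eq gmon.rep_eq zero_grassmann.rep_eq)
  finally show "gcoeff (gmon A * gmon B) C =
      gcoeff (if A \<inter> B = {} then shuffle_sign A B *\<^sub>R gmon (A \<union> B) else 0) C" .
qed

lemma gen_anticommute: "gen j * gen k + gen k * gen j = 0"
proof (cases "j = k")
  case False
  then have "shuffle_sign {k} {j} = - shuffle_sign {j} {k}"
    by (subst shuffle_sign_swap) auto
  with False show ?thesis
    by (simp add: gmon_mult insert_commute)
qed (simp add: gmon_mult)

lemma gmon_empty: "gmon {} = 1"
  by transfer (auto simp: fun_eq_iff)

lemma gmon_insert_least:
  assumes "finite A" "\<And>a. a \<in> A \<Longrightarrow> j < a"
  shows "gmon (insert j A) = gen j * gmon A"
proof -
  have "inversions {j} A = {}" "j \<notin> A"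
    using assms(2) by (force simp: inversions_def)+
  then show ?thesis
    using assms(1) by (simp add: gmon_mult shuffle_sign_def)
qed

lemma gmon_eq_prod_list:
  "finite A \<Longrightarrow> gmon A = prod_list (map gen (sorted_list_of_set A))"
proof (induction "card A" arbitrary: A)
  case 0
  then show ?case by (simp add: gmon_empty)
next
  case (Suc k)
  let ?j = "Min A"
  have ne: "A \<noteq> {}" using Suc by auto
  have A: "A = insert ?j (A - {?j})" using ne Suc by (simp add: insert_absorb)
  have less: "?j < a" if "a \<in> A - {?j}" for a
    using that Suc by (metis DiffD1 DiffD2 Min_le insertCI order_le_neq_trans)
  have "gmon A = gen ?j * gmon (A - {?j})"
    using gmon_insert_least[of "A - {?j}" ?j] A less Suc.prems by auto
  also have "gmon (A - {?j}) = prod_list (map gen (sorted_list_of_set (A - {?j})))"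
    using Suc ne by (intro Suc(1)) auto
  also have "gen ?j * \<dots> = prod_list (map gen (sorted_list_of_set A))"
    using ne Suc.prems by (simp add: sorted_list_of_set_nonempty)
  finally show ?case .
qed

definition Lambda_ev :: "nat \<Rightarrow> grassmann set" where
  "Lambda_ev N = span (gmon ` {A. A \<subseteq> {1..N} \<and> even (card A)})"

definition Lambda_odd :: "nat \<Rightarrow> grassmann set" where
  "Lambda_odd N = span (gmon ` {A. A \<subseteq> {1..N} \<and> odd (card A)})"

definition Lambda_plus :: "nat \<Rightarrow> grassmann set" where
  "Lambda_plus N = span (gmon ` {A. A \<subseteq> {1..N} \<and> card A \<ge> 1})"

lemma gcoeff_sum: "gcoeff (sum f S) A = (\<Sum>s\<in>S. gcoeff (f s) A)"
  by (induction S rule: infinite_finite_induct)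
     (simp_all add: zero_grassmann.rep_eq plus_grassmann.rep_eq)

lemma span_gmon:
  assumes "\<A> \<subseteq> Pow {1..N}"
  shows "span (gmon ` \<A>) = {x. \<forall>A. A \<notin> \<A> \<longrightarrow> gcoeff x A = 0}" (is "_ = ?R")
proof
  have "subspace ?R"
    by (auto simp: subspace_def zero_grassmann.rep_eq plus_grassmann.rep_eq
        scaleR_grassmann.rep_eq)
  moreover have "gmon ` \<A> \<subseteq> ?R" by (auto simp: gmon.rep_eq)
  ultimately show "span (gmon ` \<A>) \<subseteq> ?R" by (rule span_minimal[rotated])
  have fin: "finite \<A>" using assms finite_subset by auto
  have fin': "finite A" if "A \<in> \<A>" for A
    using that assms by (meson Pow_iff finite_atLeastAtMost finite_subset subsetD)
  show "?R \<subseteq> span (gmon ` \<A>)"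
  proof
    fix x assume x: "x \<in> ?R"
    have "x = (\<Sum>A\<in>\<A>. gcoeff x A *\<^sub>R gmon A)"
    proof (rule grassmann_eqI)
      fix B :: "nat set" assume "finite B"
      have "gcoeff (\<Sum>A\<in>\<A>. gcoeff x A *\<^sub>R gmon A) B =
          (\<Sum>A\<in>\<A>. if A = B then gcoeff x B else 0)"
        unfolding gcoeff_sum scaleR_grassmann.rep_eq gmon.rep_eq
        using fin' by (intro sum.cong) auto
      also have "\<dots> = gcoeff x B" using fin x by (simp add: sum.delta)
      finally show "gcoeff x B = gcoeff (\<Sum>A\<in>\<A>. gcoeff x A *\<^sub>R gmon A) B" by simp
    qed
    then show "x \<in> span (gmon ` \<A>)"
      by (metis (no_types, lifting) image_eqI span_base span_scale span_sum)
  qed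
qed

text \<open>The commutative even subalgebra as a type of its own, so that \<^const>\<open>det\<close> applies.\<close>

typedef grassmann_ev = "{x. \<forall>A. odd (card A) \<longrightarrow> gcoeff x A = 0}"
  by (rule exI[of _ 0]) (simp add: zero_grassmann.rep_eq)

setup_lifting type_definition_grassmann_ev

lemma even_mult:
  assumes "\<And>A. odd (card A) \<Longrightarrow> gcoeff x A = 0" "\<And>A. odd (card A) \<Longrightarrow> gcoeff y A = 0"
    and A: "odd (card A)"
  shows "gcoeff (x * y) A = 0"
  unfolding times_grassmann.rep_eq
proof (rule sum.neutral, rule ballI)
  fix B assume B: "B \<in> Pow A"
  have "finite A" using A by (metis card.infinite even_zero)
  with B have "card A = card B + card (A - B)"
    by (simp add: card_Diff_subset card_mono finite_subset)
  with A have "odd (card B) \<or> odd (card (A - B))" by auto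
  with assms(1,2) show "shuffle_sign B (A - B) * gcoeff x B * gcoeff y (A - B) = 0" by auto
qed

instantiation grassmann_ev :: comm_ring_1
begin

lift_definition zero_grassmann_ev :: grassmann_ev is 0 by (simp add: zero_grassmann.rep_eq)
lift_definition one_grassmann_ev :: grassmann_ev is 1 by (auto simp: one_grassmann.rep_eq)
lift_definition plus_grassmann_ev :: "grassmann_ev \<Rightarrow> grassmann_ev \<Rightarrow> grassmann_ev" is "(+)"
  by (simp add: plus_grassmann.rep_eq)
lift_definition minus_grassmann_ev :: "grassmann_ev \<Rightarrow> grassmann_ev \<Rightarrow> grassmann_ev" is "(-)"
  by (simp add: minus_grassmann.rep_eq)
lift_definition uminus_grassmann_ev :: "grassmann_ev \<Rightarrow> grassmann_ev" is uminus
  by (simp add: uminus_grassmann.rep_eq)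
lift_definition times_grassmann_ev :: "grassmann_ev \<Rightarrow> grassmann_ev \<Rightarrow> grassmann_ev" is "(*)"
  using even_mult by blast

instance
proof
  fix a b c :: grassmann_ev
  show "a * b * c = a * (b * c)" by transfer (simp add: mult.assoc)
  show "1 * a = a" by transfer simp
  show "a + b + c = a + (b + c)" by transfer (simp add: add.assoc)
  show "a + b = b + a" by transfer (simp add: add.commute)
  show "0 + a = a" by transfer simp
  show "- a + a = 0" by transfer simp
  show "a - b = a + - b" by transfer simp
  show "(a + b) * c = a * c + b * c" by transfer (simp add: distrib_right)
  show "(0 :: grassmann_ev) \<noteq> 1" by transfer simp
  show "a * b = b * a"
  proof transfer
    fix x y assume x: "\<forall>A. odd (card A) \<longrightarrow> gcoeff x A = 0"
      and y: "\<forall>A. odd (card A) \<longrightarrow> gcoeff y A = 0"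
    show "x * y = y * x"
    proof (rule grassmann_eqI)
      fix A :: "nat set" assume A: "finite A"
      show "gcoeff (x * y) A = gcoeff (y * x) A"
        unfolding times_grassmann.rep_eq
      proof (rule sum.reindex_bij_witness[where i = "\<lambda>B. A - B" and j = "\<lambda>B. A - B"])
        fix B assume B: "B \<in> Pow A"
        then have *: "A - (A - B) = B" by auto
        have "shuffle_sign (A - B) B = shuffle_sign B (A - B)" if "even (card B)"
          using that A B by (subst shuffle_sign_swap) (auto intro: finite_subset)
        with x * show "shuffle_sign (A - B) (A - (A - B)) * gcoeff y (A - B) *
            gcoeff x (A - (A - B)) = shuffle_sign B (A - B) * gcoeff x B * gcoeff y (A - B)"
          by (cases "even (card B)") auto
      qed auto
    qed
  qed
qed

end

lift_definition even_part :: "grassmann \<Rightarrow> grassmann_ev" is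
  "\<lambda>x. Abs_grassmann (\<lambda>A. if even (card A) then gcoeff x A else 0)"
  by (subst Abs_grassmann_inverse) auto

lemma Rep_even_part:
  "(\<And>A. odd (card A) \<Longrightarrow> gcoeff x A = 0) \<Longrightarrow> Rep_grassmann_ev (even_part x) = x"
  by (rule grassmann_eqI) (simp add: even_part.rep_eq Abs_grassmann_inverse)


subsection \<open>Supermatrices\<close>

definition real_mat :: "real mat \<Rightarrow> grassmann mat" where
  "real_mat = map_mat of_real"

definition SMat :: "nat \<Rightarrow> nat \<Rightarrow> nat \<Rightarrow> grassmann mat set" where
  "SMat m n N = {four_block_mat A B C D | A B C D.
     A \<in> carrier_mat m m \<and> elements_mat A \<subseteq> Lambda_ev N \<and>
     B \<in> carrier_mat m (2 * n) \<and> elements_mat B \<subseteq> Lambda_odd N \<and>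
     C \<in> carrier_mat (2 * n) m \<and> elements_mat C \<subseteq> Lambda_odd N \<and>
     D \<in> carrier_mat (2 * n) (2 * n) \<and> elements_mat D \<subseteq> Lambda_ev N}"

definition SMat_plus :: "nat \<Rightarrow> nat \<Rightarrow> nat \<Rightarrow> grassmann mat set" where
  "SMat_plus m n N = {M \<in> SMat m n N. elements_mat M \<subseteq> Lambda_plus N}"

text \<open>
  The exponential series converges coefficientwise, for every square matrix; on the
  finite-dimensional algebra \<open>SMat m n N\<close> this is convergence in its usual topology.
\<close>

definition mexp :: "grassmann mat \<Rightarrow> grassmann mat" where
  "mexp M = mat (dim_row M) (dim_row M) (\<lambda>(i, k).
     Abs_grassmann (\<lambda>A. \<Sum>j. gcoeff ((M ^\<^sub>m j) $$ (i, k)) A / fact j))"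

definition gnorm :: "nat set \<Rightarrow> grassmann \<Rightarrow> real" where
  "gnorm A x = (\<Sum>B\<in>Pow A. \<bar>gcoeff x B\<bar>)"

lemma gnorm_add: "gnorm A (x + y) \<le> gnorm A x + gnorm A y"
  by (auto simp: gnorm_def plus_grassmann.rep_eq simp flip: sum.distrib intro!: sum_mono)

lemma gnorm_sum: "gnorm A (sum f S) \<le> (\<Sum>s\<in>S. gnorm A (f s))"
proof (induction S rule: infinite_finite_induct)
  case (insert s S)
  then show ?case using gnorm_add[of A "f s" "sum f S"] by simp
qed (simp_all add: gnorm_def zero_grassmann.rep_eq)

lemma gnorm_nonneg: "gnorm A x \<ge> 0"
  by (simp add: gnorm_def sum_nonneg)

lemma gnorm_mult:
  assumes A: "finite A"
  shows "gnorm A (x * y) \<le> gnorm A x * gnorm A y"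
proof -
  have fin: "finite B" if "B \<subseteq> A" for B using A that by (rule rev_finite_subset)
  have "gnorm A (x * y) \<le> (\<Sum>C\<in>Pow A. \<Sum>B\<in>Pow C. \<bar>gcoeff x B\<bar> * \<bar>gcoeff y (C - B)\<bar>)"
    unfolding gnorm_def times_grassmann.rep_eq
    by (intro sum_mono order.trans[OF sum_abs]) (simp add: abs_mult)
  also have "\<dots> = (\<Sum>(C, B)\<in>Sigma (Pow A) Pow. \<bar>gcoeff x B\<bar> * \<bar>gcoeff y (C - B)\<bar>)"
    using A fin by (subst sum.Sigma) auto
  also have "\<dots> = (\<Sum>(B, D)\<in>(\<lambda>(C, B). (B, C - B)) ` Sigma (Pow A) Pow.
      \<bar>gcoeff x B\<bar> * \<bar>gcoeff y D\<bar>)"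
    by (subst sum.reindex) (auto simp: inj_on_def case_prod_unfold)
  also have "\<dots> \<le> (\<Sum>(B, D)\<in>Pow A \<times> Pow A. \<bar>gcoeff x B\<bar> * \<bar>gcoeff y D\<bar>)"
    using A by (intro sum_mono2) auto
  also have "\<dots> = gnorm A x * gnorm A y"
    by (simp add: gnorm_def sum_product sum.cartesian_product)
  finally show ?thesis .
qed

lemma summable_mexp:
  assumes M: "M \<in> carrier_mat d d" and ik: "i < d" "k < d"
  shows "summable (\<lambda>j. gcoeff ((M ^\<^sub>m j) $$ (i, k)) A / fact j)"
proof (cases "finite A")
  case False
  then show ?thesis by simp
next
  case A: True
  define c where "c = (\<Sum>i<d. \<Sum>k<d. gnorm A (M $$ (i, k)))"
  have c: "gnorm A (M $$ (i, k)) \<le> c" if "i < d" "k < d" for i k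
  proof -
    have "gnorm A (M $$ (i, k)) \<le> (\<Sum>k<d. gnorm A (M $$ (i, k)))"
      using that by (intro member_le_sum) (auto simp: gnorm_nonneg)
    also have "\<dots> \<le> c" unfolding c_def
      using that by (intro member_le_sum) (auto simp: gnorm_nonneg sum_nonneg)
    finally show ?thesis .
  qed
  have bound: "i < d \<Longrightarrow> k < d \<Longrightarrow>
      gnorm A ((M ^\<^sub>m j) $$ (i, k)) \<le> gnorm A 1 * (d * c) ^ j" for j i k
  proof (induction j arbitrary: i k)
    case 0
    then show ?case using M by (auto simp: gnorm_nonneg gnorm_def[of A 0] zero_grassmann.rep_eq)
  next
    case (Suc j)
    have Mj: "M ^\<^sub>m j \<in> carrier_mat d d" using M by simp
    have "gnorm A ((M ^\<^sub>m Suc j) $$ (i, k)) =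
        gnorm A (\<Sum>l<d. (M ^\<^sub>m j) $$ (i, l) * M $$ (l, k))"
      using M Mj Suc.prems by (simp add: scalar_prod_def atLeast0LessThan)
    also have "\<dots> \<le> (\<Sum>l<d. gnorm A ((M ^\<^sub>m j) $$ (i, l)) * gnorm A (M $$ (l, k)))"
      by (intro order.trans[OF gnorm_sum] sum_mono gnorm_mult A)
    also have "\<dots> \<le> (\<Sum>l<d. (gnorm A 1 * (d * c) ^ j) * c)"
      using Suc c order.trans[OF gnorm_nonneg c]
      by (intro sum_mono mult_mono) (auto simp: gnorm_nonneg intro!: mult_nonneg_nonneg)
    also have "\<dots> = gnorm A 1 * (d * c) ^ Suc j" by simp
    finally show ?case .
  qed
  have "summable (\<lambda>j. gnorm A 1 * (inverse (fact j) * (d * c) ^ j))"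
    by (intro summable_mult summable_exp)
  then show ?thesis
  proof (rule summable_comparison_test[rotated], intro exI[of _ 0] allI impI)
    fix j
    have "\<bar>gcoeff ((M ^\<^sub>m j) $$ (i, k)) A\<bar> \<le> gnorm A ((M ^\<^sub>m j) $$ (i, k))"
      unfolding gnorm_def using A by (intro member_le_sum) auto
    also have "\<dots> \<le> gnorm A 1 * (d * c) ^ j" using bound ik by auto
    finally show "norm (gcoeff ((M ^\<^sub>m j) $$ (i, k)) A / fact j) \<le>
        gnorm A 1 * (inverse (fact j) * (d * c) ^ j)"
      by (simp add: divide_simps)
  qed
qed

lemma gcoeff_mexp:
  assumes "M \<in> carrier_mat d d" "i < d" "k < d"
  shows "(\<lambda>j. gcoeff ((M ^\<^sub>m j) $$ (i, k)) A / fact j) sums gcoeff (mexp M $$ (i, k)) A"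
  using summable_sums[OF summable_mexp[OF assms]] assms
  by (simp add: mexp_def Abs_grassmann_inverse)

definition supertranspose :: "nat \<Rightarrow> grassmann mat \<Rightarrow> grassmann mat" where
  "supertranspose m M = (case split_block M m m of (A, B, C, D) \<Rightarrow>
     four_block_mat A\<^sup>T C\<^sup>T (- B\<^sup>T) D\<^sup>T)"

text \<open>Both inverses below are meaningful only when they exist; they are then unique.\<close>

definition mat_inv :: "grassmann mat \<Rightarrow> grassmann mat" where
  "mat_inv D = (THE E. E \<in> carrier_mat (dim_row D) (dim_row D) \<and>
     inverts_mat D E \<and> inverts_mat E D)"

definition ev_inv :: "grassmann_ev \<Rightarrow> grassmann_ev" where
  "ev_inv d = (THE e. d * e = 1)"

text \<open>
  For a supermatrix, the entries of \<open>A - B D\<^sup>-\<^sup>1 C\<close> and of \<open>D\<close> are even, so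
  \<^const>\<open>even_part\<close> only changes their type.
\<close>

definition sdet :: "nat \<Rightarrow> grassmann mat \<Rightarrow> grassmann_ev" where
  "sdet m M = (case split_block M m m of (A, B, C, D) \<Rightarrow>
     det (map_mat even_part (A - B * mat_inv D * C)) * ev_inv (det (map_mat even_part D)))"

definition Omega :: "nat \<Rightarrow> real mat" where
  "Omega n = diag_block_mat (replicate n (mat_of_rows_list 2 [[0, 1], [- 1, 0]]))"

definition Qmat :: "nat \<Rightarrow> nat \<Rightarrow> grassmann mat" where
  "Qmat m n = real_mat (four_block_mat (1\<^sub>m m) (0\<^sub>m m (2 * n)) (0\<^sub>m (2 * n) m)
     ((- 1 / 2) \<cdot>\<^sub>m Omega n))"

definition O0 :: "nat \<Rightarrow> nat \<Rightarrow> nat \<Rightarrow> grassmann mat set" where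
  "O0 m n N = {M \<in> SMat m n N.
     supertranspose m M * Qmat m n * M - Qmat m n = 0\<^sub>m (m + 2 * n) (m + 2 * n)}"

definition SO0 :: "nat \<Rightarrow> nat \<Rightarrow> nat \<Rightarrow> grassmann mat set" where
  "SO0 m n N = {M \<in> O0 m n N. sdet m M = 1}"

definition so0 :: "nat \<Rightarrow> nat \<Rightarrow> nat \<Rightarrow> grassmann mat set" where
  "so0 m n N = {X \<in> SMat m n N.
     supertranspose m X * Qmat m n + Qmat m n * X = 0\<^sub>m (m + 2 * n) (m + 2 * n)}"

definition so0_plus :: "nat \<Rightarrow> nat \<Rightarrow> nat \<Rightarrow> grassmann mat set" where
  "so0_plus m n N = so0 m n N \<inter> SMat_plus m n N"

definition so_alg :: "nat \<Rightarrow> real mat set" where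
  "so_alg p = {X \<in> carrier_mat p p. X\<^sup>T = - X}"

definition Sym :: "nat \<Rightarrow> real mat set" where
  "Sym p = {X \<in> carrier_mat p p. X\<^sup>T = X}"

definition sp_alg :: "nat \<Rightarrow> real mat set" where
  "sp_alg n = {D \<in> carrier_mat (2 * n) (2 * n).
     D\<^sup>T * Omega n + Omega n * D = 0\<^sub>m (2 * n) (2 * n)}"

definition block_prod :: "real mat set \<Rightarrow> real mat set \<Rightarrow> grassmann mat set" where
  "block_prod S T = {real_mat (diag_block_mat [X, Y]) | X Y. X \<in> S \<and> Y \<in> T}"

end

theory Submission
  imports Defs "Jordan_Normal_Form.Spectral_Radius"
begin

text \<open>
  Split \<open>M\<close> into its body (the real matrix of the coefficients of \<open>f\<^sub>\<emptyset>\<close>) and the rest.  Odd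
  elements have no body, so the body of \<open>M\<close> is block diagonal with blocks \<open>A\<close> and \<open>D\<close>, and the
  equation defining \<open>O0\<close> says that \<open>A\<close> is orthogonal and \<open>D\<close> is symplectic.  The factors
  \<open>e\<^sup>X e\<^sup>Y\<close> have to reproduce the body, and \<open>e\<^sup>Z\<close> accounts for everything else.

  For the body, the symplectic block has a polar decomposition \<open>D = U e\<^sup>Y\<close>.  The symmetric factor
  comes from a logarithm of \<open>D\<^sup>T D\<close>; symmetric logarithms are unique (\<open>rexp_symmetric_inj\<close>), which
  forces \<open>Y\<close> into the symplectic Lie algebra and \<open>U\<close> to commute with \<open>\<Omega>\<close>
  (\<open>symplectic_polar\<close>).  An orthogonal matrix \<open>R\<close> is put into the form \<open>cos \<Theta> + K\<close> with \<open>\<Theta>\<close>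
  diagonal and \<open>K\<close> skew; rescaling \<open>K\<close> gives a skew logarithm, except on the eigenspace of \<open>-1\<close>,
  where a complex structure times \<open>\<pi>\<close> is used (\<open>orthogonal_log_diag\<close>).  For \<open>U\<close> the complex
  structure is \<open>\<Omega>\<close>, and the logarithm commutes with it (\<open>unitary_log\<close>).  For \<open>A\<close> one exists as soon
  as the eigenspace has even dimension, that is, if \<open>det A > 0\<close> (\<open>special_orthogonal_log\<close>).  This
  sign is what the superdeterminant provides: \<open>sdet M = 1\<close> gives \<open>det A = det D\<close>, and
  \<open>det D > 0\<close> because the determinant of a real exponential is a square.

  What remains is a supermatrix \<open>L\<close> in \<open>O0\<close> with body \<open>1\<close>.  On matrices without body the
  exponential series is triangular for the filtration by degree: changing the argument in
  degree \<open>r\<close> changes the value in degree \<open>r\<close> by the same amount (\<open>mexp_first_order\<close>).  Hence the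
  exponential is injective there, and since degrees above \<open>N\<close> vanish, \<open>N\<close> corrections produce
  a logarithm \<open>Z\<close> of \<open>L\<close> (\<open>mexp_log\<close>).  Injectivity also turns the group equation for \<open>L\<close> into
  the Lie algebra equation for \<open>Z\<close>: the matrices \<open>Q\<^sup>-\<^sup>1 Z\<^sup>S\<^sup>T Q\<close> and \<open>- Z\<close> have the same
  exponential \<open>L\<^sup>-\<^sup>1\<close> (\<open>log_in_so0\<close>).

  For uniqueness, write \<open>B\<close> for the body of \<open>M\<close>.  Then \<open>B\<^sup>T B = e\<^sup>2\<^sup>Y\<close>, so \<open>Y\<close> is the unique symmetric
  logarithm, and \<open>e\<^sup>Z = B\<^sup>-\<^sup>1 M\<close> determines \<open>Z\<close>.
\<close>

section \<open>Coefficientwise convergence and the exponential series\<close>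

lemma mult_mat_entry:
  assumes "A \<in> carrier_mat p q" "B \<in> carrier_mat q r" "i < p" "k < r"
  shows "(A * B) $$ (i, k) = (\<Sum>l<q. A $$ (i, l) * B $$ (l, k))"
  using assms by (auto simp: scalar_prod_def atLeast0LessThan)

lemma pow_mat_add:
  fixes X :: "'a :: semiring_1 mat"
  assumes X: "X \<in> carrier_mat d d"
  shows "X ^\<^sub>m (p + q) = X ^\<^sub>m p * X ^\<^sub>m q"
proof (induction q)
  case 0
  then show ?case using X right_mult_one_mat[OF pow_carrier_mat[OF X, of p]] by simp
next
  case (Suc q)
  have "X ^\<^sub>m p * X ^\<^sub>m q * X = X ^\<^sub>m p * (X ^\<^sub>m q * X)"
    using X by (intro assoc_mult_mat[of _ d d _ d _ d]) auto
  with Suc show ?case by simp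
qed

lemma conj_pow_mat:
  fixes X :: "'a :: semiring_1 mat"
  assumes X: "X \<in> carrier_mat d d" and P: "P \<in> carrier_mat d d" and Q: "Q \<in> carrier_mat d d"
    and PQ: "P * Q = 1\<^sub>m d" and QP: "Q * P = 1\<^sub>m d"
  shows "(P * X * Q) ^\<^sub>m j = P * X ^\<^sub>m j * Q"
proof (induction j)
  case 0
  then show ?case using X P PQ by simp
next
  case (Suc j)
  have Xj: "X ^\<^sub>m j \<in> carrier_mat d d" using X by simp
  have "P * X ^\<^sub>m j * Q * (P * X * Q) = P * X ^\<^sub>m j * ((Q * P) * X) * Q"
    using X Xj P Q by (simp add: assoc_mult_mat[of _ d d _ d _ d] mult_carrier_mat[of _ d d])
  also have "\<dots> = P * (X ^\<^sub>m j * X) * Q"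
    unfolding QP using X Xj P Q by (simp add: assoc_mult_mat[of _ d d _ d _ d])
  finally show ?case using Suc by simp
qed

text \<open>
  Each coefficient of a product is a finite sum over subsets, so convergence of every
  coefficient is compatible with multiplication by a fixed element.
\<close>

definition gsums :: "(nat \<Rightarrow> grassmann) \<Rightarrow> grassmann \<Rightarrow> bool" where
  "gsums f x \<longleftrightarrow> (\<forall>A. (\<lambda>j. gcoeff (f j) A) sums gcoeff x A)"

lemma gsums_unique: "gsums f x \<Longrightarrow> gsums f y \<Longrightarrow> x = y"
  unfolding gsums_def by (rule grassmann_eqI) (metis sums_unique2)

lemma gsums_mult_left:
  assumes "gsums f x" shows "gsums (\<lambda>j. c * f j) (c * x)"
  using assms unfolding gsums_def times_grassmann.rep_eq
  by (intro allI sums_sum sums_mult) auto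

lemma gsums_mult_right:
  assumes "gsums f x" shows "gsums (\<lambda>j. f j * c) (x * c)"
  using assms unfolding gsums_def times_grassmann.rep_eq
  by (intro allI sums_sum sums_mult sums_mult2) auto

lemma gsums_sum: "(\<And>l. l \<in> L \<Longrightarrow> gsums (f l) (x l)) \<Longrightarrow> gsums (\<lambda>j. \<Sum>l\<in>L. f l j) (sum x L)"
  unfolding gsums_def gcoeff_sum by (intro allI sums_sum) auto

lemma gsums_minus: "gsums f x \<Longrightarrow> gsums (\<lambda>j. - f j) (- x)"
  unfolding gsums_def uminus_grassmann.rep_eq by (auto intro: sums_minus)

lemma mexp_carrier [simp]: "M \<in> carrier_mat d d \<Longrightarrow> mexp M \<in> carrier_mat d d"
  by (simp add: mexp_def)

lemma mexp_gsums:
  assumes "M \<in> carrier_mat d d" "i < d" "k < d"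
  shows "gsums (\<lambda>j. (1 / fact j) *\<^sub>R (M ^\<^sub>m j) $$ (i, k)) (mexp M $$ (i, k))"
  unfolding gsums_def scaleR_grassmann.rep_eq using gcoeff_mexp[OF assms] by simp

lemma mexpI:
  assumes "M \<in> carrier_mat d d" "E \<in> carrier_mat d d"
    and "\<And>i k. i < d \<Longrightarrow> k < d \<Longrightarrow> gsums (\<lambda>j. (1 / fact j) *\<^sub>R (M ^\<^sub>m j) $$ (i, k)) (E $$ (i, k))"
  shows "mexp M = E"
proof (rule eq_matI)
  fix i k assume "i < dim_row E" "k < dim_col E"
  then show "mexp M $$ (i, k) = E $$ (i, k)"
    using assms mexp_gsums[OF assms(1)] by (intro gsums_unique) auto
qed (use carrier_matD[OF mexp_carrier[OF assms(1)]] carrier_matD[OF assms(2)] in auto)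

lemma mexp_conj:
  assumes X: "X \<in> carrier_mat d d" and P: "P \<in> carrier_mat d d" and Q: "Q \<in> carrier_mat d d"
    and "P * Q = 1\<^sub>m d" "Q * P = 1\<^sub>m d"
  shows "mexp (P * X * Q) = P * mexp X * Q"
proof (rule mexpI)
  fix i k assume ik: "i < d" "k < d"
  have entry: "(P * Y * Q) $$ (i, k) = (\<Sum>l<d. (\<Sum>h<d. P $$ (i, h) * Y $$ (h, l)) * Q $$ (l, k))"
    if "Y \<in> carrier_mat d d" for Y
    using P Q that ik
    by (subst mult_mat_entry[of _ d d _ d]) (auto simp: mult_mat_entry[of P d d Y d] simp del: index_mult_mat(1))
  have "gsums (\<lambda>j. \<Sum>l<d. (\<Sum>h<d. P $$ (i, h) * ((1 / fact j) *\<^sub>R (X ^\<^sub>m j) $$ (h, l))) * Q $$ (l, k))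
      (\<Sum>l<d. (\<Sum>h<d. P $$ (i, h) * mexp X $$ (h, l)) * Q $$ (l, k))"
    using X by (intro gsums_sum gsums_mult_left gsums_mult_right mexp_gsums) auto
  then show "gsums (\<lambda>j. (1 / fact j) *\<^sub>R ((P * X * Q) ^\<^sub>m j) $$ (i, k)) ((P * mexp X * Q) $$ (i, k))"
    using X by (simp add: conj_pow_mat[OF assms] entry scaleR_sum_right flip: scaleR_sum_right[of _ _ "{..<d}"] mult_scaleR_left)
qed (use assms in auto)

subsection \<open>The law of exponents\<close>

abbreviation scale_mat :: "real \<Rightarrow> grassmann mat \<Rightarrow> grassmann mat" where
  "scale_mat a \<equiv> map_mat (scaleR a)"

lemma scale_pow_mat:
  assumes X: "X \<in> carrier_mat d d"
  shows "scale_mat a X ^\<^sub>m j = scale_mat (a ^ j) (X ^\<^sub>m j)"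
proof (induction j)
  case 0
  then show ?case using X by (intro eq_matI) auto
next
  case (Suc j)
  have Xj: "X ^\<^sub>m j \<in> carrier_mat d d" using X by simp
  show ?case unfolding pow_mat.simps Suc using X Xj
    by (intro eq_matI) (auto simp: mult_mat_entry[of _ d d _ d] scaleR_sum_right mult.commute
        simp del: index_mult_mat(1))
qed

lemma scale_pow_entry:
  assumes X: "X \<in> carrier_mat d d" and ik: "i < d" "k < d"
  shows "(scale_mat a X ^\<^sub>m j) $$ (i, k) = a ^ j *\<^sub>R (X ^\<^sub>m j) $$ (i, k)"
  using carrier_matD[OF pow_carrier_mat[OF X, of j]] ik by (simp add: scale_pow_mat[OF X])

text \<open>
  Coefficientwise, the series for \<open>2 X\<close> is the value at \<open>2\<close> of a power series whose value at \<open>1\<close>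
  is the series for \<open>X\<close>, and a power series converges absolutely strictly inside its disc.
\<close>

lemma mexp_series_abs_summable:
  assumes X: "X \<in> carrier_mat d d" and ik: "i < d" "k < d"
  shows "summable (\<lambda>j. norm (gcoeff ((1 / fact j) *\<^sub>R (X ^\<^sub>m j) $$ (i, k)) A))"
proof -
  have "summable (\<lambda>j. gcoeff ((scale_mat 2 X ^\<^sub>m j) $$ (i, k)) A / fact j)"
    using X ik by (intro summable_mexp) auto
  then have "summable (\<lambda>j. (gcoeff ((X ^\<^sub>m j) $$ (i, k)) A / fact j) * 2 ^ j)"
    by (simp add: scale_pow_entry[OF X ik] scaleR_grassmann.rep_eq mult.commute)
  from powser_insidea[OF this, of 1] show ?thesis
    by (simp add: scaleR_grassmann.rep_eq)
qed

lemma exp_binomial: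
  fixes a b :: real
  shows "(\<Sum>p\<le>j. (a ^ p / fact p) * (b ^ (j - p) / fact (j - p))) = (a + b) ^ j / fact j"
  unfolding binomial_ring sum_divide_distrib
  by (intro sum.cong) (auto simp: binomial_fact field_simps)

text \<open>
  The Cauchy product of the two series, taken in every coefficient, is summed by the binomial
  theorem.
\<close>

lemma mexp_add_scale:
  assumes X: "X \<in> carrier_mat d d"
  shows "mexp (scale_mat (a + b) X) = mexp (scale_mat a X) * mexp (scale_mat b X)"
proof (rule mexpI)
  fix i k assume ik: "i < d" "k < d"
  have aX: "scale_mat a X \<in> carrier_mat d d" and bX: "scale_mat b X \<in> carrier_mat d d"
    using X by auto
  have Xp: "X ^\<^sub>m p \<in> carrier_mat d d" for p using X by simp
  define c where "c p l = (1 / fact p) *\<^sub>R (scale_mat a X ^\<^sub>m p) $$ (i, l)" for p l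
  define e where "e q l = (1 / fact q) *\<^sub>R (scale_mat b X ^\<^sub>m q) $$ (l, k)" for q l
  show "gsums (\<lambda>j. (1 / fact j) *\<^sub>R (scale_mat (a + b) X ^\<^sub>m j) $$ (i, k))
      ((mexp (scale_mat a X) * mexp (scale_mat b X)) $$ (i, k))"
    unfolding gsums_def
  proof
    fix A
    have "(\<lambda>j. \<Sum>p\<le>j. gcoeff (c p l) B * gcoeff (e (j - p) l) C) sums
        (gcoeff (mexp (scale_mat a X) $$ (i, l)) B * gcoeff (mexp (scale_mat b X) $$ (l, k)) C)"
      if l: "l < d" for l B C
    proof -
      have "(\<lambda>p. gcoeff (c p l) B) sums gcoeff (mexp (scale_mat a X) $$ (i, l)) B"
        and "(\<lambda>q. gcoeff (e q l) C) sums gcoeff (mexp (scale_mat b X) $$ (l, k)) C"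
        using mexp_gsums[OF aX ik(1) l] mexp_gsums[OF bX l ik(2)]
        unfolding gsums_def c_def e_def by blast+
      moreover have "summable (\<lambda>p. norm (gcoeff (c p l) B))"
        "summable (\<lambda>q. norm (gcoeff (e q l) C))"
        unfolding c_def e_def using mexp_series_abs_summable aX bX ik l by blast+
      ultimately show ?thesis
        using Cauchy_product_sums[of "\<lambda>p. gcoeff (c p l) B" "\<lambda>q. gcoeff (e q l) C"]
        by (simp add: sums_iff)
    qed
    then have "(\<lambda>j. \<Sum>l<d. \<Sum>B\<in>Pow A. shuffle_sign B (A - B) *
          (\<Sum>p\<le>j. gcoeff (c p l) B * gcoeff (e (j - p) l) (A - B))) sums
        (\<Sum>l<d. \<Sum>B\<in>Pow A. shuffle_sign B (A - B) *
          (gcoeff (mexp (scale_mat a X) $$ (i, l)) B *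
           gcoeff (mexp (scale_mat b X) $$ (l, k)) (A - B)))"
      by (intro sums_sum sums_mult) auto
    also have "(\<lambda>j. \<Sum>l<d. \<Sum>B\<in>Pow A. shuffle_sign B (A - B) *
          (\<Sum>p\<le>j. gcoeff (c p l) B * gcoeff (e (j - p) l) (A - B))) =
        (\<lambda>j. \<Sum>p\<le>j. gcoeff (\<Sum>l<d. c p l * e (j - p) l) A)"
    proof
      fix j
      have "(\<Sum>l<d. \<Sum>B\<in>Pow A. \<Sum>p\<le>j. shuffle_sign B (A - B) * gcoeff (c p l) B * gcoeff (e (j - p) l) (A - B))
        = (\<Sum>p\<le>j. \<Sum>l<d. \<Sum>B\<in>Pow A. shuffle_sign B (A - B) * gcoeff (c p l) B * gcoeff (e (j - p) l) (A - B))"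
      proof -
        have "(\<Sum>B\<in>Pow A. \<Sum>p\<le>j. shuffle_sign B (A - B) * gcoeff (c p l) B * gcoeff (e (j - p) l) (A - B))
          = (\<Sum>p\<le>j. \<Sum>B\<in>Pow A. shuffle_sign B (A - B) * gcoeff (c p l) B * gcoeff (e (j - p) l) (A - B))" for l
          by (rule sum.swap)
        then show ?thesis by (simp only:) (rule sum.swap)
      qed
      then show "(\<Sum>l<d. \<Sum>B\<in>Pow A. shuffle_sign B (A - B) *
          (\<Sum>p\<le>j. gcoeff (c p l) B * gcoeff (e (j - p) l) (A - B))) =
          (\<Sum>p\<le>j. gcoeff (\<Sum>l<d. c p l * e (j - p) l) A)"
        by (simp add: gcoeff_sum times_grassmann.rep_eq sum_distrib_left mult.assoc)
    qed
    also have "\<dots> = (\<lambda>j. gcoeff ((1 / fact j) *\<^sub>R (scale_mat (a + b) X ^\<^sub>m j) $$ (i, k)) A)"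
    proof
      fix j
      have "(\<Sum>l<d. c p l * e (j - p) l) =
          ((a ^ p / fact p) * (b ^ (j - p) / fact (j - p))) *\<^sub>R (X ^\<^sub>m j) $$ (i, k)"
        if "p \<le> j" for p
      proof -
        have "(X ^\<^sub>m j) $$ (i, k) = (X ^\<^sub>m p * X ^\<^sub>m (j - p)) $$ (i, k)"
          using pow_mat_add[OF X, of p "j - p"] that by simp
        also have "\<dots> = (\<Sum>l<d. (X ^\<^sub>m p) $$ (i, l) * (X ^\<^sub>m (j - p)) $$ (l, k))"
          using ik Xp by (intro mult_mat_entry)
        finally show ?thesis
          using ik Xp unfolding c_def e_def
          by (auto simp: scale_pow_entry[OF X] scaleR_sum_right mult.commute intro!: sum.cong)
      qed
      then have "(\<Sum>p\<le>j. gcoeff (\<Sum>l<d. c p l * e (j - p) l) A) =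
          (\<Sum>p\<le>j. (a ^ p / fact p) * (b ^ (j - p) / fact (j - p))) * gcoeff ((X ^\<^sub>m j) $$ (i, k)) A"
        by (simp add: scaleR_grassmann.rep_eq sum_distrib_right)
      then show "(\<Sum>p\<le>j. gcoeff (\<Sum>l<d. c p l * e (j - p) l) A) =
          gcoeff ((1 / fact j) *\<^sub>R (scale_mat (a + b) X ^\<^sub>m j) $$ (i, k)) A"
        unfolding exp_binomial scale_pow_entry[OF X ik] by (simp add: scaleR_grassmann.rep_eq)
    qed
    also have "(\<Sum>l<d. \<Sum>B\<in>Pow A. shuffle_sign B (A - B) *
          (gcoeff (mexp (scale_mat a X) $$ (i, l)) B *
           gcoeff (mexp (scale_mat b X) $$ (l, k)) (A - B))) =
        gcoeff ((mexp (scale_mat a X) * mexp (scale_mat b X)) $$ (i, k)) A"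
      using mult_mat_entry[OF mexp_carrier[OF aX] mexp_carrier[OF bX] ik]
      by (simp add: gcoeff_sum times_grassmann.rep_eq mult.assoc)
    finally show "(\<lambda>j. gcoeff ((1 / fact j) *\<^sub>R (scale_mat (a + b) X ^\<^sub>m j) $$ (i, k)) A) sums
        gcoeff ((mexp (scale_mat a X) * mexp (scale_mat b X)) $$ (i, k)) A" .
  qed
qed (use X in \<open>auto intro!: mult_carrier_mat[of _ d d]\<close>)

lemma mexp_zero: "mexp (0\<^sub>m d d) = 1\<^sub>m d"
proof (rule mexpI)
  fix i k assume ik: "i < d" "k < d"
  have "(0\<^sub>m d d :: grassmann mat) ^\<^sub>m Suc j = 0\<^sub>m d d" for j
    using right_mult_zero_mat[OF pow_carrier_mat, of "0\<^sub>m d d" d j d] by simp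
  then have "(0\<^sub>m d d :: grassmann mat) ^\<^sub>m j = (if j = 0 then 1\<^sub>m d else 0\<^sub>m d d)" for j
    by (cases j) auto
  then have "(\<lambda>j. gcoeff ((1 / fact j) *\<^sub>R ((0\<^sub>m d d) ^\<^sub>m j) $$ (i, k)) A) =
      (\<lambda>j. if j = 0 then gcoeff (1\<^sub>m d $$ (i, k)) A else 0)" for A
    using ik by (auto simp: fun_eq_iff zero_grassmann.rep_eq)
  then show "gsums (\<lambda>j. (1 / fact j) *\<^sub>R ((0\<^sub>m d d) ^\<^sub>m j) $$ (i, k)) (1\<^sub>m d $$ (i, k))"
    unfolding gsums_def using sums_single[of 0 "\<lambda>_. gcoeff (1\<^sub>m d $$ (i, k)) _"] by metis
qed auto

lemma mexp_uminus:
  assumes X: "X \<in> carrier_mat d d"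
  shows "mexp (- X) * mexp X = 1\<^sub>m d" "mexp X * mexp (- X) = 1\<^sub>m d"
proof -
  have eq: "scale_mat (- 1) X = - X" "scale_mat 1 X = X" "scale_mat 0 X = 0\<^sub>m d d"
    using X by (auto intro!: eq_matI)
  show "mexp (- X) * mexp X = 1\<^sub>m d"
    using mexp_add_scale[OF X, of "- 1" 1] by (simp add: eq mexp_zero)
  show "mexp X * mexp (- X) = 1\<^sub>m d"
    using mexp_add_scale[OF X, of 1 "- 1"] by (simp add: eq mexp_zero)
qed

section \<open>Supermatrices entrywise\<close>

text \<open>
  The even part of \<open>\<Lambda>\<^sub>N\<close> for \<open>e = True\<close> and the odd part for \<open>e = False\<close>; as a predicate on
  coefficients it treats both parities at once, with \<open>e = f\<close> as the parity of a product.
\<close>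

definition parity_supported :: "nat \<Rightarrow> bool \<Rightarrow> grassmann \<Rightarrow> bool" where
  "parity_supported N e x \<longleftrightarrow> (\<forall>A. gcoeff x A \<noteq> 0 \<longrightarrow> A \<subseteq> {1..N} \<and> even (card A) = e)"

lemma Lambda_ev_iff: "x \<in> Lambda_ev N \<longleftrightarrow> parity_supported N True x"
  unfolding Lambda_ev_def parity_supported_def by (subst span_gmon) auto

lemma Lambda_odd_iff: "x \<in> Lambda_odd N \<longleftrightarrow> parity_supported N False x"
  unfolding Lambda_odd_def parity_supported_def by (subst span_gmon) auto

lemma Lambda_plus_iff:
  "x \<in> Lambda_plus N \<longleftrightarrow> gcoeff x {} = 0 \<and> (\<forall>A. gcoeff x A \<noteq> 0 \<longrightarrow> A \<subseteq> {1..N})"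
proof -
  have "card A \<ge> 1 \<longleftrightarrow> A \<noteq> {}" if "A \<subseteq> {1..N}" for A
    using that finite_subset[OF that] by (simp add: card_gt_0_iff Suc_le_eq)
  then show ?thesis
    unfolding Lambda_plus_def by (subst span_gmon) auto
qed

lemma parity_supported_mult:
  assumes "parity_supported N e x" "parity_supported N f y"
  shows "parity_supported N (e = f) (x * y)"
  unfolding parity_supported_def
proof (intro allI impI)
  fix A assume "gcoeff (x * y) A \<noteq> 0"
  then obtain B where "B \<in> Pow A" "shuffle_sign B (A - B) * gcoeff x B * gcoeff y (A - B) \<noteq> 0"
    unfolding times_grassmann.rep_eq by (rule sum.not_neutral_contains_not_neutral)
  then have B: "B \<subseteq> A" "gcoeff x B \<noteq> 0" "gcoeff y (A - B) \<noteq> 0" by auto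
  with assms have *: "B \<subseteq> {1..N}" "even (card B) = e" "A - B \<subseteq> {1..N}" "even (card (A - B)) = f"
    unfolding parity_supported_def by blast+
  then have fin: "finite B" "finite (A - B)" by (meson finite_atLeastAtMost finite_subset)+
  have "A = B \<union> (A - B)" using B by auto
  then have "card A = card B + card (A - B)"
    using fin by (metis Diff_disjoint card_Un_disjoint)
  with * B show "A \<subseteq> {1..N} \<and> even (card A) = (e = f)" by auto
qed

lemma parity_supported_sum:
  "(\<And>l. l \<in> L \<Longrightarrow> parity_supported N e (x l)) \<Longrightarrow> parity_supported N e (sum x L)"
  unfolding parity_supported_def gcoeff_sum
proof (intro allI impI)
  fix A assume *: "\<And>l. l \<in> L \<Longrightarrow> \<forall>A. gcoeff (x l) A \<noteq> 0 \<longrightarrow> A \<subseteq> {1..N} \<and> even (card A) = e"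
    and "(\<Sum>l\<in>L. gcoeff (x l) A) \<noteq> 0"
  then obtain l where "l \<in> L" "gcoeff (x l) A \<noteq> 0"
    by (auto elim!: sum.not_neutral_contains_not_neutral)
  with * show "A \<subseteq> {1..N} \<and> even (card A) = e" by blast
qed

lemma parity_supported_add:
  assumes "parity_supported N e x" "parity_supported N e y"
  shows "parity_supported N e (x + y)"
  unfolding parity_supported_def
proof (intro allI impI)
  fix A assume "gcoeff (x + y) A \<noteq> 0"
  then have "gcoeff x A \<noteq> 0 \<or> gcoeff y A \<noteq> 0" by (auto simp: plus_grassmann.rep_eq)
  with assms show "A \<subseteq> {1..N} \<and> even (card A) = e" unfolding parity_supported_def by blast
qed

lemma parity_supported_uminus: "parity_supported N e x \<Longrightarrow> parity_supported N e (- x)"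
  by (simp add: parity_supported_def uminus_grassmann.rep_eq)

lemma parity_supported_gsums:
  assumes "gsums f x" "\<And>j. parity_supported N e (f j)"
  shows "parity_supported N e x"
  unfolding parity_supported_def
proof (intro allI impI, rule ccontr)
  fix A assume A: "gcoeff x A \<noteq> 0" and "\<not> (A \<subseteq> {1..N} \<and> even (card A) = e)"
  then have "gcoeff (f j) A = 0" for j using assms(2) unfolding parity_supported_def by blast
  then have "(\<lambda>j. 0 :: real) = (\<lambda>j. gcoeff (f j) A)" by simp
  then have "(\<lambda>j. 0 :: real) sums gcoeff x A" using assms(1) unfolding gsums_def by metis
  with A show False using sums_unique2 sums_zero by blast
qed

lemma supercommute:
  assumes x: "parity_supported N e x" and y: "parity_supported N f y"
  shows "y * x = (if e \<or> f then x * y else - (x * y))"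
proof (rule grassmann_eqI)
  fix A :: "nat set" assume A: "finite A"
  have "gcoeff (y * x) A =
      (\<Sum>B\<in>Pow A. (if e \<or> f then 1 else - 1) * (shuffle_sign B (A - B) * gcoeff x B * gcoeff y (A - B)))"
    unfolding times_grassmann.rep_eq
  proof (rule sum.reindex_bij_witness[where i = "\<lambda>B. A - B" and j = "\<lambda>B. A - B"])
    fix B assume B: "B \<in> Pow A"
    then have *: "A - (A - B) = B" by auto
    have fin: "finite B" "finite (A - B)" using A B by (auto intro: finite_subset)
    show "(if e \<or> f then 1 else - 1) * (shuffle_sign (A - B) (A - (A - B)) * gcoeff x (A - B) *
        gcoeff y (A - (A - B))) = shuffle_sign B (A - B) * gcoeff y B * gcoeff x (A - B)"
    proof (cases "gcoeff x (A - B) = 0 \<or> gcoeff y B = 0")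
      case False
      then have "even (card (A - B)) = e" "even (card B) = f"
        using x y unfolding parity_supported_def by blast+
      then show ?thesis
        unfolding * using shuffle_sign_swap[OF fin] by (auto simp: uminus_power_if)
    qed (auto simp: *)
  qed auto
  also have "\<dots> = gcoeff (if e \<or> f then x * y else - (x * y)) A"
    by (simp add: times_grassmann.rep_eq uminus_grassmann.rep_eq sum_negf)
  finally show "gcoeff (y * x) A = gcoeff (if e \<or> f then x * y else - (x * y)) A" .
qed

text \<open>
  The parity of an entry depends only on whether its row and its column lie on the same side
  of \<open>m\<close>.  In this form closure properties are proved entry by entry, without case
  distinctions on the four blocks.
\<close>

lemma SMat_iff:
  "M \<in> SMat m n N \<longleftrightarrow> M \<in> carrier_mat (m + 2 * n) (m + 2 * n) \<and>
    (\<forall>i < m + 2 * n. \<forall>k < m + 2 * n. parity_supported N ((i < m) = (k < m)) (M $$ (i, k)))"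
    (is "_ \<longleftrightarrow> ?R")
proof
  assume "M \<in> SMat m n N"
  then obtain A B C D where M: "M = four_block_mat A B C D"
    and A: "A \<in> carrier_mat m m" "elements_mat A \<subseteq> Lambda_ev N"
    and B: "B \<in> carrier_mat m (2 * n)" "elements_mat B \<subseteq> Lambda_odd N"
    and C: "C \<in> carrier_mat (2 * n) m" "elements_mat C \<subseteq> Lambda_odd N"
    and D: "D \<in> carrier_mat (2 * n) (2 * n)" "elements_mat D \<subseteq> Lambda_ev N"
    unfolding SMat_def by (elim CollectE exE conjE) (rule that)
  have dims: "dim_row A = m" "dim_col A = m" "dim_row D = 2 * n" "dim_col D = 2 * n"
    "dim_row B = m" "dim_col B = 2 * n" "dim_row C = 2 * n" "dim_col C = m"
    using A B C D by auto
  have el: "A $$ (i, k) \<in> Lambda_ev N" if "i < m" "k < m" for i k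
    using A that dims elements_matI by (metis subsetD)
  moreover have "B $$ (i, k) \<in> Lambda_odd N" if "i < m" "k < 2 * n" for i k
    using B that dims elements_matI by (metis subsetD)
  moreover have "C $$ (i, k) \<in> Lambda_odd N" if "i < 2 * n" "k < m" for i k
    using C that dims elements_matI by (metis subsetD)
  moreover have "D $$ (i, k) \<in> Lambda_ev N" if "i < 2 * n" "k < 2 * n" for i k
    using D that dims elements_matI by (metis subsetD)
  ultimately show ?R
    unfolding M using A(1) B(1) C(1) D(1)
    by (auto simp: dims Lambda_ev_iff Lambda_odd_iff)
next
  assume R: ?R
  obtain A B C D where sp: "split_block M m m = (A, B, C, D)" by (metis prod_cases4)
  from R have "dim_row M = m + 2 * n" "dim_col M = m + 2 * n" by auto
  note s = split_block[OF sp this]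
  have el: "A = mat m m (\<lambda>ij. M $$ ij)" "B = mat m (2 * n) (\<lambda>(i, j). M $$ (i, j + m))"
    "C = mat (2 * n) m (\<lambda>(i, j). M $$ (i + m, j))"
    "D = mat (2 * n) (2 * n) (\<lambda>(i, j). M $$ (i + m, j + m))"
    using sp R unfolding split_block_def Let_def by auto
  have R': "parity_supported N ((i < m) = (k < m)) (M $$ (i, k))" if "i < m + 2 * n" "k < m + 2 * n" for i k
    using R that by blast
  have "elements_mat A \<subseteq> Lambda_ev N"
  proof
    fix x assume "x \<in> elements_mat A"
    then obtain i k where "i < m" "k < m" "x = M $$ (i, k)"
      unfolding el elements_mat_def by auto
    with R'[of i k] show "x \<in> Lambda_ev N" by (simp add: Lambda_ev_iff)
  qed
  moreover have "elements_mat B \<subseteq> Lambda_odd N"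
  proof
    fix x assume "x \<in> elements_mat B"
    then obtain i k where "i < m" "k < 2 * n" "x = M $$ (i, k + m)"
      unfolding el elements_mat_def by auto
    with R'[of i "k + m"] show "x \<in> Lambda_odd N" by (simp add: Lambda_odd_iff)
  qed
  moreover have "elements_mat C \<subseteq> Lambda_odd N"
  proof
    fix x assume "x \<in> elements_mat C"
    then obtain i k where "i < 2 * n" "k < m" "x = M $$ (i + m, k)"
      unfolding el elements_mat_def by auto
    with R'[of "i + m" k] show "x \<in> Lambda_odd N" by (simp add: Lambda_odd_iff)
  qed
  moreover have "elements_mat D \<subseteq> Lambda_ev N"
  proof
    fix x assume "x \<in> elements_mat D"
    then obtain i k where "i < 2 * n" "k < 2 * n" "x = M $$ (i + m, k + m)"
      unfolding el elements_mat_def by auto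
    with R'[of "i + m" "k + m"] show "x \<in> Lambda_ev N" by (simp add: Lambda_ev_iff)
  qed
  ultimately show "M \<in> SMat m n N" using s
    unfolding SMat_def mem_Collect_eq by (intro exI conjI)
qed

lemma SMat_carrier: "M \<in> SMat m n N \<Longrightarrow> M \<in> carrier_mat (m + 2 * n) (m + 2 * n)"
  by (simp add: SMat_iff)

lemma SMat_mult:
  assumes M: "M \<in> SMat m n N" and L: "L \<in> SMat m n N"
  shows "M * L \<in> SMat m n N"
  unfolding SMat_iff
proof (intro conjI allI impI)
  note car = SMat_carrier[OF M] SMat_carrier[OF L]
  show "M * L \<in> carrier_mat (m + 2 * n) (m + 2 * n)" using car by simp
  fix i k assume ik: "i < m + 2 * n" "k < m + 2 * n"
  show "parity_supported N ((i < m) = (k < m)) ((M * L) $$ (i, k))"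
    unfolding mult_mat_entry[OF car ik]
  proof (rule parity_supported_sum)
    fix l assume "l \<in> {..<m + 2 * n}"
    with M L ik have "parity_supported N (((i < m) = (l < m)) = ((l < m) = (k < m)))
        (M $$ (i, l) * L $$ (l, k))"
      unfolding SMat_iff by (intro parity_supported_mult) auto
    also have "(((i < m) = (l < m)) = ((l < m) = (k < m))) = ((i < m) = (k < m))" by auto
    finally show "parity_supported N ((i < m) = (k < m)) (M $$ (i, l) * L $$ (l, k))" .
  qed
qed

lemma SMat_one: "1\<^sub>m (m + 2 * n) \<in> SMat m n N"
  by (auto simp: SMat_iff parity_supported_def one_grassmann.rep_eq zero_grassmann.rep_eq
      split: if_splits)

lemma SMat_pow: "M \<in> SMat m n N \<Longrightarrow> M ^\<^sub>m j \<in> SMat m n N"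
proof (induction j)
  case 0
  then show ?case using SMat_carrier[of M m n N] SMat_one by (auto dest: carrier_matD)
qed (simp add: SMat_mult)

lemma SMat_mexp:
  assumes M: "M \<in> SMat m n N"
  shows "mexp M \<in> SMat m n N"
  unfolding SMat_iff
proof (intro conjI allI impI)
  note car = SMat_carrier[OF M]
  show "mexp M \<in> carrier_mat (m + 2 * n) (m + 2 * n)" using car by simp
  fix i k assume ik: "i < m + 2 * n" "k < m + 2 * n"
  show "parity_supported N ((i < m) = (k < m)) (mexp M $$ (i, k))"
  proof (rule parity_supported_gsums[OF mexp_gsums[OF car ik]])
    fix j
    show "parity_supported N ((i < m) = (k < m)) ((1 / fact j) *\<^sub>R (M ^\<^sub>m j) $$ (i, k))"
      using SMat_pow[OF M, of j] ik
      unfolding SMat_iff parity_supported_def scaleR_grassmann.rep_eq by auto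
  qed
qed

lemma SMat_add: "M \<in> SMat m n N \<Longrightarrow> L \<in> SMat m n N \<Longrightarrow> M + L \<in> SMat m n N"
  unfolding SMat_iff by (auto simp: parity_supported_add)

lemma SMat_uminus: "M \<in> SMat m n N \<Longrightarrow> - M \<in> SMat m n N"
  unfolding SMat_iff by (auto simp: parity_supported_uminus)

subsection \<open>The supertranspose\<close>

lemma supertranspose_carrier:
  "M \<in> carrier_mat (m + d) (m + d) \<Longrightarrow> supertranspose m M \<in> carrier_mat (m + d) (m + d)"
  by (auto simp: supertranspose_def split_block_def Let_def)

lemma supertranspose_entry:
  assumes "M \<in> carrier_mat (m + d) (m + d)" "i < m + d" "k < m + d"
  shows "supertranspose m M $$ (i, k) = (if \<not> i < m \<and> k < m then - M $$ (k, i) else M $$ (k, i))"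
  using assms by (auto simp: supertranspose_def split_block_def Let_def)

text \<open>
  Two signs occur: one from the supertranspose and one from exchanging the factors
  of an entry product.  They agree for each of the eight positions of the two outer indices and
  the summation index relative to \<open>m\<close>.
\<close>

lemma supertranspose_mult:
  assumes M: "M \<in> SMat m n N" and L: "L \<in> SMat m n N"
  shows "supertranspose m (M * L) = supertranspose m L * supertranspose m M"
proof -
  let ?d = "m + 2 * n"
  note car = SMat_carrier[OF M] SMat_carrier[OF L]
  note st = supertranspose_carrier[OF car(1)] supertranspose_carrier[OF car(2)]
  have prodC: "M * L \<in> carrier_mat ?d ?d" using car by simp
  show ?thesis
  proof (rule eq_matI)
    fix i k assume "i < dim_row (supertranspose m L * supertranspose m M)"
      "k < dim_col (supertranspose m L * supertranspose m M)"
    with st have ik: "i < ?d" "k < ?d" by auto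
    have *: "supertranspose m L $$ (i, l) * supertranspose m M $$ (l, k) =
        (if \<not> i < m \<and> k < m then - (M $$ (k, l) * L $$ (l, i)) else M $$ (k, l) * L $$ (l, i))"
      if l: "l < ?d" for l
    proof -
      have "parity_supported N ((k < m) = (l < m)) (M $$ (k, l))"
        "parity_supported N ((l < m) = (i < m)) (L $$ (l, i))"
        using M L ik l unfolding SMat_iff by auto
      from supercommute[OF this] show ?thesis
        by (cases "i < m"; cases "k < m"; cases "l < m")
           (simp_all add: supertranspose_entry[OF car(1)] supertranspose_entry[OF car(2)] ik l)
    qed
    have "(supertranspose m L * supertranspose m M) $$ (i, k) =
        (\<Sum>l<?d. supertranspose m L $$ (i, l) * supertranspose m M $$ (l, k))"
      by (rule mult_mat_entry[OF st(2) st(1) ik])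
    also have "\<dots> = (if \<not> i < m \<and> k < m then - (M * L) $$ (k, i) else (M * L) $$ (k, i))"
      using * by (simp add: mult_mat_entry[OF car ik(2) ik(1)] sum_negf)
    finally show "supertranspose m (M * L) $$ (i, k) = (supertranspose m L * supertranspose m M) $$ (i, k)"
      using supertranspose_entry[OF prodC ik] by simp
  qed (use st supertranspose_carrier[OF prodC] in auto)
qed

lemma supertranspose_one: "supertranspose m (1\<^sub>m (m + d)) = 1\<^sub>m (m + d)"
proof (rule eq_matI)
  fix i k assume "i < dim_row (1\<^sub>m (m + d))" "k < dim_col (1\<^sub>m (m + d))"
  then have ik: "i < m + d" "k < m + d" by auto
  show "supertranspose m (1\<^sub>m (m + d)) $$ (i, k) = 1\<^sub>m (m + d) $$ (i, k)"
    using ik by (subst supertranspose_entry[OF one_carrier_mat ik]) auto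
qed (use supertranspose_carrier[of "1\<^sub>m (m + d)" m d] in auto)

lemma supertranspose_pow:
  assumes M: "M \<in> SMat m n N"
  shows "supertranspose m (M ^\<^sub>m j) = supertranspose m M ^\<^sub>m j"
proof (induction j)
  case 0
  then show ?case using SMat_carrier[OF M] supertranspose_carrier[OF SMat_carrier[OF M]]
    by (auto simp: supertranspose_one dest!: carrier_matD)
next
  case (Suc j)
  note st = supertranspose_carrier[OF SMat_carrier[OF M]]
  have "supertranspose m (M ^\<^sub>m Suc j) = supertranspose m M * supertranspose m M ^\<^sub>m j"
    using supertranspose_mult[OF SMat_pow[OF M] M] Suc by simp
  also have "\<dots> = supertranspose m M ^\<^sub>m Suc j"
    using pow_mat_add[OF st, of 1 j] st by simp
  finally show ?case .
qed

lemma supertranspose_mexp: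
  assumes M: "M \<in> SMat m n N"
  shows "mexp (supertranspose m M) = supertranspose m (mexp M)"
proof (rule mexpI)
  note car = SMat_carrier[OF M]
  note st = supertranspose_carrier[OF car]
  show "supertranspose m M \<in> carrier_mat (m + 2 * n) (m + 2 * n)"
    "supertranspose m (mexp M) \<in> carrier_mat (m + 2 * n) (m + 2 * n)"
    using car by (auto intro: supertranspose_carrier)
  fix i k assume ik: "i < m + 2 * n" "k < m + 2 * n"
  note g = mexp_gsums[OF car ik(2) ik(1)]
  show "gsums (\<lambda>j. (1 / fact j) *\<^sub>R (supertranspose m M ^\<^sub>m j) $$ (i, k))
      (supertranspose m (mexp M) $$ (i, k))"
    using g gsums_minus[OF g]
    unfolding supertranspose_pow[OF M, symmetric] supertranspose_entry[OF mexp_carrier[OF car] ik]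
      supertranspose_entry[OF pow_carrier_mat[OF car] ik] by auto
qed

section \<open>The exponential map on matrices with vanishing body\<close>

text \<open>
  Congruence modulo the matrices whose entries have degree at least \<open>r\<close>.  Only finite \<open>A\<close> are
  compared, since the cardinality of an infinite set is \<open>0\<close>.
\<close>

definition agree_below :: "nat \<Rightarrow> nat \<Rightarrow> grassmann mat \<Rightarrow> grassmann mat \<Rightarrow> bool" where
  "agree_below d r X Y \<longleftrightarrow> (\<forall>i<d. \<forall>k<d. \<forall>A. finite A \<longrightarrow> card A < r \<longrightarrow>
     gcoeff (X $$ (i, k)) A = gcoeff (Y $$ (i, k)) A)"

definition bodiless :: "nat \<Rightarrow> grassmann mat \<Rightarrow> bool" where
  "bodiless d X \<longleftrightarrow> (\<forall>i<d. \<forall>k<d. gcoeff (X $$ (i, k)) {} = 0)"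

lemma gcoeff_mult_empty: "gcoeff (x * y) {} = gcoeff x {} * gcoeff y {}"
  by (simp add: times_grassmann.rep_eq)

lemma bodiless_mult:
  assumes "X \<in> carrier_mat d d" "Y \<in> carrier_mat d d" "bodiless d Y"
  shows "bodiless d (X * Y)"
  unfolding bodiless_def
proof (intro allI impI)
  fix i k assume "i < d" "k < d"
  then show "gcoeff ((X * Y) $$ (i, k)) {} = 0"
    using assms mult_mat_entry[OF assms(1,2), of i k]
    by (simp add: gcoeff_sum gcoeff_mult_empty bodiless_def)
qed

text \<open>
  A factor without body raises the degree by at least one, so a product of two such factors
  is determined one degree further than its factors.
\<close>

lemma agree_mult:
  assumes car: "X \<in> carrier_mat d d" "X' \<in> carrier_mat d d" "Y \<in> carrier_mat d d" "Y' \<in> carrier_mat d d"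
    and bl: "bodiless d X" "bodiless d X'" "bodiless d Y" "bodiless d Y'"
    and ag: "agree_below d r X X'" "agree_below d r Y Y'"
  shows "agree_below d (Suc r) (X * Y) (X' * Y')"
  unfolding agree_below_def
proof (intro allI impI)
  fix i k and A :: "nat set" assume ik: "i < d" "k < d" and A: "finite A" "card A < Suc r"
  have "gcoeff (X $$ (i, l) * Y $$ (l, k)) A = gcoeff (X' $$ (i, l) * Y' $$ (l, k)) A"
    if l: "l < d" for l
    unfolding times_grassmann.rep_eq
  proof (rule sum.cong[OF refl])
    fix B assume "B \<in> Pow A"
    then have B: "B \<subseteq> A" by simp
    consider "B = {}" | "B = A" | "B \<noteq> {}" "B \<noteq> A" by auto
    then show "shuffle_sign B (A - B) * gcoeff (X $$ (i, l)) B * gcoeff (Y $$ (l, k)) (A - B) =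
        shuffle_sign B (A - B) * gcoeff (X' $$ (i, l)) B * gcoeff (Y' $$ (l, k)) (A - B)"
    proof cases
      case 3
      then have "card B < card A" "card (A - B) < card A"
        using A(1) B by (auto intro!: psubset_card_mono)
      then show ?thesis
        using ag ik l A B finite_subset[OF B A(1)] unfolding agree_below_def by simp
    qed (use bl ik l in \<open>simp_all add: bodiless_def\<close>)
  qed
  then show "gcoeff ((X * Y) $$ (i, k)) A = gcoeff ((X' * Y') $$ (i, k)) A"
    unfolding mult_mat_entry[OF car(1,3) ik] mult_mat_entry[OF car(2,4) ik] gcoeff_sum
    by (intro sum.cong) auto
qed

lemma agree_mono: "agree_below d s X Y \<Longrightarrow> r \<le> s \<Longrightarrow> agree_below d r X Y"
  unfolding agree_below_def by auto

lemma agree_pow: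
  assumes car: "X \<in> carrier_mat d d" "X' \<in> carrier_mat d d"
    and bl: "bodiless d X" "bodiless d X'" and ag: "agree_below d r X X'"
  shows "agree_below d (Suc r) (X ^\<^sub>m (j + 2)) (X' ^\<^sub>m (j + 2)) \<and>
    bodiless d (X ^\<^sub>m (j + 1)) \<and> bodiless d (X' ^\<^sub>m (j + 1)) \<and>
    agree_below d r (X ^\<^sub>m (j + 1)) (X' ^\<^sub>m (j + 1))"
proof (induction j)
  case 0
  have "X ^\<^sub>m 1 = X" "X' ^\<^sub>m 1 = X'" using car by auto
  moreover have "X ^\<^sub>m 2 = X * X" "X' ^\<^sub>m 2 = X' * X'" using car by (auto simp: numeral_2_eq_2)
  ultimately show ?case using agree_mult[OF car car bl bl ag ag] bl ag by simp
next
  case (Suc j)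
  have c: "X ^\<^sub>m p \<in> carrier_mat d d" "X' ^\<^sub>m p \<in> carrier_mat d d" for p using car by auto
  from Suc have IH: "agree_below d (Suc r) (X ^\<^sub>m (j + 2)) (X' ^\<^sub>m (j + 2))"
    "bodiless d (X ^\<^sub>m (j + 1))" "bodiless d (X' ^\<^sub>m (j + 1))" by auto
  have b: "bodiless d (X ^\<^sub>m (Suc j + 1))" "bodiless d (X' ^\<^sub>m (Suc j + 1))"
    using bodiless_mult[OF c(1)[of "j + 1"] car(1) bl(1)] bodiless_mult[OF c(2)[of "j + 1"] car(2) bl(2)]
    by auto
  have a: "agree_below d r (X ^\<^sub>m (Suc j + 1)) (X' ^\<^sub>m (Suc j + 1))"
    using agree_mono[OF IH(1), of r] by simp
  have "agree_below d (Suc r) (X ^\<^sub>m (Suc j + 2)) (X' ^\<^sub>m (Suc j + 2))"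
    using agree_mult[OF c(1) c(2) car b bl a ag] by simp
  with a b show ?case by simp
qed

text \<open>
  If two matrices without body agree below degree \<open>r\<close>, then all powers except the first agree
  up to degree \<open>r\<close>, and only the linear term of the series sees the difference.
\<close>

lemma mexp_first_order:
  assumes car: "X \<in> carrier_mat d d" "X' \<in> carrier_mat d d"
    and bl: "bodiless d X" "bodiless d X'" and ag: "agree_below d r X X'"
    and ik: "i < d" "k < d" and A: "finite A" "card A \<le> r"
  shows "gcoeff (mexp X $$ (i, k)) A - gcoeff (mexp X' $$ (i, k)) A =
    gcoeff (X $$ (i, k)) A - gcoeff (X' $$ (i, k)) A"
proof -
  let ?f = "\<lambda>Y j. gcoeff ((1 / fact j) *\<^sub>R (Y ^\<^sub>m j) $$ (i, k)) A"
  have "?f X j - ?f X' j = (if j = 1 then gcoeff (X $$ (i, k)) A - gcoeff (X' $$ (i, k)) A else 0)" for j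
  proof -
    consider "j = 0" | "j = 1" | q where "j = q + 2"
      by (metis add_2_eq_Suc' not0_implies_Suc One_nat_def)
    then show ?thesis
    proof cases
      case 3
      then show ?thesis using agree_pow[OF car bl ag, of q] ik A
        unfolding agree_below_def by (auto simp: scaleR_grassmann.rep_eq)
    qed (use car in \<open>auto simp: scaleR_grassmann.rep_eq dest!: carrier_matD\<close>)
  qed
  then have "(\<lambda>j. ?f X j - ?f X' j) sums (gcoeff (X $$ (i, k)) A - gcoeff (X' $$ (i, k)) A)"
    using sums_single[of 1 "\<lambda>_. gcoeff (X $$ (i, k)) A - gcoeff (X' $$ (i, k)) A"] by simp
  moreover have "(\<lambda>j. ?f X j - ?f X' j) sums
      (gcoeff (mexp X $$ (i, k)) A - gcoeff (mexp X' $$ (i, k)) A)"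
    using mexp_gsums[OF car(1) ik] mexp_gsums[OF car(2) ik] unfolding gsums_def
    by (intro sums_diff) auto
  ultimately show ?thesis by (rule sums_unique2[symmetric])
qed

text \<open>
  Induction on the degree: the linear term recovers the next degree from the exponentials.
\<close>

lemma mexp_inj_bodiless:
  assumes car: "X \<in> carrier_mat d d" "X' \<in> carrier_mat d d"
    and bl: "bodiless d X" "bodiless d X'" and eq: "mexp X = mexp X'"
  shows "X = X'"
proof -
  have "agree_below d r X X'" for r
  proof (induction r)
    case 0
    show ?case by (simp add: agree_below_def)
  next
    case (Suc r)
    show ?case unfolding agree_below_def
    proof (intro allI impI)
      fix i k and A :: "nat set" assume "i < d" "k < d" "finite A" "card A < Suc r"
      with mexp_first_order[OF car bl Suc, of i k A]
      show "gcoeff (X $$ (i, k)) A = gcoeff (X' $$ (i, k)) A" by (simp add: eq)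
    qed
  qed
  then show ?thesis
    using car by (intro eq_matI) (auto intro!: grassmann_eqI simp: agree_below_def)
qed

text \<open>
  Replacing \<open>Z\<close> by \<open>Z + (L - e\<^sup>Z)\<close> corrects \<open>e\<^sup>Z\<close> in one further degree.  After \<open>N\<close> steps
  nothing is left to correct, because \<open>\<Lambda>\<^sub>N\<close> has no elements of degree above \<open>N\<close>.
\<close>

lemma mexp_log:
  assumes L: "L \<in> SMat m n N" and b1: "bodiless (m + 2 * n) (L - 1\<^sub>m (m + 2 * n))"
  obtains Z where "Z \<in> SMat m n N" "bodiless (m + 2 * n) Z" "mexp Z = L"
proof -
  let ?d = "m + 2 * n"
  have LC: "L \<in> carrier_mat ?d ?d" using L by (rule SMat_carrier)
  have zero: "0\<^sub>m ?d ?d \<in> SMat m n N" "bodiless ?d (0\<^sub>m ?d ?d)"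
    by (auto simp: SMat_iff parity_supported_def bodiless_def zero_grassmann.rep_eq)
  have ex: "\<exists>Z \<in> SMat m n N. bodiless ?d Z \<and> agree_below ?d (Suc r) (mexp Z) L" for r
  proof (induction r)
    case 0
    show ?case
    proof (intro bexI[OF _ zero(1)] conjI zero(2))
      have "gcoeff (L $$ (i, k)) {} = gcoeff (1\<^sub>m ?d $$ (i, k)) {}" if "i < ?d" "k < ?d" for i k
        using b1 that LC unfolding bodiless_def
        by (auto simp: minus_grassmann.rep_eq dest!: carrier_matD)
      then show "agree_below ?d (Suc 0) (mexp (0\<^sub>m ?d ?d)) L"
        unfolding mexp_zero agree_below_def by auto
    qed
  next
    case (Suc r)
    then obtain Z where Z: "Z \<in> SMat m n N" "bodiless ?d Z" and ag: "agree_below ?d (Suc r) (mexp Z) L"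
      by auto
    have ZC: "Z \<in> carrier_mat ?d ?d" "mexp Z \<in> carrier_mat ?d ?d"
      using Z SMat_carrier by auto
    define W where "W = Z + (L + - mexp Z)"
    have W: "W \<in> SMat m n N"
      unfolding W_def by (intro SMat_add SMat_uminus SMat_mexp Z L)
    have WC: "W \<in> carrier_mat ?d ?d" using W SMat_carrier by auto
    have We: "gcoeff (W $$ (i, k)) A = gcoeff (Z $$ (i, k)) A +
        (gcoeff (L $$ (i, k)) A - gcoeff (mexp Z $$ (i, k)) A)" if "i < ?d" "k < ?d" for i k A
      using that ZC LC carrier_matD[OF ZC(2)]
      by (simp add: W_def plus_grassmann.rep_eq minus_grassmann.rep_eq)
    have agZ: "agree_below ?d (Suc r) W Z"
      using ag We unfolding agree_below_def by simp
    then have bW: "bodiless ?d W"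
      using Z(2) unfolding agree_below_def bodiless_def by simp
    have "agree_below ?d (Suc (Suc r)) (mexp W) L"
      unfolding agree_below_def
    proof (intro allI impI)
      fix i k and A :: "nat set" assume *: "i < ?d" "k < ?d" "finite A" "card A < Suc (Suc r)"
      with mexp_first_order[OF WC ZC(1) bW Z(2) agZ, of i k A]
      show "gcoeff (mexp W $$ (i, k)) A = gcoeff (L $$ (i, k)) A"
        by (simp add: We)
    qed
    with W bW show ?case by blast
  qed
  then obtain Z where Z: "Z \<in> SMat m n N" "bodiless ?d Z" "agree_below ?d (Suc N) (mexp Z) L"
    by blast
  have eZ: "mexp Z \<in> SMat m n N" using Z by (intro SMat_mexp)
  have "mexp Z = L"
  proof (rule eq_matI)
    fix i k assume "i < dim_row L" "k < dim_col L"
    with LC have ik: "i < ?d" "k < ?d" by auto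
    show "mexp Z $$ (i, k) = L $$ (i, k)"
    proof (rule grassmann_eqI)
      fix A :: "nat set" assume A: "finite A"
      show "gcoeff (mexp Z $$ (i, k)) A = gcoeff (L $$ (i, k)) A"
      proof (cases "A \<subseteq> {1..N}")
        case True
        then have "card A \<le> card {1..N}" by (intro card_mono) auto
        then show ?thesis using Z(3) A ik unfolding agree_below_def by simp
      next
        case False
        then show ?thesis using eZ L ik unfolding SMat_iff parity_supported_def by metis
      qed
    qed
  qed (use LC SMat_carrier[OF eZ] in auto)
  with Z that show ?thesis by blast
qed

section \<open>The real matrix exponential\<close>

lemma mat_mult_eq_one_cancel:
  fixes A :: "'a :: semiring_1 mat"
  assumes "A * B = 1\<^sub>m d" "A \<in> carrier_mat d d" "B \<in> carrier_mat d d" "X \<in> carrier_mat d d"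
  shows "A * (B * X) = X"
  using assms by (metis assoc_mult_mat left_mult_one_mat)

text \<open>
  A constant of its own, so that simplification does not unfold the recursion of
  \<open>diag_block_mat\<close>.
\<close>

definition dsum :: "'a :: zero mat \<Rightarrow> 'a mat \<Rightarrow> 'a mat" where
  "dsum A B = diag_block_mat [A, B]"

lemma dsum_eq:
  assumes "A \<in> carrier_mat p p" "B \<in> carrier_mat q q"
  shows "dsum A B = four_block_mat A (0\<^sub>m p q) (0\<^sub>m q p) B"
proof -
  have "four_block_mat B (0\<^sub>m q 0) (0\<^sub>m 0 q) (0\<^sub>m 0 0) = B"
    using assms(2) by (intro eq_matI) auto
  then show ?thesis using assms by (simp add: dsum_def)
qed

lemma dsum_carrier:
  "A \<in> carrier_mat p p \<Longrightarrow> B \<in> carrier_mat q q \<Longrightarrow> dsum A B \<in> carrier_mat (p + q) (p + q)"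
  by (simp add: dsum_eq)

lemma dsum_entry:
  assumes "A \<in> carrier_mat p p" "B \<in> carrier_mat q q" "i < p + q" "k < p + q"
  shows "dsum A B $$ (i, k) = (if i < p then (if k < p then A $$ (i, k) else 0)
    else if k < p then 0 else B $$ (i - p, k - p))"
  using assms by (auto simp: dsum_eq[OF assms(1,2)])

lemma dsum_mult:
  fixes A B C D :: "'a :: semiring_1 mat"
  assumes "A \<in> carrier_mat p p" "B \<in> carrier_mat q q" "C \<in> carrier_mat p p" "D \<in> carrier_mat q q"
  shows "dsum A B * dsum C D = dsum (A * C) (B * D)"
  using assms
  by (simp add: dsum_eq[of _ p _ q] mult_four_block_mat[of _ p p _ q _ q _ _ p _ q])

lemma dsum_transpose:
  assumes "A \<in> carrier_mat p p" "B \<in> carrier_mat q q"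
  shows "(dsum A B)\<^sup>T = dsum A\<^sup>T B\<^sup>T"
  using assms by (simp add: dsum_eq[of _ p _ q] transpose_four_block_mat[of _ p p _ q _ q])

lemma dsum_one: "dsum (1\<^sub>m p) (1\<^sub>m q) = 1\<^sub>m (p + q)"
  by (rule eq_matI) (auto simp: dsum_eq[of _ p _ q])

lemma real_mat_carrier [simp]: "real_mat X \<in> carrier_mat p q \<longleftrightarrow> X \<in> carrier_mat p q"
  by (simp add: real_mat_def)

lemma real_mat_mult:
  assumes "X \<in> carrier_mat p q" "Y \<in> carrier_mat q r"
  shows "real_mat (X * Y) = real_mat X * real_mat Y"
  unfolding real_mat_def by (rule of_real_hom.mat_hom_mult[OF assms])

lemma real_mat_one: "real_mat (1\<^sub>m d) = 1\<^sub>m d"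
  by (rule eq_matI) (auto simp: real_mat_def)

lemma gcoeff_of_real: "gcoeff (of_real r) A = (if A = {} then r else 0)"
  by (simp add: of_real_def scaleR_grassmann.rep_eq one_grassmann.rep_eq)

definition body :: "grassmann mat \<Rightarrow> real mat" where
  "body = map_mat (\<lambda>x. gcoeff x {})"

lemma body_carrier [simp]: "body X \<in> carrier_mat p q \<longleftrightarrow> X \<in> carrier_mat p q"
  by (simp add: body_def)

lemma body_mult:
  assumes "X \<in> carrier_mat p q" "Y \<in> carrier_mat q r"
  shows "body (X * Y) = body X * body Y"
proof -
  interpret semiring_hom "\<lambda>x. gcoeff x {}"
    by unfold_locales
      (auto simp: gcoeff_mult_empty plus_grassmann.rep_eq zero_grassmann.rep_eq one_grassmann.rep_eq)
  show ?thesis unfolding body_def by (rule mat_hom_mult[OF assms])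
qed

lemma body_one: "body (1\<^sub>m d) = 1\<^sub>m d"
  by (rule eq_matI) (auto simp: body_def one_grassmann.rep_eq zero_grassmann.rep_eq)

lemma body_real_mat [simp]: "body (real_mat X) = X"
  by (rule eq_matI) (auto simp: body_def real_mat_def gcoeff_of_real)

lemma body_pow: "X \<in> carrier_mat d d \<Longrightarrow> body (X ^\<^sub>m j) = body X ^\<^sub>m j"
proof (induction j)
  case 0
  then have "body (X ^\<^sub>m 0) = 1\<^sub>m d" "body X ^\<^sub>m 0 = 1\<^sub>m d"
    using carrier_matD[of "body X" d d] by (auto simp: body_one)
  then show ?case by simp
qed (simp add: body_mult[of _ d d _ d])

lemma real_mat_pow: "X \<in> carrier_mat d d \<Longrightarrow> real_mat (X ^\<^sub>m j) = real_mat X ^\<^sub>m j"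
proof (induction j)
  case 0
  then have "real_mat (X ^\<^sub>m 0) = 1\<^sub>m d" "real_mat X ^\<^sub>m 0 = 1\<^sub>m d"
    using carrier_matD[of "real_mat X" d d] by (auto simp: real_mat_one)
  then show ?case by simp
qed (simp add: real_mat_mult[of _ d d _ d])

text \<open>
  The exponential of a real matrix.  Read off from the Grassmann exponential, it inherits
  the law of exponents; \<open>rexp_sums\<close> shows that it is the usual series.
\<close>

definition rexp :: "real mat \<Rightarrow> real mat" where
  "rexp X = body (mexp (real_mat X))"

lemma rexp_carrier [simp]: "X \<in> carrier_mat d d \<Longrightarrow> rexp X \<in> carrier_mat d d"
  by (simp add: rexp_def)

lemma body_mexp_sums:
  assumes M: "M \<in> carrier_mat d d" and ik: "i < d" "k < d"
  shows "(\<lambda>j. (body M ^\<^sub>m j) $$ (i, k) / fact j) sums (body (mexp M) $$ (i, k))"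
proof -
  have "gcoeff ((M ^\<^sub>m j) $$ (i, k)) {} = (body M ^\<^sub>m j) $$ (i, k)" for j
    unfolding body_pow[OF M, symmetric] using carrier_matD[OF pow_carrier_mat[OF M, of j]] ik
    by (simp add: body_def)
  moreover have "gcoeff (mexp M $$ (i, k)) {} = body (mexp M) $$ (i, k)"
    using carrier_matD[OF mexp_carrier[OF M]] ik by (simp add: body_def)
  ultimately show ?thesis using gcoeff_mexp[OF M ik, of "{}"] by simp
qed

lemma rexp_sums:
  assumes X: "X \<in> carrier_mat d d" and ik: "i < d" "k < d"
  shows "(\<lambda>j. (X ^\<^sub>m j) $$ (i, k) / fact j) sums (rexp X $$ (i, k))"
  using body_mexp_sums[of "real_mat X" d i k] assms by (simp add: rexp_def)

lemma rexpI:
  assumes "X \<in> carrier_mat d d" "E \<in> carrier_mat d d"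
    and "\<And>i k. i < d \<Longrightarrow> k < d \<Longrightarrow> (\<lambda>j. (X ^\<^sub>m j) $$ (i, k) / fact j) sums (E $$ (i, k))"
  shows "rexp X = E"
proof (rule eq_matI)
  fix i k assume "i < dim_row E" "k < dim_col E"
  then show "rexp X $$ (i, k) = E $$ (i, k)"
    using assms rexp_sums[OF assms(1)] sums_unique2 by (metis carrier_matD)
qed (use carrier_matD[OF rexp_carrier[OF assms(1)]] carrier_matD[OF assms(2)] in auto)

lemma body_mexp:
  assumes "M \<in> carrier_mat d d"
  shows "body (mexp M) = rexp (body M)"
  using assms by (intro rexpI[symmetric, of _ d] body_mexp_sums) auto

lemma mexp_real_mat:
  assumes X: "X \<in> carrier_mat d d"
  shows "mexp (real_mat X) = real_mat (rexp X)"
proof (rule mexpI)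
  fix i k assume ik: "i < d" "k < d"
  have "(real_mat X ^\<^sub>m j) $$ (i, k) = of_real ((X ^\<^sub>m j) $$ (i, k))" for j
    unfolding real_mat_pow[OF X, symmetric] using carrier_matD[OF pow_carrier_mat[OF X, of j]] ik
    by (simp add: real_mat_def)
  moreover have "real_mat (rexp X) $$ (i, k) = of_real (rexp X $$ (i, k))"
    using carrier_matD[OF rexp_carrier[OF X]] ik by (simp add: real_mat_def)
  ultimately show "gsums (\<lambda>j. (1 / fact j) *\<^sub>R (real_mat X ^\<^sub>m j) $$ (i, k)) (real_mat (rexp X) $$ (i, k))"
    unfolding gsums_def using rexp_sums[OF X ik]
    by (auto simp: scaleR_grassmann.rep_eq gcoeff_of_real)
qed (use X in auto)

lemma real_mat_smult: "real_mat (a \<cdot>\<^sub>m X) = scale_mat a (real_mat X)"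
  by (rule eq_matI) (auto simp: real_mat_def scaleR_conv_of_real)

lemma rexp_add_smult:
  assumes X: "X \<in> carrier_mat d d"
  shows "rexp ((a + b) \<cdot>\<^sub>m X) = rexp (a \<cdot>\<^sub>m X) * rexp (b \<cdot>\<^sub>m X)"
  using X mexp_add_scale[of "real_mat X" d a b]
  by (simp add: rexp_def real_mat_smult body_mult[of _ d d _ d])

lemma rexp_uminus:
  assumes X: "X \<in> carrier_mat d d"
  shows "rexp (- X) * rexp X = 1\<^sub>m d" "rexp X * rexp (- X) = 1\<^sub>m d"
proof -
  have "real_mat (- X) = - real_mat X" by (rule eq_matI) (auto simp: real_mat_def)
  then show "rexp (- X) * rexp X = 1\<^sub>m d" "rexp X * rexp (- X) = 1\<^sub>m d"
    using mexp_uminus[of "real_mat X" d] X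
    by (simp_all add: rexp_def body_one flip: body_mult[of _ d d _ d])
qed

lemma rexp_conj:
  assumes X: "X \<in> carrier_mat d d" and P: "P \<in> carrier_mat d d" and Q: "Q \<in> carrier_mat d d"
    and "P * Q = 1\<^sub>m d" "Q * P = 1\<^sub>m d"
  shows "rexp (P * X * Q) = P * rexp X * Q"
proof -
  have "real_mat P * real_mat Q = 1\<^sub>m d" "real_mat Q * real_mat P = 1\<^sub>m d"
    using assms by (simp_all add: real_mat_one flip: real_mat_mult[of _ d d _ d])
  then have "mexp (real_mat P * real_mat X * real_mat Q) = real_mat P * mexp (real_mat X) * real_mat Q"
    using assms by (intro mexp_conj) auto
  then show ?thesis
    using assms unfolding rexp_def
    by (simp add: body_mult[of _ d d _ d] real_mat_mult[of _ d d _ d] mult_carrier_mat[of _ d d])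
qed

lemma pow_transpose_mat:
  fixes X :: "'a :: comm_semiring_1 mat"
  assumes X: "X \<in> carrier_mat d d"
  shows "X\<^sup>T ^\<^sub>m j = (X ^\<^sub>m j)\<^sup>T"
proof (induction j)
  case 0
  show ?case using X by auto
next
  case (Suc j)
  have "X ^\<^sub>m Suc j = X * X ^\<^sub>m j" using pow_mat_add[OF X, of 1 j] X by simp
  then have "(X ^\<^sub>m Suc j)\<^sup>T = (X ^\<^sub>m j)\<^sup>T * X\<^sup>T"
    using X by (simp add: transpose_mult[of _ d d _ d])
  with Suc show ?case by simp
qed

lemma rexp_transpose:
  assumes X: "X \<in> carrier_mat d d"
  shows "rexp X\<^sup>T = (rexp X)\<^sup>T"
proof (rule rexpI)
  fix i k assume ik: "i < d" "k < d"
  then show "(\<lambda>j. (X\<^sup>T ^\<^sub>m j) $$ (i, k) / fact j) sums ((rexp X)\<^sup>T $$ (i, k))"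
    unfolding pow_transpose_mat[OF X]
    using rexp_sums[OF X ik(2) ik(1)] carrier_matD[OF pow_carrier_mat[OF X]]
      carrier_matD[OF rexp_carrier[OF X]] by simp
qed (use X in auto)

lemma mat_diag_pow: "mat_diag d f ^\<^sub>m j = mat_diag d (\<lambda>i. f i ^ j)"
  by (induction j) (simp_all add: power_Suc2 carrier_matD(1)[OF mat_diag_dim] del: power_Suc)

lemma rexp_mat_diag: "rexp (mat_diag d f) = mat_diag d (\<lambda>i. exp (f i))"
proof (rule rexpI[of _ d])
  fix i k assume ik: "i < d" "k < d"
  show "(\<lambda>j. (mat_diag d f ^\<^sub>m j) $$ (i, k) / fact j) sums (mat_diag d (\<lambda>i. exp (f i)) $$ (i, k))"
    using exp_converges[of "f i"] ik unfolding mat_diag_pow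
    by (auto simp: mat_diag_def divide_inverse_commute)
qed auto

lemma rexp_dsum:
  assumes A: "A \<in> carrier_mat p p" and B: "B \<in> carrier_mat q q"
  shows "rexp (dsum A B) = dsum (rexp A) (rexp B)"
proof (rule rexpI)
  show "dsum A B \<in> carrier_mat (p + q) (p + q)" "dsum (rexp A) (rexp B) \<in> carrier_mat (p + q) (p + q)"
    using A B by (auto intro!: dsum_carrier)
  fix i k assume ik: "i < p + q" "k < p + q"
  have "dsum A B ^\<^sub>m j = dsum (A ^\<^sub>m j) (B ^\<^sub>m j)" for j
    using diag_block_pow_mat[of "[A, B]" j] A B by (simp add: dsum_def del: diag_block_mat.simps)
  then show "(\<lambda>j. (dsum A B ^\<^sub>m j) $$ (i, k) / fact j) sums (dsum (rexp A) (rexp B) $$ (i, k))"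
    using rexp_sums[OF A, of i k] rexp_sums[OF B, of "i - p" "k - p"] ik
    by (simp add: dsum_entry[OF pow_carrier_mat[OF A] pow_carrier_mat[OF B] ik]
        dsum_entry[OF rexp_carrier[OF A] rexp_carrier[OF B] ik])
qed

text \<open>
  A real exponential is the square of the exponential of half the argument.
\<close>

lemma det_rexp_pos:
  assumes X: "X \<in> carrier_mat d d"
  shows "det (rexp X) > 0"
proof -
  have h: "(1 / 2) \<cdot>\<^sub>m X \<in> carrier_mat d d" using X by simp
  have "X = (1 / 2 + 1 / 2) \<cdot>\<^sub>m X" using X by (intro eq_matI) auto
  then have "rexp X = rexp ((1 / 2) \<cdot>\<^sub>m X) * rexp ((1 / 2) \<cdot>\<^sub>m X)"
    using rexp_add_smult[OF X] by metis
  then have "det (rexp X) = (det (rexp ((1 / 2) \<cdot>\<^sub>m X)))\<^sup>2"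
    using rexp_carrier[OF h] by (simp add: det_mult[of _ d] power2_eq_square)
  moreover have "det (rexp (- X)) * det (rexp X) = 1"
    using rexp_uminus(1)[OF X] X by (metis det_mult det_one rexp_carrier uminus_carrier_mat)
  ultimately show ?thesis
    by (metis mult_zero_right power2_eq_square zero_less_power2 zero_neq_one power_zero_numeral)
qed

section \<open>Diagonalisation of symmetric matrices\<close>

text \<open>
  Over the complex numbers there is an eigenvector \<open>x + i y\<close>.  Evaluating \<open>\<langle>S x, y\<rangle> = \<langle>x, S y\<rangle>\<close>
  shows that the imaginary part of the eigenvalue vanishes, so \<open>x\<close> or \<open>y\<close>, whichever is
  nonzero, is a real eigenvector.
\<close>

lemma symmetric_real_eigenvector:
  fixes S :: "real mat"
  assumes S: "S \<in> carrier_mat d d" and sym: "S\<^sup>T = S" and d: "d > 0"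
  obtains l u where "(\<Sum>i<d. (u i)\<^sup>2) = 1" "\<And>i. i < d \<Longrightarrow> (\<Sum>k<d. S $$ (i, k) * u k) = l * u i"
proof -
  let ?C = "map_mat complex_of_real S"
  have C: "?C \<in> carrier_mat d d" using S by simp
  from spectrum_non_empty[OF C d] obtain c v where "eigenvector ?C v c"
    by (auto simp: spectrum_def eigenvalue_def)
  then have v: "v \<in> carrier_vec d" "v \<noteq> 0\<^sub>v d" "?C *\<^sub>v v = c \<cdot>\<^sub>v v"
    using C unfolding eigenvector_def by auto
  have ev: "(\<Sum>k<d. of_real (S $$ (i, k)) * v $ k) = c * v $ i" if "i < d" for i
    using arg_cong[OF v(3), of "\<lambda>w. w $ i"] that S v(1)
    by (auto simp: scalar_prod_def atLeast0LessThan)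
  define x where "x i = Re (v $ i)" for i
  define y where "y i = Im (v $ i)" for i
  have ex: "(\<Sum>k<d. S $$ (i, k) * x k) = Re c * x i - Im c * y i"
    and ey: "(\<Sum>k<d. S $$ (i, k) * y k) = Re c * y i + Im c * x i" if "i < d" for i
    using arg_cong[OF ev[OF that], of Re] arg_cong[OF ev[OF that], of Im]
    by (simp_all add: x_def y_def)
  have symm: "S $$ (i, k) = S $$ (k, i)" if "i < d" "k < d" for i k
    using arg_cong[OF sym, of "\<lambda>M. M $$ (i, k)"] S that by auto
  have "(\<Sum>i<d. y i * (\<Sum>k<d. S $$ (i, k) * x k)) = (\<Sum>k<d. x k * (\<Sum>i<d. S $$ (k, i) * y i))"
    unfolding sum_distrib_left by (subst sum.swap) (auto intro!: sum.cong simp: symm)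
  then have "(\<Sum>i<d. x i * (Re c * y i + Im c * x i) - y i * (Re c * x i - Im c * y i)) = 0"
    by (simp add: ex ey sum_subtractf)
  also have "(\<Sum>i<d. x i * (Re c * y i + Im c * x i) - y i * (Re c * x i - Im c * y i)) =
      Im c * (\<Sum>i<d. (x i)\<^sup>2 + (y i)\<^sup>2)"
    by (simp add: sum_distrib_left algebra_simps power2_eq_square)
  finally have "Im c * (\<Sum>i<d. (x i)\<^sup>2 + (y i)\<^sup>2) = 0" .
  moreover obtain i0 where i0: "i0 < d" "v $ i0 \<noteq> 0"
    using v(1,2) by (metis carrier_vecD eq_vecI index_zero_vec)
  moreover have "(\<Sum>i<d. (x i)\<^sup>2 + (y i)\<^sup>2) > 0"
  proof (rule sum_pos2[of _ i0])
    show "0 < (x i0)\<^sup>2 + (y i0)\<^sup>2"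
      using i0(2) by (auto simp: x_def y_def complex_eq_iff sum_power2_gt_zero_iff)
  qed (use i0 in auto)
  ultimately have Im: "Im c = 0" by simp
  from i0 have "x i0 \<noteq> 0 \<or> y i0 \<noteq> 0" by (auto simp: x_def y_def complex_eq_iff)
  then obtain z where z: "z i0 \<noteq> 0" "\<And>i. i < d \<Longrightarrow> (\<Sum>k<d. S $$ (i, k) * z k) = Re c * z i"
    using ex ey by (auto simp: Im)
  define r where "r = sqrt (\<Sum>i<d. (z i)\<^sup>2)"
  have "(\<Sum>i<d. (z i)\<^sup>2) > 0"
    using z(1) i0(1) by (intro sum_pos2[of _ i0]) auto
  then have r: "r > 0" "r\<^sup>2 = (\<Sum>i<d. (z i)\<^sup>2)" unfolding r_def by auto
  show ?thesis
  proof (rule that)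
    show "(\<Sum>i<d. (z i / r)\<^sup>2) = 1"
      using r by (simp add: power_divide flip: sum_divide_distrib r(2))
    show "(\<Sum>k<d. S $$ (i, k) * (z k / r)) = Re c * (z i / r)" if "i < d" for i
      using z(2)[OF that] by (simp flip: sum_divide_distrib)
  qed
qed

text \<open>
  The reflection \<open>1 - c w w\<^sup>T\<close> that interchanges \<open>u\<close> with the first basis vector.
\<close>

lemma householder:
  assumes u: "(\<Sum>i<d. (u i)\<^sup>2) = (1 :: real)" and d: "d > 0"
  obtains H where "H \<in> carrier_mat d d" "H\<^sup>T = H" "H * H = 1\<^sub>m d" "\<And>i. i < d \<Longrightarrow> H $$ (i, 0) = u i"
proof -
  let ?e = "\<lambda>i. if i = 0 then 1 else 0 :: real"
  define w where "w i = u i - ?e i" for i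
  \<comment> \<open>Since \<open>|w|\<^sup>2 = - 2 w\<^sub>0\<close>, this is the usual factor \<open>2 / |w|\<^sup>2\<close>; if \<open>u\<close> is already the first basis
    vector, then \<open>w = 0\<close>, division by zero gives \<open>c = 0\<close> and \<open>H\<close> is the identity.\<close>
  define c where "c = - 1 / w 0"
  define H where "H = mat d d (\<lambda>(i, k). (if i = k then 1 else 0) - c * w i * w k)"
  have "(\<Sum>i<d. (w i)\<^sup>2) = (\<Sum>i<d. (u i)\<^sup>2 + (if i = 0 then 1 - 2 * u 0 else 0))"
    by (intro sum.cong) (auto simp: w_def power2_eq_square algebra_simps)
  also have "\<dots> = - 2 * w 0" using u d by (simp add: sum.distrib w_def)
  finally have ww: "(\<Sum>i<d. (w i)\<^sup>2) = - 2 * w 0" .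
  have w0: "w i = 0" if "w 0 = 0" "i < d" for i
  proof -
    have "(\<Sum>i<d. (w i)\<^sup>2) = 0" using ww that by simp
    then have "\<forall>i\<in>{..<d}. (w i)\<^sup>2 = 0" by (subst sum_nonneg_eq_0_iff[symmetric]) auto
    with that show ?thesis by auto
  qed
  have cww: "c * c * (\<Sum>i<d. (w i)\<^sup>2) = 2 * c" unfolding ww c_def by (cases "w 0 = 0") auto
  have HC: "H \<in> carrier_mat d d" by (simp add: H_def)
  show ?thesis
  proof (rule that[OF HC])
    show "H\<^sup>T = H" by (rule eq_matI) (auto simp: H_def)
    show "H * H = 1\<^sub>m d"
    proof (rule eq_matI)
      fix i k assume "i < dim_row (1\<^sub>m d :: real mat)" "k < dim_col (1\<^sub>m d :: real mat)"
      then have ik: "i < d" "k < d" by auto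
      have "(H * H) $$ (i, k) = (\<Sum>l<d. H $$ (i, l) * H $$ (l, k))"
        by (rule mult_mat_entry[OF HC HC ik])
      also have "\<dots> = (\<Sum>l<d. (if i = l then (if l = k then 1 else 0) else 0)
          - (if l = k then c * w i * w l else 0) - (if i = l then c * w l * w k else 0)
          + (w i * w k) * (c * c * (w l)\<^sup>2))"
        using ik by (intro sum.cong) (auto simp: H_def algebra_simps power2_eq_square)
      also have "\<dots> = (if i = k then 1 else 0) - c * w i * w k - c * w i * w k
          + (w i * w k) * (c * c * (\<Sum>l<d. (w l)\<^sup>2))"
        using ik by (simp add: sum.distrib sum_subtractf flip: sum_distrib_left)
      also have "\<dots> = (if i = k then 1 else 0)" unfolding cww by simp
      finally show "(H * H) $$ (i, k) = 1\<^sub>m d $$ (i, k)" using ik by simp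
    qed (auto simp: H_def)
    show "H $$ (i, 0) = u i" if "i < d" for i
      using that d w0[of i] by (cases "w 0 = 0") (auto simp: H_def c_def w_def)
  qed
qed

text \<open>
  A reflection moves a unit eigenvector to the first basis vector.  By symmetry the first
  row and column then vanish off the diagonal, and the induction continues with the
  remaining block.
\<close>

lemma symmetric_diagonalisable:
  fixes S :: "real mat"
  assumes "S \<in> carrier_mat d d" "S\<^sup>T = S"
  obtains P f where "P \<in> carrier_mat d d" "P\<^sup>T * P = 1\<^sub>m d" "P * P\<^sup>T = 1\<^sub>m d"
    "S = P * mat_diag d f * P\<^sup>T"
proof -
  have "\<exists>P f. P \<in> carrier_mat d d \<and> P\<^sup>T * P = 1\<^sub>m d \<and> P * P\<^sup>T = 1\<^sub>m d \<and> S = P * mat_diag d f * P\<^sup>T"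
    using assms
  proof (induction d arbitrary: S)
    case 0
    then have "S = 1\<^sub>m 0 * mat_diag 0 (\<lambda>_. 0) * (1\<^sub>m 0)\<^sup>T" by auto
    then show ?case by (metis one_carrier_mat left_mult_one_mat transpose_one)
  next
    case (Suc d)
    note S = Suc.prems(1)
    obtain l u where u: "(\<Sum>i<Suc d. (u i)\<^sup>2) = 1"
      and Su: "\<And>i. i < Suc d \<Longrightarrow> (\<Sum>k<Suc d. S $$ (i, k) * u k) = l * u i"
      using symmetric_real_eigenvector[OF Suc.prems] by (metis zero_less_Suc)
    obtain H where H: "H \<in> carrier_mat (Suc d) (Suc d)" "H\<^sup>T = H" "H * H = 1\<^sub>m (Suc d)"
      and Hu: "\<And>i. i < Suc d \<Longrightarrow> H $$ (i, 0) = u i"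
      using householder[OF u] by (metis zero_less_Suc)
    define T where "T = H * S * H"
    have TC: "T \<in> carrier_mat (Suc d) (Suc d)" using S H by (simp add: T_def)
    have Tt: "T\<^sup>T = T"
      using S H Suc.prems(2)
      by (simp add: T_def transpose_mult[of _ "Suc d" "Suc d" _ "Suc d"]
          assoc_mult_mat[of _ "Suc d" "Suc d" _ "Suc d" _ "Suc d"])
    have T0: "T $$ (i, 0) = (if i = 0 then l else 0)" if i: "i < Suc d" for i
    proof -
      have SH: "(S * H) $$ (k, 0) = l * H $$ (k, 0)" if "k < Suc d" for k
        using Su[OF that] mult_mat_entry[OF S H(1) that, of 0] Hu that by simp
      have "T = H * (S * H)"
        using S H by (simp add: T_def assoc_mult_mat[of _ "Suc d" "Suc d" _ "Suc d" _ "Suc d"])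
      then have "T $$ (i, 0) = (\<Sum>k<Suc d. H $$ (i, k) * (S * H) $$ (k, 0))"
        using mult_mat_entry[OF H(1) mult_carrier_mat[OF S H(1)] i, of 0] by simp
      also have "\<dots> = l * (\<Sum>k<Suc d. H $$ (i, k) * H $$ (k, 0))"
        unfolding sum_distrib_left by (intro sum.cong) (auto simp: SH)
      also have "\<dots> = l * (H * H) $$ (i, 0)"
        using mult_mat_entry[OF H(1) H(1) i, of 0] by simp
      finally show ?thesis using i by (simp add: H(3))
    qed
    have T0': "T $$ (0, i) = (if i = 0 then l else 0)" if "i < Suc d" for i
      using T0[OF that] arg_cong[OF Tt, of "\<lambda>M. M $$ (0, i)"] TC that by auto
    define T' where "T' = mat d d (\<lambda>(i, k). T $$ (Suc i, Suc k))"
    have T'C: "T' \<in> carrier_mat d d" by (simp add: T'_def)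
    have "T'\<^sup>T = T'"
    proof (rule eq_matI)
      fix i k assume "i < dim_row T'" "k < dim_col T'"
      then show "T'\<^sup>T $$ (i, k) = T' $$ (i, k)"
        using arg_cong[OF Tt, of "\<lambda>M. M $$ (Suc i, Suc k)"] TC by (auto simp: T'_def)
    qed (auto simp: T'_def)
    from Suc.IH[OF T'C this] obtain P f where P: "P \<in> carrier_mat d d" "P\<^sup>T * P = 1\<^sub>m d"
      "P * P\<^sup>T = 1\<^sub>m d" "T' = P * mat_diag d f * P\<^sup>T" by blast
    define g where "g i = (case i of 0 \<Rightarrow> l | Suc j \<Rightarrow> f j)" for i
    define B where "B = dsum (1\<^sub>m 1) P"
    have one: "1\<^sub>m (Suc 0) \<in> carrier_mat 1 1" by simp
    have lC: "mat_diag 1 (\<lambda>_. l) \<in> carrier_mat 1 1" by simp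
    have fC: "mat_diag d f \<in> carrier_mat d d" by simp
    have PT: "P\<^sup>T \<in> carrier_mat d d" using P by simp
    have BC: "B \<in> carrier_mat (Suc d) (Suc d)"
      unfolding B_def using dsum_carrier[OF one_carrier_mat P(1), of 1] by simp
    have BT: "B\<^sup>T = dsum (1\<^sub>m 1) P\<^sup>T"
      unfolding B_def by (subst dsum_transpose[OF one_carrier_mat P(1)]) simp
    have BB: "B\<^sup>T * B = 1\<^sub>m (Suc d)" "B * B\<^sup>T = 1\<^sub>m (Suc d)"
      unfolding BT unfolding B_def
      using dsum_mult[OF one_carrier_mat PT one_carrier_mat P(1), of 1]
        dsum_mult[OF one_carrier_mat P(1) one_carrier_mat PT, of 1] P dsum_one[of 1 d] by simp_all
    have gd: "mat_diag (Suc d) g = dsum (mat_diag 1 (\<lambda>_. l)) (mat_diag d f)"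
    proof (rule eq_matI)
      fix i k assume "i < dim_row (dsum (mat_diag 1 (\<lambda>_. l)) (mat_diag d f))"
        "k < dim_col (dsum (mat_diag 1 (\<lambda>_. l)) (mat_diag d f))"
      then have ik: "i < 1 + d" "k < 1 + d" using carrier_matD[OF dsum_carrier[OF lC fC]] by auto
      then show "mat_diag (Suc d) g $$ (i, k) = dsum (mat_diag 1 (\<lambda>_. l)) (mat_diag d f) $$ (i, k)"
        unfolding dsum_entry[OF lC fC ik] by (auto simp: mat_diag_def g_def split: nat.split)
    qed (use carrier_matD[OF dsum_carrier[OF lC fC]] in \<open>auto simp: mat_diag_def\<close>)
    have "B * mat_diag (Suc d) g * B\<^sup>T = dsum (mat_diag 1 (\<lambda>_. l)) T'"
      unfolding BT unfolding B_def gd P(4)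
      by (simp only: dsum_mult[OF one_carrier_mat P(1) lC fC] left_mult_one_mat[OF lC]
          dsum_mult[OF lC mult_carrier_mat[OF P(1) fC] one_carrier_mat PT] right_mult_one_mat[OF lC])
    also have "\<dots> = T"
    proof (rule eq_matI)
      fix i k assume "i < dim_row T" "k < dim_col T"
      then have ik: "i < 1 + d" "k < 1 + d" using TC by auto
      show "dsum (mat_diag 1 (\<lambda>_. l)) T' $$ (i, k) = T $$ (i, k)"
        unfolding dsum_entry[OF lC T'C ik] using ik T0[of i] T0'[of k]
        by (auto simp: mat_diag_def T'_def)
    qed (use carrier_matD[OF dsum_carrier[OF lC T'C]] TC in auto)
    finally have T: "T = B * mat_diag (Suc d) g * B\<^sup>T" by simp
    note as = assoc_mult_mat[of _ "Suc d" "Suc d" _ "Suc d" _ "Suc d"] mult_carrier_mat[of _ "Suc d" "Suc d"]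
    have HBC: "H * B \<in> carrier_mat (Suc d) (Suc d)" using H BC by simp
    have HBT: "(H * B)\<^sup>T = B\<^sup>T * H" using H BC by (simp add: transpose_mult[of _ "Suc d" "Suc d" _ "Suc d"])
    have "(H * B)\<^sup>T * (H * B) = 1\<^sub>m (Suc d)" "(H * B) * (H * B)\<^sup>T = 1\<^sub>m (Suc d)"
      unfolding HBT using H BC BB
      by (simp_all add: as mat_mult_eq_one_cancel[OF H(3)] mat_mult_eq_one_cancel[OF BB(2)])
    moreover have "S = H * T * H"
      using H S by (simp add: T_def as mat_mult_eq_one_cancel[OF H(3)])
    then have "S = (H * B) * mat_diag (Suc d) g * (H * B)\<^sup>T"
      unfolding HBT T using H BC by (simp add: as)
    ultimately show ?case using HBC by blast
  qed
  with that show ?thesis by blast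
qed

section \<open>Symmetric logarithms and the polar decomposition\<close>

lemma rexp_orthogonal_conj:
  assumes "X \<in> carrier_mat d d" "P \<in> carrier_mat d d" "P\<^sup>T * P = 1\<^sub>m d" "P * P\<^sup>T = 1\<^sub>m d"
  shows "rexp (P * X * P\<^sup>T) = P * rexp X * P\<^sup>T"
  using assms by (intro rexp_conj) auto

text \<open>
  Diagonalise both matrices.  The change of basis \<open>R\<close> intertwines the diagonal matrices with
  entries \<open>exp (f k)\<close> and \<open>exp (f' i)\<close>, so \<open>R $$ (i, k)\<close> vanishes unless \<open>f' i = f k\<close>; hence \<open>R\<close> intertwines the
  exponents as well.
\<close>

lemma rexp_symmetric_inj:
  assumes Y: "Y \<in> carrier_mat d d" "Y\<^sup>T = Y" and Y': "Y' \<in> carrier_mat d d" "Y'\<^sup>T = Y'"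
    and eq: "rexp Y = rexp Y'"
  shows "Y = Y'"
proof -
  note as = assoc_mult_mat[of _ d d _ d _ d] mult_carrier_mat[of _ d d]
  obtain P f where P: "P \<in> carrier_mat d d" "P\<^sup>T * P = 1\<^sub>m d" "P * P\<^sup>T = 1\<^sub>m d"
    and Yd: "Y = P * mat_diag d f * P\<^sup>T" using symmetric_diagonalisable[OF Y] .
  obtain P' f' where P': "P' \<in> carrier_mat d d" "P'\<^sup>T * P' = 1\<^sub>m d" "P' * P'\<^sup>T = 1\<^sub>m d"
    and Yd': "Y' = P' * mat_diag d f' * P'\<^sup>T" using symmetric_diagonalisable[OF Y'] .
  note cancel = mat_mult_eq_one_cancel[OF P(2)] mat_mult_eq_one_cancel[OF P(3)]
    mat_mult_eq_one_cancel[OF P'(2)] mat_mult_eq_one_cancel[OF P'(3)]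
  define R where "R = P'\<^sup>T * P"
  have R: "R \<in> carrier_mat d d" using P P' by (simp add: R_def)
  have e: "P * mat_diag d (\<lambda>i. exp (f i)) * P\<^sup>T = P' * mat_diag d (\<lambda>i. exp (f' i)) * P'\<^sup>T"
    using eq rexp_orthogonal_conj[OF _ P, of "mat_diag d f"]
      rexp_orthogonal_conj[OF _ P', of "mat_diag d f'"] by (simp add: Yd Yd' rexp_mat_diag)
  have "mat_diag d (\<lambda>i. exp (f' i)) * R = P'\<^sup>T * (P' * mat_diag d (\<lambda>i. exp (f' i)) * P'\<^sup>T) * P"
    using P P' by (simp add: R_def as cancel)
  also have "\<dots> = R * mat_diag d (\<lambda>i. exp (f i))"
    unfolding e[symmetric] using P P' by (simp add: R_def as cancel right_mult_one_mat[OF mat_diag_dim])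
  finally have eR: "mat_diag d (\<lambda>i. exp (f' i)) * R = R * mat_diag d (\<lambda>i. exp (f i))" .
  have "mat_diag d f' * R = R * mat_diag d f"
  proof (rule eq_matI)
    fix i k assume "i < dim_row (R * mat_diag d f)" "k < dim_col (R * mat_diag d f)"
    with R have ik: "i < d" "k < d" by (auto simp: mat_diag_def)
    then have "exp (f' i) * R $$ (i, k) = R $$ (i, k) * exp (f k)"
      using arg_cong[OF eR, of "\<lambda>M. M $$ (i, k)"] R
      by (simp add: mat_diag_mult_left[of _ d d] mat_diag_mult_right[of _ d d])
    then have "R $$ (i, k) = 0 \<or> f' i = f k" by auto
    with ik R show "(mat_diag d f' * R) $$ (i, k) = (R * mat_diag d f) $$ (i, k)"
      by (auto simp: mat_diag_mult_left[of _ d d] mat_diag_mult_right[of _ d d])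
  qed (use R in \<open>auto simp: mat_diag_def\<close>)
  moreover have "Y' = P' * (mat_diag d f' * R) * P\<^sup>T"
    unfolding Yd' R_def using P P' by (simp add: as cancel P(3))
  moreover have "Y = P' * (R * mat_diag d f) * P\<^sup>T"
    unfolding Yd R_def using P P' by (simp add: as cancel)
  ultimately show ?thesis by simp
qed

lemma smult_one_mat: "(1 :: 'a :: semiring_1) \<cdot>\<^sub>m X = X"
  by (rule eq_matI) auto

lemma rexp_square: "Y \<in> carrier_mat d d \<Longrightarrow> rexp Y * rexp Y = rexp (2 \<cdot>\<^sub>m Y)"
  using rexp_add_smult[of Y d 1 1] by (simp add: smult_one_mat)

lemma rexp_square_symmetric_inj:
  assumes Y: "Y \<in> carrier_mat d d" "Y\<^sup>T = Y" and Y': "Y' \<in> carrier_mat d d" "Y'\<^sup>T = Y'"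
    and eq: "rexp Y * rexp Y = rexp Y' * rexp Y'"
  shows "Y = Y'"
proof -
  have t: "(2 \<cdot>\<^sub>m X)\<^sup>T = 2 \<cdot>\<^sub>m X\<^sup>T" for X :: "real mat" by (rule eq_matI) auto
  have "2 \<cdot>\<^sub>m Y = 2 \<cdot>\<^sub>m Y'"
    by (rule rexp_symmetric_inj[of _ d]) (use eq Y Y' in \<open>auto simp: rexp_square[of _ d] t\<close>)
  then have "(1 / 2) \<cdot>\<^sub>m (2 \<cdot>\<^sub>m Y) = (1 / 2) \<cdot>\<^sub>m (2 \<cdot>\<^sub>m Y')"
    by (rule arg_cong[where f = "\<lambda>X. (1 / 2) \<cdot>\<^sub>m X"])
  moreover have "(1 / 2) \<cdot>\<^sub>m (2 \<cdot>\<^sub>m X) = X" for X :: "real mat" by (rule eq_matI) auto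
  ultimately show ?thesis by (simp only:)
qed

lemma polar_log:
  fixes D E :: "real mat"
  assumes D: "D \<in> carrier_mat d d" and E: "E \<in> carrier_mat d d" "E * D = 1\<^sub>m d"
  obtains Y where "Y \<in> carrier_mat d d" "Y\<^sup>T = Y" "rexp Y * rexp Y = D\<^sup>T * D"
proof -
  note as = assoc_mult_mat[of _ d d _ d _ d] mult_carrier_mat[of _ d d]
  have S: "D\<^sup>T * D \<in> carrier_mat d d" "(D\<^sup>T * D)\<^sup>T = D\<^sup>T * D"
    using D by (auto simp: transpose_mult[of _ d d _ d])
  obtain P f where P: "P \<in> carrier_mat d d" "P\<^sup>T * P = 1\<^sub>m d" "P * P\<^sup>T = 1\<^sub>m d"
    and Sd: "D\<^sup>T * D = P * mat_diag d f * P\<^sup>T" using symmetric_diagonalisable[OF S] .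
  note cancel = mat_mult_eq_one_cancel[OF P(2)] mat_mult_eq_one_cancel[OF P(3)]
  define B where "B = D * P"
  have B: "B \<in> carrier_mat d d" using D P by (simp add: B_def)
  have "B\<^sup>T * B = P\<^sup>T * (D\<^sup>T * D) * P"
    unfolding B_def using D P by (simp add: as transpose_mult[of _ d d _ d])
  also have "\<dots> = mat_diag d f" unfolding Sd using P by (simp add: as cancel right_mult_one_mat[OF mat_diag_dim])
  finally have BB: "B\<^sup>T * B = mat_diag d f" .
  have inv: "(P\<^sup>T * E) * B = 1\<^sub>m d"
    unfolding B_def using D E P by (simp add: as mat_mult_eq_one_cancel[OF E(2)])
  have pos: "f i > 0" if i: "i < d" for i
  proof -
    have BT: "B\<^sup>T \<in> carrier_mat d d" using B by simp
    have "f i = (\<Sum>l<d. (B $$ (l, i))\<^sup>2)"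
      using arg_cong[OF BB, of "\<lambda>M. M $$ (i, i)"] i B unfolding mult_mat_entry[OF BT B i i]
      by (simp add: mat_diag_def power2_eq_square)
    moreover have "\<exists>l<d. B $$ (l, i) \<noteq> 0"
    proof (rule ccontr)
      assume "\<not> ?thesis"
      then have "((P\<^sup>T * E) * B) $$ (i, i) = 0"
        using P E B i by (subst mult_mat_entry[of _ d d _ d]) auto
      with i show False by (simp add: inv)
    qed
    then obtain l where "l < d" "B $$ (l, i) \<noteq> 0" by blast
    then have "0 < (\<Sum>l<d. (B $$ (l, i))\<^sup>2)"
      by (intro sum_pos2[of _ l]) auto
    ultimately show ?thesis by simp
  qed
  define Y where "Y = P * mat_diag d (\<lambda>i. ln (f i) / 2) * P\<^sup>T"
  have dT: "(mat_diag d g)\<^sup>T = mat_diag d g" for g :: "nat \<Rightarrow> real"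
    by (rule eq_matI) (auto simp: mat_diag_def)
  show ?thesis
  proof (rule that)
    show "Y \<in> carrier_mat d d" "Y\<^sup>T = Y"
      using P by (auto simp: Y_def as transpose_mult[of _ d d _ d] dT)
    have eY: "rexp Y = P * mat_diag d (\<lambda>i. exp (ln (f i) / 2)) * P\<^sup>T"
      unfolding Y_def using rexp_orthogonal_conj[OF _ P] by (simp add: rexp_mat_diag)
    have "mat_diag d (\<lambda>i. exp (ln (f i) / 2) * exp (ln (f i) / 2)) = mat_diag d f"
      using pos by (intro eq_matI) (auto simp: mat_diag_def simp flip: exp_add)
    then have "mat_diag d (\<lambda>i. exp (ln (f i) / 2)) * mat_diag d (\<lambda>i. exp (ln (f i) / 2)) = mat_diag d f"
      by simp
    then show "rexp Y * rexp Y = D\<^sup>T * D"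
      unfolding eY Sd using P by (simp add: as cancel flip: assoc_mult_mat[of "mat_diag d _" d d "mat_diag d _" d "P\<^sup>T" d])
  qed
qed

text \<open>
  For the complex structure \<open>J = \<Omega>\<close> this is the polar decomposition of a symplectic matrix within the
  symplectic group.  The matrices \<open>J\<^sup>T Y J\<close> and \<open>- Y\<close> are symmetric, and the squares of their
  exponentials are both inverse to \<open>D\<^sup>T D\<close>; uniqueness of symmetric logarithms makes them equal.
\<close>

lemma symplectic_polar:
  fixes D J :: "real mat"
  assumes D: "D \<in> carrier_mat d d" and J: "J \<in> carrier_mat d d" "J\<^sup>T = - J" "J\<^sup>T * J = 1\<^sub>m d"
    and DJ: "D\<^sup>T * J * D = J"
  obtains U Y where "U \<in> carrier_mat d d" "U\<^sup>T * U = 1\<^sub>m d" "J * U = U * J"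
    "Y \<in> carrier_mat d d" "Y\<^sup>T = Y" "Y * J + J * Y = 0\<^sub>m d d" "D = U * rexp Y"
proof -
  note as = assoc_mult_mat[of _ d d _ d _ d] mult_carrier_mat[of _ d d]
  have JT: "J\<^sup>T \<in> carrier_mat d d" using J by simp
  have JJ: "J * J\<^sup>T = 1\<^sub>m d" by (rule mat_mult_left_right_inverse[OF JT J(1) J(3)])
  note cancelJ = mat_mult_eq_one_cancel[OF J(3)] mat_mult_eq_one_cancel[OF JJ]
  define E where "E = J\<^sup>T * D\<^sup>T * J"
  have E: "E \<in> carrier_mat d d" using D J(1) by (simp add: E_def as J(3))
  have ED: "E * D = 1\<^sub>m d"
    using arg_cong[OF DJ, of "\<lambda>M. J\<^sup>T * M"] D J(1) by (simp add: E_def as J(3))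
  have DE: "D * E = 1\<^sub>m d" by (rule mat_mult_left_right_inverse[OF E D ED])
  have DJD: "D * J\<^sup>T * D\<^sup>T = J\<^sup>T"
    using arg_cong[OF DE, of "\<lambda>M. M * J\<^sup>T"] D J(1) by (simp add: E_def as JJ)
  have DJD': "D\<^sup>T * J\<^sup>T * D = J\<^sup>T"
    using arg_cong[OF DJ, of transpose_mat] D J(1) by (simp add: as transpose_mult[of _ d d _ d])
  obtain Y where Y: "Y \<in> carrier_mat d d" "Y\<^sup>T = Y" and YY: "rexp Y * rexp Y = D\<^sup>T * D"
    using polar_log[OF D E ED] .
  have mY: "- Y \<in> carrier_mat d d" "(- Y)\<^sup>T = - Y" using Y by (auto simp: transpose_uminus)
  let ?e = "rexp Y" and ?e' = "rexp (- Y)"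
  have e: "?e \<in> carrier_mat d d" "?e' \<in> carrier_mat d d" using Y by auto
  note inv = rexp_uminus[OF Y(1)]
  note cancel = mat_mult_eq_one_cancel[OF inv(1)] mat_mult_eq_one_cancel[OF inv(2)]
  have eT: "?e\<^sup>T = ?e" "?e'\<^sup>T = ?e'" using rexp_transpose[OF Y(1)] rexp_transpose[OF mY(1)] Y mY by auto
  define W where "W = J\<^sup>T * Y * J"
  have W: "W \<in> carrier_mat d d" using Y J(1) by (simp add: W_def as)
  have WT: "W\<^sup>T = W" using Y J(1) by (simp add: W_def as transpose_mult[of _ d d _ d])
  have eW: "rexp W = J\<^sup>T * ?e * J" unfolding W_def by (rule rexp_conj[OF Y(1) JT J(1) J(3) JJ])
  have "?e * ?e * (rexp W * rexp W) = (?e * ?e) * J\<^sup>T * (?e * ?e) * J"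
    unfolding eW using e J(1) by (simp add: as cancelJ)
  also have "\<dots> = D\<^sup>T * (D * J\<^sup>T * D\<^sup>T) * D * J"
    unfolding YY using D J(1) by (simp add: as)
  also have "\<dots> = (D\<^sup>T * J\<^sup>T * D) * J" unfolding DJD using D J(1) by (simp add: as)
  finally have sq: "?e * ?e * (rexp W * rexp W) = 1\<^sub>m d" unfolding DJD' J(3) .
  have "rexp W * rexp W = ?e' * (?e' * (?e * ?e * (rexp W * rexp W)))"
    using e W by (simp add: as cancel)
  also have "\<dots> = ?e' * ?e'" unfolding sq using e by simp
  finally have WY: "W = - Y" using rexp_square_symmetric_inj[OF W WT mY] by simp
  have YJ: "Y * J + J * Y = 0\<^sub>m d d"
  proof -
    have "J * W = Y * J" using Y J(1) by (simp add: W_def as cancelJ)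
    then have "Y * J = - (J * Y)" unfolding WY using J(1) Y by simp
    then show ?thesis using J(1) Y by (simp add: uminus_l_inv_mat[of _ d d])
  qed
  have Je: "J * ?e' = ?e * J"
    using eW e J(1) by (simp add: WY as cancelJ)
  define U where "U = D * ?e'"
  have U: "U \<in> carrier_mat d d" using D e by (simp add: U_def)
  have UT: "U\<^sup>T = ?e' * D\<^sup>T" using D e by (simp add: U_def transpose_mult[of _ d d _ d] eT)
  have "U\<^sup>T * U = ?e' * (D\<^sup>T * D) * ?e'" unfolding UT unfolding U_def using D e by (simp add: as)
  also have "\<dots> = 1\<^sub>m d" unfolding YY[symmetric] using e by (simp add: as cancel inv)
  finally have UU: "U\<^sup>T * U = 1\<^sub>m d" .
  have UU': "U * U\<^sup>T = 1\<^sub>m d"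
    by (rule mat_mult_left_right_inverse[OF _ U UU]) (use U in simp)
  have "U\<^sup>T * J * U = ?e' * (D\<^sup>T * J * D) * ?e'" unfolding UT unfolding U_def using D J(1) e by (simp add: as)
  also have "\<dots> = J" unfolding DJ using e J(1) by (simp add: as Je cancel)
  finally have UJ: "U\<^sup>T * J * U = J" .
  have "J * U = U * (U\<^sup>T * J * U)" using U J(1) by (simp add: as mat_mult_eq_one_cancel[OF UU'])
  then have JU: "J * U = U * J" unfolding UJ .
  have "D = U * ?e" using D e by (simp add: U_def as inv)
  then show ?thesis by (rule that[OF U UU JU Y YJ])
qed

section \<open>Skew logarithms of orthogonal matrices\<close>

text \<open>
  An orthogonal matrix commutes with its transpose, hence with twice its symmetric part, whose
  eigenvalues \<open>s i\<close> are the cosines of the rotation angles.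
\<close>

lemma orthogonal_commutes_with_cosines:
  fixes R :: "real mat"
  assumes R: "R \<in> carrier_mat d d" "R\<^sup>T * R = 1\<^sub>m d" "R * R\<^sup>T = 1\<^sub>m d"
    and s: "R + R\<^sup>T = mat_diag d (\<lambda>i. 2 * s i)"
    and ik: "i < d" "k < d" "s i \<noteq> s k"
  shows "R $$ (i, k) = 0"
proof -
  have "R * (R + R\<^sup>T) = (R + R\<^sup>T) * R"
    using R by (simp add: mult_add_distrib_mat[of _ d d _ d] add_mult_distrib_mat[of _ d d _ _ d])
  then have "(R * mat_diag d (\<lambda>i. 2 * s i)) $$ (i, k) = (mat_diag d (\<lambda>i. 2 * s i) * R) $$ (i, k)"
    unfolding s by simp
  then show ?thesis
    using R ik by (simp add: mat_diag_mult_left[of _ d d] mat_diag_mult_right[of _ d d])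
qed

text \<open>
  Write \<open>R = s + K\<close> with \<open>s\<close> diagonal and \<open>K\<close> skew.  Then \<open>K\<close> commutes with \<open>s\<close> and
  \<open>K\<^sup>2 = s\<^sup>2 - 1\<close>, so with \<open>\<theta> = arccos s\<close> the skew matrix \<open>X = (\<theta> / sin \<theta>) K\<close> satisfies
  \<open>X\<^sup>2 = - \<theta>\<^sup>2\<close> and therefore \<open>e\<^sup>X = cos \<theta> + (sin \<theta> / \<theta>) X = R\<close>.  Where \<open>s = - 1\<close> the matrix
  \<open>K\<close> vanishes although \<open>\<theta> = \<pi>\<close>; there \<open>\<pi> J\<close> serves instead, for a complex structure \<open>J\<close> of that eigenspace.
\<close>

lemma orthogonal_log_diag:
  fixes R J :: "real mat"
  assumes R: "R \<in> carrier_mat d d" "R\<^sup>T * R = 1\<^sub>m d" "R * R\<^sup>T = 1\<^sub>m d"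
    and s: "R + R\<^sup>T = mat_diag d (\<lambda>i. 2 * s i)"
    and J: "J \<in> carrier_mat d d" "J\<^sup>T = - J"
    and Js: "\<And>i k. i < d \<Longrightarrow> k < d \<Longrightarrow> s i \<noteq> s k \<Longrightarrow> J $$ (i, k) = 0"
    and JJ: "\<And>i k. i < d \<Longrightarrow> k < d \<Longrightarrow> s i = - 1 \<Longrightarrow> (J * J) $$ (i, k) = (if i = k then - 1 else 0)"
  obtains X where "X \<in> carrier_mat d d" "X\<^sup>T = - X" "rexp X = R" "J * R = R * J \<Longrightarrow> J * X = X * J"
proof -
  note [simp del] = index_mult_mat(1)
  define K where "K i k = R $$ (i, k) - (if i = k then s i else 0)" for i k
  define t where "t i = arccos (s i)" for i
  define g where "g i = t i / sqrt (1 - (s i)\<^sup>2)" for i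
  define x where "x i k = g i * K i k + (if s i = - 1 then pi * J $$ (i, k) else 0)" for i k
  have Rs: "R $$ (i, k) + R $$ (k, i) = (if i = k then 2 * s i else 0)" if "i < d" "k < d" for i k
    using arg_cong[OF s, of "\<lambda>M. M $$ (i, k)"] that R by (auto simp: mat_diag_def)
  have R0: "R $$ (i, k) = 0" if "i < d" "k < d" "s i \<noteq> s k" for i k
    using orthogonal_commutes_with_cosines[OF R s that] .
  have Jskew: "J $$ (i, k) = - J $$ (k, i)" if "i < d" "k < d" for i k
    using arg_cong[OF J(2), of "\<lambda>M. M $$ (k, i)"] that J(1) by auto
  have K0: "K i k = 0" if "i < d" "k < d" "s i \<noteq> s k" for i k
    using R0[OF that] that by (auto simp: K_def)
  have Kskew: "K i k = - K k i" if "i < d" "k < d" for i k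
    using Rs[OF that] by (auto simp: K_def)
  have RT: "R\<^sup>T \<in> carrier_mat d d" using R by simp
  have KK: "(\<Sum>l<d. K i l * K l k) = (if i = k then (s i)\<^sup>2 - 1 else 0)" if ik: "i < d" "k < d" for i k
  proof -
    have "(\<Sum>l<d. R $$ (i, l) * R $$ (k, l)) = (R * R\<^sup>T) $$ (i, k)"
      using ik R(1) by (subst mult_mat_entry[OF R(1) RT ik]) auto
    then have RR: "(\<Sum>l<d. R $$ (i, l) * R $$ (k, l)) = (if i = k then 1 else 0)" using ik by (simp add: R(3))
    have "(\<Sum>l<d. K i l * K l k) = - (\<Sum>l<d. K i l * K k l)"
      unfolding sum_negf[symmetric]
    proof (rule sum.cong[OF refl])
      fix l assume "l \<in> {..<d}"
      then have "K l k = - K k l" using Kskew[of l k] ik by simp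
      then show "K i l * K l k = - (K i l * K k l)" by simp
    qed
    also have "(\<Sum>l<d. K i l * K k l) = (\<Sum>l<d. R $$ (i, l) * R $$ (k, l)
        - (if l = k then s k * R $$ (i, k) else 0) - (if l = i then s i * R $$ (k, i) else 0)
        + (if l = i then (if i = k then (s i)\<^sup>2 else 0) else 0))"
      by (intro sum.cong) (auto simp: K_def algebra_simps power2_eq_square)
    also have "\<dots> = (if i = k then 1 else 0) - s k * R $$ (i, k) - s i * R $$ (k, i)
        + (if i = k then (s i)\<^sup>2 else 0)"
      using ik by (simp add: sum.distrib sum_subtractf RR)
    also have "s k * R $$ (i, k) = s i * R $$ (i, k)"
      using R0[OF ik] by (cases "s i = s k") auto
    also have "(if i = k then 1 else 0) - s i * R $$ (i, k) - s i * R $$ (k, i) + (if i = k then (s i)\<^sup>2 else 0)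
        = (if i = k then 1 - (s i)\<^sup>2 else 0)"
      using Rs[OF ik] distrib_left[of "s i" "R $$ (i, k)" "R $$ (k, i)"]
      by (cases "i = k") (auto simp: power2_eq_square)
    finally show ?thesis by auto
  qed
  have Ksq: "(\<Sum>l<d. (K i l)\<^sup>2) = 1 - (s i)\<^sup>2" if i: "i < d" for i
  proof -
    have "(\<Sum>l<d. (K i l)\<^sup>2) = - (\<Sum>l<d. K i l * K l i)"
      unfolding sum_negf[symmetric]
    proof (rule sum.cong[OF refl])
      fix l assume "l \<in> {..<d}"
      then have "K l i = - K i l" using Kskew[of l i] i by simp
      then show "(K i l)\<^sup>2 = - (K i l * K l i)" by (simp add: power2_eq_square)
    qed
    with KK[OF i i] show ?thesis by simp
  qed
  have s1: "(s i)\<^sup>2 \<le> 1" if "i < d" for i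
    using Ksq[OF that] sum_nonneg[of "{..<d}" "\<lambda>l. (K i l)\<^sup>2"] by simp
  then have sb: "- 1 \<le> s i" "s i \<le> 1" if "i < d" for i
    using that abs_le_square_iff[of "s i" 1] by (auto simp: abs_le_iff)
  have Kz: "K i l = 0" if "i < d" "l < d" "(s i)\<^sup>2 = 1" for i l
  proof -
    have "(\<Sum>l<d. (K i l)\<^sup>2) = 0" using Ksq that by simp
    then have "\<forall>l\<in>{..<d}. (K i l)\<^sup>2 = 0" by (subst sum_nonneg_eq_0_iff[symmetric]) auto
    with that show ?thesis by auto
  qed
  have x0: "x i k = 0" if "i < d" "k < d" "s i \<noteq> s k" for i k
    using K0[OF that] Js[OF that] by (simp add: x_def)
  have geq: "g i = g k" if "s i = s k" for i k using that by (simp add: g_def t_def)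
  have xskew: "x i k = - x k i" if "i < d" "k < d" for i k
  proof (cases "s i = s k")
    case True
    then show ?thesis using Kskew[OF that] Jskew[OF that] geq[OF True] by (simp add: x_def)
  next
    case False
    then show ?thesis using x0[of i k] x0[of k i] that by simp
  qed
  have gg: "(g i)\<^sup>2 * ((s i)\<^sup>2 - 1) = - (t i)\<^sup>2" if i: "i < d" and n: "s i \<noteq> - 1" for i
  proof (cases "s i = 1")
    case True
    then show ?thesis by (simp add: t_def)
  next
    case False
    with n have "(s i)\<^sup>2 \<noteq> 1" by (auto simp: power2_eq_1_iff)
    with s1[OF i] have "1 - (s i)\<^sup>2 > 0" by simp
    then show ?thesis unfolding g_def by (simp add: power_divide field_simps)
  qed
  have xx: "(\<Sum>l<d. x i l * x l k) = (if i = k then - (t i)\<^sup>2 else 0)" if ik: "i < d" "k < d" for i k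
  proof (cases "s i = - 1")
    case True
    have "x i l * x l k = pi\<^sup>2 * (J $$ (i, l) * J $$ (l, k))" if l: "l < d" for l
    proof (cases "s l = s i")
      case lT: True
      then have "s l = - 1" using True by simp
      with True show ?thesis using Kz[of i l] Kz[of l k] ik l by (simp add: x_def power2_eq_square)
    next
      case False
      then show ?thesis using x0[of i l] Js[of i l] ik l by auto
    qed
    then have "(\<Sum>l<d. x i l * x l k) = pi\<^sup>2 * (J * J) $$ (i, k)"
      by (simp add: mult_mat_entry[OF J(1) J(1) ik] sum_distrib_left)
    then show ?thesis using True ik by (cases "i = k") (simp_all add: JJ t_def)
  next
    case False
    have "x i l * x l k = (g i)\<^sup>2 * (K i l * K l k)" if l: "l < d" for l
    proof (cases "s l = s i")
      case True
      with False show ?thesis using geq[OF True] by (simp add: x_def power2_eq_square)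
    next
      case False
      then show ?thesis using x0[of i l] K0[of i l] ik l by auto
    qed
    then have "(\<Sum>l<d. x i l * x l k) = (g i)\<^sup>2 * (\<Sum>l<d. K i l * K l k)"
      by (simp add: sum_distrib_left)
    then show ?thesis using KK[OF ik] gg[OF ik(1) False] by (cases "i = k") simp_all
  qed
  have xt: "x i k = 0" if "i < d" "k < d" "t i = 0" for i k
  proof -
    have "s i = cos (t i)" using sb[OF that(1)] by (simp add: t_def)
    also have "\<dots> = 1" by (simp add: that(3))
    finally have si: "s i = 1" .
    then have "K i k = 0" using that by (intro Kz) auto
    with si show ?thesis by (simp add: x_def)
  qed
  define X where "X = mat d d (\<lambda>(i, k). x i k)"
  have X: "X \<in> carrier_mat d d" by (simp add: X_def)
  have Xe: "X $$ (i, k) = x i k" if "i < d" "k < d" for i k using that by (simp add: X_def)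
  \<comment> \<open>Termwise form of \<open>e\<^sup>X = cos \<theta> + (X / \<theta>) sin \<theta>\<close>.  Where \<open>\<theta> = 0\<close> the row of \<open>X\<close> vanishes, so the
    quotient \<open>0 / 0 = 0\<close> has the right value.\<close>
  have pow: "(X ^\<^sub>m j) $$ (i, k) = fact j *
      ((if i = k then cos_coeff j * t i ^ j else 0) + x i k / t i * (sin_coeff j * t i ^ j))"
    if ik: "i < d" "k < d" for i k j
    using ik
  proof (induction j arbitrary: k)
    case 0
    then show ?case using X by (auto dest!: carrier_matD)
  next
    case (Suc j)
    have "(X ^\<^sub>m Suc j) $$ (i, k) = (\<Sum>l<d. (X ^\<^sub>m j) $$ (i, l) * X $$ (l, k))"
      using mult_mat_entry[OF pow_carrier_mat[OF X] X Suc.prems] by simp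
    also have "\<dots> = fact j * (\<Sum>l<d. (if l = i then cos_coeff j * t i ^ j * x i k else 0)
        + sin_coeff j * t i ^ j / t i * (x i l * x l k))"
      unfolding sum_distrib_left using Suc
      by (intro sum.cong) (auto simp: Xe algebra_simps)
    also have "\<dots> = fact j * (cos_coeff j * t i ^ j * x i k
        + sin_coeff j * t i ^ j / t i * (if i = k then - (t i)\<^sup>2 else 0))"
      unfolding sum.distrib sum_distrib_left[symmetric] xx[OF Suc.prems] using Suc.prems by simp
    also have "\<dots> = fact (Suc j) * ((if i = k then cos_coeff (Suc j) * t i ^ Suc j else 0)
        + x i k / t i * (sin_coeff (Suc j) * t i ^ Suc j))"
      using xt[OF Suc.prems] unfolding sin_coeff_Suc cos_coeff_Suc
      by (cases "t i = 0") (auto simp: field_simps power2_eq_square simp del: of_nat_Suc)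
    finally show ?case .
  qed
  have eX: "rexp X = R"
  proof (rule rexpI[OF X R(1)])
    fix i k assume ik: "i < d" "k < d"
    have "(\<lambda>j. cos_coeff j * t i ^ j) sums cos (t i)" "(\<lambda>j. sin_coeff j * t i ^ j) sums sin (t i)"
      using cos_converges[of "t i"] sin_converges[of "t i"] by simp_all
    from sums_add[OF this(1) sums_mult[OF this(2), of "x i k / t i"]]
      sums_mult[OF this(2), of "x i k / t i"]
    have "(\<lambda>j. (if i = k then cos_coeff j * t i ^ j else 0) + x i k / t i * (sin_coeff j * t i ^ j)) sums
        ((if i = k then cos (t i) else 0) + x i k / t i * sin (t i))"
      by (cases "i = k") (simp_all only: if_True if_False add_0 simp_thms)
    moreover have "(if i = k then cos (t i) else 0) + x i k / t i * sin (t i) = R $$ (i, k)"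
    proof -
      have c: "cos (t i) = s i" "sin (t i) = sqrt (1 - (s i)\<^sup>2)"
        using sb[OF ik(1)] by (auto simp: t_def sin_arccos)
      have RK: "R $$ (i, k) = (if i = k then s i else 0) + K i k" by (simp add: K_def)
      show ?thesis
      proof (cases "(s i)\<^sup>2 = 1")
        case True
        then show ?thesis unfolding RK c using Kz[OF ik True] by simp
      next
        case False
        then have "s i \<noteq> - 1" "sqrt (1 - (s i)\<^sup>2) \<noteq> 0" by auto
        moreover from this have "t i \<noteq> 0" using c(2) by auto
        ultimately show ?thesis unfolding RK c by (simp add: x_def g_def)
      qed
    qed
    ultimately show "(\<lambda>j. (X ^\<^sub>m j) $$ (i, k) / fact j) sums (R $$ (i, k))"
      by (simp add: pow[OF ik])
  qed
  have XT: "X\<^sup>T = - X"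
  proof (rule eq_matI)
    fix i k assume "i < dim_row (- X)" "k < dim_col (- X)"
    then have "i < d" "k < d" by (auto simp: X_def)
    then show "X\<^sup>T $$ (i, k) = (- X) $$ (i, k)"
      using xskew[of k i] X by (simp add: Xe)
  qed (auto simp: X_def)
  have "J * X = X * J" if JR: "J * R = R * J"
  proof (rule eq_matI)
    fix i k assume "i < dim_row (X * J)" "k < dim_col (X * J)"
    with X J have ik: "i < d" "k < d" by auto
    have JRe: "(\<Sum>l<d. J $$ (i, l) * R $$ (l, k)) = (\<Sum>l<d. R $$ (i, l) * J $$ (l, k))"
      using arg_cong[OF JR, of "\<lambda>M. M $$ (i, k)"]
      unfolding mult_mat_entry[OF J(1) R(1) ik] mult_mat_entry[OF R(1) J(1) ik] .
    have "(\<Sum>l<d. J $$ (i, l) * K l k) = (\<Sum>l<d. J $$ (i, l) * R $$ (l, k) - (if l = k then J $$ (i, k) * s k else 0))"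
      by (intro sum.cong) (auto simp: K_def algebra_simps)
    also have "\<dots> = (\<Sum>l<d. R $$ (i, l) * J $$ (l, k)) - J $$ (i, k) * s k"
      using ik by (simp add: sum_subtractf JRe)
    also have "J $$ (i, k) * s k = s i * J $$ (i, k)"
      using Js[OF ik] by (cases "s i = s k") auto
    also have "(\<Sum>l<d. R $$ (i, l) * J $$ (l, k)) - s i * J $$ (i, k) =
        (\<Sum>l<d. R $$ (i, l) * J $$ (l, k) - (if l = i then s i * J $$ (i, k) else 0))"
      using ik by (simp add: sum_subtractf)
    also have "\<dots> = (\<Sum>l<d. K i l * J $$ (l, k))"
      by (intro sum.cong) (auto simp: K_def algebra_simps)
    finally have JK: "(\<Sum>l<d. J $$ (i, l) * K l k) = (\<Sum>l<d. K i l * J $$ (l, k))" .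
    have 1: "J $$ (i, l) * x l k = g i * (J $$ (i, l) * K l k)
        + (if s i = - 1 then pi else 0) * (J $$ (i, l) * J $$ (l, k))" if l: "l < d" for l
    proof (cases "s l = s i")
      case True
      then show ?thesis using geq[OF True] by (simp add: x_def algebra_simps)
    next
      case False
      then show ?thesis using Js[of i l] ik l by auto
    qed
    have 2: "x i l * J $$ (l, k) = g i * (K i l * J $$ (l, k))
        + (if s i = - 1 then pi else 0) * (J $$ (i, l) * J $$ (l, k))" for l
      by (simp add: x_def algebra_simps)
    show "(J * X) $$ (i, k) = (X * J) $$ (i, k)"
      unfolding mult_mat_entry[OF J(1) X ik] mult_mat_entry[OF X J(1) ik]
      using ik by (simp add: Xe 1 2 sum.distrib JK flip: sum_distrib_left)
  qed (use X J in auto)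
  then show ?thesis by (rule that[OF X XT eX])
qed

text \<open>
  Diagonalising the symmetric part of \<open>R\<close> brings \<open>R\<close> into the form treated by
  \<open>orthogonal_log_diag\<close>.
\<close>

lemma orthogonal_cosine_diagonalisation:
  fixes R :: "real mat"
  assumes R: "R \<in> carrier_mat d d" "R\<^sup>T * R = 1\<^sub>m d"
  obtains P s where "P \<in> carrier_mat d d" "P\<^sup>T * P = 1\<^sub>m d" "P * P\<^sup>T = 1\<^sub>m d"
    "(P\<^sup>T * R * P) + (P\<^sup>T * R * P)\<^sup>T = mat_diag d (\<lambda>i. 2 * s i)"
    "(P\<^sup>T * R * P)\<^sup>T * (P\<^sup>T * R * P) = 1\<^sub>m d" "(P\<^sup>T * R * P) * (P\<^sup>T * R * P)\<^sup>T = 1\<^sub>m d"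
    "P * (P\<^sup>T * R * P) * P\<^sup>T = R"
proof -
  note as = assoc_mult_mat[of _ d d _ d _ d] mult_carrier_mat[of _ d d]
  have RT: "R\<^sup>T \<in> carrier_mat d d" using R by simp
  have RR: "R * R\<^sup>T = 1\<^sub>m d" by (rule mat_mult_left_right_inverse[OF RT R])
  define S where "S = R + R\<^sup>T"
  have S: "S \<in> carrier_mat d d" "S\<^sup>T = S"
    using R by (auto simp: S_def transpose_add[of _ d d] comm_add_mat[of _ d d])
  obtain P f where P: "P \<in> carrier_mat d d" "P\<^sup>T * P = 1\<^sub>m d" "P * P\<^sup>T = 1\<^sub>m d"
    and Sd: "S = P * mat_diag d f * P\<^sup>T" using symmetric_diagonalisable[OF S] .
  note cancel = mat_mult_eq_one_cancel[OF P(2)] mat_mult_eq_one_cancel[OF P(3)]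
  have PT: "P\<^sup>T \<in> carrier_mat d d" using P by simp
  have T: "(P\<^sup>T * R * P)\<^sup>T = P\<^sup>T * R\<^sup>T * P"
    using P R by (simp add: as transpose_mult[of _ d d _ d])
  have "(P\<^sup>T * R * P) + P\<^sup>T * R\<^sup>T * P = P\<^sup>T * S * P"
    unfolding S_def using P(1) R(1)
    by (simp add: mult_add_distrib_mat[of _ d d _ d] add_mult_distrib_mat[of _ d d _ _ d] as)
  also have "\<dots> = mat_diag d (\<lambda>i. 2 * (f i / 2))"
    unfolding Sd using P(1) by (simp add: as cancel P(2) right_mult_one_mat[OF mat_diag_dim])
  finally have 1: "(P\<^sup>T * R * P) + (P\<^sup>T * R * P)\<^sup>T = mat_diag d (\<lambda>i. 2 * (f i / 2))" unfolding T .
  have 2: "(P\<^sup>T * R * P)\<^sup>T * (P\<^sup>T * R * P) = 1\<^sub>m d"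
    unfolding T using P(1) R(1) by (simp add: as cancel mat_mult_eq_one_cancel[OF R(2)] P(2))
  have 3: "(P\<^sup>T * R * P) * (P\<^sup>T * R * P)\<^sup>T = 1\<^sub>m d"
    unfolding T using P(1) R(1) by (simp add: as cancel mat_mult_eq_one_cancel[OF RR] P(2))
  have 4: "P * (P\<^sup>T * R * P) * P\<^sup>T = R"
    using P(1) R(1) by (simp add: as cancel P(3))
  show ?thesis by (rule that[OF P 1 2 3 4])
qed

lemma skew_conj:
  fixes X :: "real mat"
  assumes X: "X \<in> carrier_mat d d" "X\<^sup>T = - X" and P: "P \<in> carrier_mat d d"
  shows "(P * X * P\<^sup>T)\<^sup>T = - (P * X * P\<^sup>T)"
proof -
  have PX: "P * X \<in> carrier_mat d d" and PT: "P\<^sup>T \<in> carrier_mat d d" using X P by auto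
  have "(P * X * P\<^sup>T)\<^sup>T = P * (X\<^sup>T * P\<^sup>T)"
    using transpose_mult[OF PX PT] transpose_mult[OF P X(1)] by simp
  also have "\<dots> = - (P * (X * P\<^sup>T))"
    unfolding X(2) using X(1) P PT by simp
  also have "P * (X * P\<^sup>T) = P * X * P\<^sup>T" using X(1) P PT by (simp add: assoc_mult_mat[of _ d d _ d _ d])
  finally show ?thesis .
qed

text \<open>
  The orthogonal matrices commuting with \<open>J\<close> form the unitary group.  Here \<open>J\<close> itself, transported to the
  eigenbasis, is the complex structure on the eigenspace of \<open>-1\<close>, and every
  ingredient of the logarithm commutes with it.
\<close>

lemma unitary_log:
  fixes U J :: "real mat"
  assumes U: "U \<in> carrier_mat d d" "U\<^sup>T * U = 1\<^sub>m d"
    and J: "J \<in> carrier_mat d d" "J\<^sup>T = - J" "J\<^sup>T * J = 1\<^sub>m d" and JU: "J * U = U * J"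
  obtains X where "X \<in> carrier_mat d d" "X\<^sup>T = - X" "J * X = X * J" "rexp X = U"
proof -
  note as = assoc_mult_mat[of _ d d _ d _ d] mult_carrier_mat[of _ d d]
  obtain P s where P: "P \<in> carrier_mat d d" "P\<^sup>T * P = 1\<^sub>m d" "P * P\<^sup>T = 1\<^sub>m d"
    and s: "(P\<^sup>T * U * P) + (P\<^sup>T * U * P)\<^sup>T = mat_diag d (\<lambda>i. 2 * s i)"
    and R1: "(P\<^sup>T * U * P)\<^sup>T * (P\<^sup>T * U * P) = 1\<^sub>m d" and R2: "(P\<^sup>T * U * P) * (P\<^sup>T * U * P)\<^sup>T = 1\<^sub>m d"
    and PU: "P * (P\<^sup>T * U * P) * P\<^sup>T = U"
    using orthogonal_cosine_diagonalisation[OF U] .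
  note cancel = mat_mult_eq_one_cancel[OF P(2)] mat_mult_eq_one_cancel[OF P(3)]
  define R where "R = P\<^sup>T * U * P"
  define L where "L = P\<^sup>T * J * P"
  have PT: "P\<^sup>T \<in> carrier_mat d d" using P by simp
  have R: "R \<in> carrier_mat d d" using P(1) U(1) by (simp add: R_def as)
  have L: "L \<in> carrier_mat d d" using P(1) J(1) by (simp add: L_def as)
  have LT: "L\<^sup>T = - L"
    unfolding L_def using skew_conj[OF J(1,2) PT] by simp
  have JJ: "J * J = - 1\<^sub>m d"
  proof -
    have "- J * J = 1\<^sub>m d" using J(2,3) by simp
    then have "- (J * J) = 1\<^sub>m d" using J(1) by simp
    then show ?thesis by (metis uminus_uminus_mat)
  qed
  have LL: "L * L = - 1\<^sub>m d"
  proof -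
    have "L * L = P\<^sup>T * (J * J) * P" unfolding L_def using P(1) J(1) by (simp add: as cancel)
    then show ?thesis unfolding JJ using P by simp
  qed
  have LR: "L * R = R * L"
  proof -
    have "L * R = P\<^sup>T * (J * U) * P" unfolding L_def R_def using P(1) J(1) U(1) by (simp add: as cancel)
    also have "\<dots> = R * L" unfolding JU unfolding L_def R_def using P(1) J(1) U(1) by (simp add: as cancel)
    finally show ?thesis .
  qed
  have RT: "R\<^sup>T \<in> carrier_mat d d" using R by simp
  note R12 = R1[folded R_def] R2[folded R_def]
  have LRT: "L * R\<^sup>T = R\<^sup>T * L"
  proof -
    have "L * R\<^sup>T = R\<^sup>T * (R * L) * R\<^sup>T"
      using L R by (simp add: as mat_mult_eq_one_cancel[OF R12(1)])
    also have "\<dots> = R\<^sup>T * L" unfolding LR[symmetric] using L R by (simp add: as R12)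
    finally show ?thesis .
  qed
  have Ls: "L $$ (i, k) = 0" if ik: "i < d" "k < d" "s i \<noteq> s k" for i k
  proof -
    have "L * (R + R\<^sup>T) = (R + R\<^sup>T) * L"
      using L R RT LR LRT
      by (simp add: mult_add_distrib_mat[of _ d d _ d] add_mult_distrib_mat[of _ d d _ _ d])
    then have "(L * mat_diag d (\<lambda>i. 2 * s i)) $$ (i, k) = (mat_diag d (\<lambda>i. 2 * s i) * L) $$ (i, k)"
      unfolding R_def s by simp
    then show ?thesis
      using L ik by (simp add: mat_diag_mult_left[of _ d d] mat_diag_mult_right[of _ d d])
  qed
  obtain X where X: "X \<in> carrier_mat d d" "X\<^sup>T = - X" "rexp X = R" and LX: "L * R = R * L \<Longrightarrow> L * X = X * L"
  proof (rule orthogonal_log_diag[OF R R12 s[folded R_def] L LT Ls])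
    show "(L * L) $$ (i, k) = (if i = k then - 1 else 0)" if "i < d" "k < d" for i k
      unfolding LL using that by simp
  qed blast+
  show ?thesis
  proof (rule that)
    show "P * X * P\<^sup>T \<in> carrier_mat d d" using X P by simp
    show "(P * X * P\<^sup>T)\<^sup>T = - (P * X * P\<^sup>T)" by (rule skew_conj[OF X(1,2) P(1)])
    have PL: "J = P * L * P\<^sup>T" unfolding L_def using P(1,3) J(1) by (simp add: as cancel)
    have "J * (P * X * P\<^sup>T) = P * (L * X) * P\<^sup>T"
      unfolding PL using P(1) X(1) L by (simp add: as cancel)
    also have "\<dots> = (P * X * P\<^sup>T) * J"
      unfolding LX[OF LR] unfolding PL using P(1) X(1) L by (simp add: as cancel)
    finally show "J * (P * X * P\<^sup>T) = (P * X * P\<^sup>T) * J" .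
    show "rexp (P * X * P\<^sup>T) = U"
      using rexp_orthogonal_conj[OF X(1) P] PU by (simp add: X(3) R_def)
  qed
qed

text \<open>
  The entries of \<open>Omega\<close>, by \<open>Omega_eq\<close>, as a function on all pairs of naturals that does not depend
  on the size of the matrix.
\<close>

definition omega_entry :: "nat \<Rightarrow> nat \<Rightarrow> real" where
  "omega_entry a b = (if even a \<and> b = Suc a then 1 else if odd a \<and> a = Suc b then - 1 else 0)"

lemma omega_entry_skew: "omega_entry a b = - omega_entry b a"
  by (auto simp: omega_entry_def)

text \<open>
  Row \<open>a\<close> has its only nonzero entry in the column paired with \<open>a\<close>.
\<close>

lemma omega_entry_square:
  assumes "a < 2 * n" "c < 2 * n"
  shows "(\<Sum>b<2 * n. omega_entry a b * omega_entry b c) = (if a = c then - 1 else 0)"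
proof -
  define p where "p = (if even a then Suc a else a - 1)"
  have p: "p < 2 * n" using assms by (auto simp: p_def elim!: evenE) 
  have "(\<Sum>b<2 * n. omega_entry a b * omega_entry b c) =
      (\<Sum>b<2 * n. if b = p then omega_entry a p * omega_entry p c else 0)"
    by (intro sum.cong) (auto simp: omega_entry_def p_def)
  also have "\<dots> = omega_entry a p * omega_entry p c" using p by simp
  also have "\<dots> = (if a = c then - 1 else 0)"
    by (auto simp: omega_entry_def p_def elim!: oddE)
  finally show ?thesis .
qed

lemma Omega_eq: "Omega n = mat (2 * n) (2 * n) (\<lambda>(a, b). omega_entry a b)"
proof (induction n)
  case 0
  show ?case by (auto simp: Omega_def)
next
  case (Suc n)
  let ?B = "mat_of_rows_list 2 [[0, 1], [- 1, 0]] :: real mat"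
  have B: "?B \<in> carrier_mat 2 2" by (auto simp: mat_of_rows_list_def)
  have "Omega (Suc n) = dsum ?B (Omega n)"
    by (simp only: Omega_def dsum_def replicate_Suc diag_block_mat.simps(2)[of ?B] diag_block_mat_singleton)
  also have "\<dots> = mat (2 * Suc n) (2 * Suc n) (\<lambda>(a, b). omega_entry a b)" (is "_ = ?R")
  proof (rule eq_matI)
    have O: "Omega n \<in> carrier_mat (2 * n) (2 * n)" by (simp add: Suc)
    show "dim_row (dsum ?B (Omega n)) = dim_row ?R" "dim_col (dsum ?B (Omega n)) = dim_col ?R"
      using carrier_matD[OF dsum_carrier[OF B O]] by auto
    fix i k assume "i < dim_row ?R" "k < dim_col ?R"
    then have ik: "i < 2 + 2 * n" "k < 2 + 2 * n" by auto
    have B2: "?B $$ (a, b) = omega_entry a b" if "a < 2" "b < 2" for a b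
      using that by (auto simp: mat_of_rows_list_def omega_entry_def less_2_cases_iff)
    have sh: "omega_entry (i - 2) (k - 2) = omega_entry i k" if "\<not> i < 2" "\<not> k < 2"
    proof -
      have "i = Suc (Suc (i - 2))" "k = Suc (Suc (k - 2))" using that by auto
      then obtain a b where "i = Suc (Suc a)" "k = Suc (Suc b)" by blast
      then show ?thesis by (simp add: omega_entry_def)
    qed
    have z: "omega_entry i k = 0" if "(i < 2) \<noteq> (k < 2)"
    proof -
      have "i = 0 \<or> i = 1 \<or> k = 0 \<or> k = 1" using that by linarith
      then show ?thesis using that by (elim disjE) (auto simp: omega_entry_def)
    qed
    show "dsum ?B (Omega n) $$ (i, k) = ?R $$ (i, k)"
    proof (cases "i < 2"; cases "k < 2")
      assume "i < 2" "k < 2"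
      then show ?thesis unfolding dsum_entry[OF B O ik] using ik B2[of i k] by simp
    next
      assume "\<not> i < 2" "\<not> k < 2"
      then have "i - 2 < 2 * n" "k - 2 < 2 * n" using ik by auto
      with \<open>\<not> i < 2\<close> \<open>\<not> k < 2\<close> show ?thesis
        unfolding dsum_entry[OF B O ik] using ik sh by (simp add: Suc)
    qed (use ik z in \<open>simp_all add: dsum_entry[OF B O ik]\<close>)
  qed
  finally show ?case .
qed

lemma Omega_carrier [simp]: "Omega n \<in> carrier_mat (2 * n) (2 * n)"
  by (simp add: Omega_eq)

lemma Omega_skew: "(Omega n)\<^sup>T = - Omega n"
proof (rule eq_matI)
  fix i k assume "i < dim_row (- Omega n)" "k < dim_col (- Omega n)"
  then show "(Omega n)\<^sup>T $$ (i, k) = (- Omega n) $$ (i, k)"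
    using omega_entry_skew[of k i] by (simp add: Omega_eq)
qed (auto simp: Omega_eq)

lemma Omega_square: "Omega n * Omega n = - 1\<^sub>m (2 * n)"
proof (rule eq_matI)
  fix i k assume "i < dim_row (- 1\<^sub>m (2 * n) :: real mat)" "k < dim_col (- 1\<^sub>m (2 * n) :: real mat)"
  then have ik: "i < 2 * n" "k < 2 * n" by auto
  then show "(Omega n * Omega n) $$ (i, k) = (- 1\<^sub>m (2 * n)) $$ (i, k)"
    using mult_mat_entry[OF Omega_carrier Omega_carrier ik] omega_entry_square[OF ik]
    by (simp add: Omega_eq)
qed (auto simp: carrier_matD[OF Omega_carrier])

lemma Omega_orthogonal: "(Omega n)\<^sup>T * Omega n = 1\<^sub>m (2 * n)"
proof -
  have "- Omega n * Omega n = - (Omega n * Omega n)"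
    by (rule uminus_mult_left_mat) (simp add: carrier_matD[OF Omega_carrier])
  then show ?thesis unfolding Omega_skew Omega_square by simp
qed

text \<open>
  Number the elements of \<open>I\<close> and transport the matrix \<open>Omega\<close>.
\<close>

lemma coordinate_complex_structure:
  assumes I: "I \<subseteq> {..<d}" and ev: "even (card I)"
  obtains J :: "real mat" where "J \<in> carrier_mat d d" "J\<^sup>T = - J"
    "\<And>i k. i < d \<Longrightarrow> k < d \<Longrightarrow> i \<notin> I \<or> k \<notin> I \<Longrightarrow> J $$ (i, k) = 0"
    "\<And>i k. i < d \<Longrightarrow> k < d \<Longrightarrow> i \<in> I \<Longrightarrow> (J * J) $$ (i, k) = (if i = k then - 1 else 0)"
proof -
  have fin: "finite I" using I finite_subset by blast
  obtain n where n: "card I = 2 * n" using ev by (elim evenE)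
  obtain h where h: "bij_betw h I {0..<card I}"
    using ex_bij_betw_finite_nat[OF fin] by blast
  then have h: "bij_betw h I {..<2 * n}" by (simp add: n atLeast0LessThan)
  have hI: "h i < 2 * n" if "i \<in> I" for i using h that by (auto dest!: bij_betwE)
  have inj: "h i = h k \<longleftrightarrow> i = k" if "i \<in> I" "k \<in> I" for i k
    using h that unfolding bij_betw_def inj_on_def by blast
  define J where "J = mat d d (\<lambda>(i, k). if i \<in> I \<and> k \<in> I then omega_entry (h i) (h k) else 0)"
  have JC: "J \<in> carrier_mat d d" by (simp add: J_def)
  have Je: "J $$ (i, k) = (if i \<in> I \<and> k \<in> I then omega_entry (h i) (h k) else 0)" if "i < d" "k < d" for i k
    using that by (simp add: J_def)
  show ?thesis
  proof (rule that[OF JC])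
    show "J\<^sup>T = - J"
    proof (rule eq_matI)
      fix i k assume "i < dim_row (- J)" "k < dim_col (- J)"
      then have "i < d" "k < d" by (auto simp: J_def)
      then show "J\<^sup>T $$ (i, k) = (- J) $$ (i, k)"
        using omega_entry_skew[of "h k" "h i"] JC by (simp add: Je)
    qed (auto simp: J_def)
    show "J $$ (i, k) = 0" if "i < d" "k < d" "i \<notin> I \<or> k \<notin> I" for i k
      using that by (auto simp: Je)
    fix i k assume ik: "i < d" "k < d" and iI: "i \<in> I"
    have "(J * J) $$ (i, k) = (\<Sum>l<d. J $$ (i, l) * J $$ (l, k))"
      by (rule mult_mat_entry[OF JC JC ik])
    also have "\<dots> = (\<Sum>l\<in>I. J $$ (i, l) * J $$ (l, k))"
      using I ik by (intro sum.mono_neutral_right) (auto simp: Je)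
    also have "\<dots> = (if i = k then - 1 else 0)"
    proof (cases "k \<in> I")
      case True
      have "(\<Sum>l\<in>I. J $$ (i, l) * J $$ (l, k)) = (\<Sum>l\<in>I. omega_entry (h i) (h l) * omega_entry (h l) (h k))"
        using I ik iI True by (intro sum.cong) (auto simp: Je)
      also have "\<dots> = (\<Sum>b<2 * n. omega_entry (h i) b * omega_entry b (h k))"
        by (rule sum.reindex_bij_betw[OF h])
      finally show ?thesis
        using omega_entry_square[OF hI[OF iI] hI[OF True]] inj[OF iI True] by simp
    next
      case False
      then have "(\<Sum>l\<in>I. J $$ (i, l) * J $$ (l, k)) = 0"
        using I ik by (intro sum.neutral) (auto simp: Je)
      with False iI show ?thesis by auto
    qed
    finally show "(J * J) $$ (i, k) = (if i = k then - 1 else 0)" .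
  qed
qed

lemma det_mat_diag: "det (mat_diag d f) = (\<Prod>i<d. f i :: real)"
proof -
  have "det (mat_diag d f) = prod_list (diag_mat (mat_diag d f))"
    by (rule det_upper_triangular[of _ d]) (auto simp: mat_diag_def)
  also have "diag_mat (mat_diag d f) = map f [0..<d]"
    by (auto simp: diag_mat_def mat_diag_def)
  also have "prod_list (map f [0..<d]) = (\<Prod>i<d. f i)"
    by (simp add: prod.distinct_set_conv_list[symmetric] atLeast0LessThan)
  finally show ?thesis .
qed

text \<open>
  The eigenspace of \<open>-1\<close> has even dimension: flipping its sign gives an orthogonal matrix
  without eigenvalue \<open>-1\<close>, which is an exponential and has positive determinant, while the flip
  has determinant \<open>(-1)\<close> to the power of this dimension.  An even-dimensional eigenspace carries
  a complex structure.
\<close>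

lemma special_orthogonal_log:
  fixes A :: "real mat"
  assumes A: "A \<in> carrier_mat d d" "A\<^sup>T * A = 1\<^sub>m d" and det: "det A > 0"
  obtains X where "X \<in> carrier_mat d d" "X\<^sup>T = - X" "rexp X = A"
proof -
  obtain P s where P: "P \<in> carrier_mat d d" "P\<^sup>T * P = 1\<^sub>m d" "P * P\<^sup>T = 1\<^sub>m d"
    and s: "(P\<^sup>T * A * P) + (P\<^sup>T * A * P)\<^sup>T = mat_diag d (\<lambda>i. 2 * s i)"
    and R1: "(P\<^sup>T * A * P)\<^sup>T * (P\<^sup>T * A * P) = 1\<^sub>m d" and R2: "(P\<^sup>T * A * P) * (P\<^sup>T * A * P)\<^sup>T = 1\<^sub>m d"
    and PA: "P * (P\<^sup>T * A * P) * P\<^sup>T = A"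
    using orthogonal_cosine_diagonalisation[OF A] .
  define R where "R = P\<^sup>T * A * P"
  have R: "R \<in> carrier_mat d d" using P(1) A(1) by (simp add: R_def mult_carrier_mat[of _ d d])
  note R12 = R1[folded R_def] R2[folded R_def]
  note s = s[folded R_def]
  have RT: "R\<^sup>T \<in> carrier_mat d d" using R by simp
  have PT: "P\<^sup>T \<in> carrier_mat d d" using P by simp
  have detR: "det R > 0"
  proof -
    have "det R = det P\<^sup>T * det P * det A"
      unfolding R_def using P(1) A(1) by (simp add: det_mult[of _ d] mult_carrier_mat[of _ d d])
    also have "det P\<^sup>T * det P = 1" using det_mult[OF PT P(1)] by (simp add: P(2))
    finally show ?thesis using det by simp
  qed
  define I where "I = {i. i < d \<and> s i = - 1}"
  have ev: "even (card I)"
  proof -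
    define f :: "nat \<Rightarrow> real" where "f i = (if s i = - 1 then - 1 else 1)" for i
    define F where "F = mat_diag d f"
    have F: "F \<in> carrier_mat d d" by (simp add: F_def)
    have FT: "F\<^sup>T = F" by (rule eq_matI) (auto simp: F_def mat_diag_def)
    have "mat_diag d (\<lambda>i. f i * f i) = 1\<^sub>m d" unfolding f_def by (rule eq_matI) (auto simp: mat_diag_def)
    then have FF: "F * F = 1\<^sub>m d" by (simp add: F_def)
    note as = assoc_mult_mat[of _ d d _ d _ d] mult_carrier_mat[of _ d d]
    have RFT: "(R * F)\<^sup>T = F * R\<^sup>T" using R F by (simp add: transpose_mult[of _ d d _ d] FT)
    have RF: "R * F \<in> carrier_mat d d" using R F by simp
    have 1: "(R * F)\<^sup>T * (R * F) = 1\<^sub>m d"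
      unfolding RFT using R F by (simp add: as mat_mult_eq_one_cancel[OF R12(1)] FF)
    have 2: "(R * F) * (R * F)\<^sup>T = 1\<^sub>m d"
      unfolding RFT using R F by (simp add: as mat_mult_eq_one_cancel[OF FF] R12)
    have 3: "R * F + (R * F)\<^sup>T = mat_diag d (\<lambda>i. 2 * (s i * f i))"
    proof (rule eq_matI)
      fix i k assume "i < dim_row (mat_diag d (\<lambda>i. 2 * (s i * f i)))" "k < dim_col (mat_diag d (\<lambda>i. 2 * (s i * f i)))"
      then have ik: "i < d" "k < d" by (auto simp: mat_diag_def)
      have e: "(R * F + (R * F)\<^sup>T) $$ (i, k) = R $$ (i, k) * f k + f i * R $$ (k, i)"
        unfolding RFT using ik R by (simp add: F_def mat_diag_mult_left[of _ d d] mat_diag_mult_right[of _ d d])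
      have sum: "R $$ (i, k) + R $$ (k, i) = (if i = k then 2 * s i else 0)"
        using arg_cong[OF s, of "\<lambda>M. M $$ (i, k)"] ik R by (auto simp: mat_diag_def)
      show "(R * F + (R * F)\<^sup>T) $$ (i, k) = mat_diag d (\<lambda>i. 2 * (s i * f i)) $$ (i, k)"
      proof (cases "s i = s k")
        case True
        then have "f k = f i" by (simp add: f_def)
        then have "(R * F + (R * F)\<^sup>T) $$ (i, k) = f i * (R $$ (i, k) + R $$ (k, i))"
          unfolding e by (simp add: algebra_simps)
        then show ?thesis unfolding sum using ik by (simp add: mat_diag_def)
      next
        case False
        then have "R $$ (i, k) = 0" "R $$ (k, i) = 0" "i \<noteq> k"
          using orthogonal_commutes_with_cosines[OF R R12 s] ik by auto
        then show ?thesis unfolding e using ik by (simp add: mat_diag_def)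
      qed
    qed (use RF in \<open>auto simp: mat_diag_def\<close>)
    obtain X where X: "X \<in> carrier_mat d d" "rexp X = R * F"
    proof (rule orthogonal_log_diag[OF RF 1 2 3, of "0\<^sub>m d d"])
      show "((0\<^sub>m d d :: real mat) * 0\<^sub>m d d) $$ (i, k) = (if i = k then - 1 else 0)"
        if "s i * f i = - 1" for i k
        using that by (auto simp: f_def split: if_splits)
      show "(0\<^sub>m d d :: real mat)\<^sup>T = - 0\<^sub>m d d" by (rule eq_matI) auto
    qed auto
    have "det R * det F > 0"
      using det_rexp_pos[OF X(1)] R F by (simp add: X(2) det_mult[of _ d])
    then have "det F > 0" using detR by (simp add: zero_less_mult_iff)
    moreover have "det F = (- 1) ^ card I"
    proof -
      have "{..<d} \<inter> {i. s i = - 1} = I" by (auto simp: I_def)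
      then show ?thesis unfolding F_def det_mat_diag f_def by (simp add: prod.If_cases)
    qed
    ultimately show ?thesis by (auto simp: uminus_power_if split: if_splits)
  qed
  have I: "I \<subseteq> {..<d}" by (auto simp: I_def)
  obtain J :: "real mat" where J: "J \<in> carrier_mat d d" "J\<^sup>T = - J"
    "\<And>i k. i < d \<Longrightarrow> k < d \<Longrightarrow> i \<notin> I \<or> k \<notin> I \<Longrightarrow> J $$ (i, k) = 0"
    "\<And>i k. i < d \<Longrightarrow> k < d \<Longrightarrow> i \<in> I \<Longrightarrow> (J * J) $$ (i, k) = (if i = k then - 1 else 0)"
    by (rule coordinate_complex_structure[OF I ev]) blast
  have Js: "J $$ (i, k) = 0" if "i < d" "k < d" "s i \<noteq> s k" for i k
    using that by (intro J(3)) (auto simp: I_def)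
  have JJ: "(J * J) $$ (i, k) = (if i = k then - 1 else 0)" if "i < d" "k < d" "s i = - 1" for i k
    using that by (intro J(4)) (auto simp: I_def)
  obtain X where X: "X \<in> carrier_mat d d" "X\<^sup>T = - X" "rexp X = R"
    by (rule orthogonal_log_diag[OF R R12 s J(1,2) Js JJ]) blast+
  show ?thesis
  proof (rule that)
    show "P * X * P\<^sup>T \<in> carrier_mat d d" using X P by simp
    show "(P * X * P\<^sup>T)\<^sup>T = - (P * X * P\<^sup>T)" by (rule skew_conj[OF X(1,2) P(1)])
    show "rexp (P * X * P\<^sup>T) = A"
      using rexp_orthogonal_conj[OF X(1) P] PA by (simp add: X(3) R_def)
  qed
qed

section \<open>Bodies of supermatrices\<close>

lemma body_entry:
  assumes "X \<in> carrier_mat p q" "i < p" "k < q"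
  shows "body X $$ (i, k) = gcoeff (X $$ (i, k)) {}"
  using assms by (simp add: body_def)

lemma bodiless_iff:
  assumes "X \<in> carrier_mat d d"
  shows "bodiless d X \<longleftrightarrow> body X = 0\<^sub>m d d"
proof
  assume "bodiless d X"
  then show "body X = 0\<^sub>m d d"
    using assms by (intro eq_matI) (auto simp: bodiless_def body_def)
next
  assume "body X = 0\<^sub>m d d"
  then show "bodiless d X"
    unfolding bodiless_def using body_entry[OF assms] by auto
qed

lemma bodiless_minus_one:
  assumes L: "L \<in> carrier_mat d d" and bL: "body L = 1\<^sub>m d"
  shows "bodiless d (L - 1\<^sub>m d)"
  unfolding bodiless_def
proof (intro allI impI)
  fix i k assume ik: "i < d" "k < d"
  have "gcoeff (L $$ (i, k)) {} = (if i = k then 1 else 0)"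
    using body_entry[OF L ik] ik by (simp add: bL)
  then show "gcoeff ((L - 1\<^sub>m d) $$ (i, k)) {} = 0"
    using L ik by (simp add: minus_grassmann.rep_eq one_grassmann.rep_eq zero_grassmann.rep_eq)
qed

lemma rexp_zero: "rexp (0\<^sub>m d d) = 1\<^sub>m d"
proof -
  have "real_mat (0\<^sub>m d d) = 0\<^sub>m d d" by (rule eq_matI) (auto simp: real_mat_def)
  then show ?thesis by (simp add: rexp_def mexp_zero body_one)
qed

lemma body_mexp_bodiless:
  assumes "Z \<in> carrier_mat d d" "bodiless d Z"
  shows "body (mexp Z) = 1\<^sub>m d"
  using assms by (simp add: body_mexp bodiless_iff rexp_zero)

lemma real_mat_dsum_SMat:
  assumes "A \<in> carrier_mat m m" "B \<in> carrier_mat (2 * n) (2 * n)"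
  shows "real_mat (dsum A B) \<in> SMat m n N"
proof -
  note c = dsum_carrier[OF assms]
  show ?thesis
    unfolding SMat_iff parity_supported_def using c dsum_entry[OF assms]
    by (auto simp: real_mat_def gcoeff_of_real split: if_splits)
qed

text \<open>
  The blocks off the diagonal have odd entries, and the empty set has even cardinality.
\<close>

lemma body_SMat:
  assumes M: "M \<in> SMat m n N"
  shows "body M = dsum (mat m m (\<lambda>(i, k). gcoeff (M $$ (i, k)) {}))
    (mat (2 * n) (2 * n) (\<lambda>(i, k). gcoeff (M $$ (i + m, k + m)) {}))" (is "_ = dsum ?A ?D")
proof (rule eq_matI)
  have A: "?A \<in> carrier_mat m m" and D: "?D \<in> carrier_mat (2 * n) (2 * n)" by auto
  note c = carrier_matD[OF dsum_carrier[OF A D]] SMat_carrier[OF M]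
  show "dim_row (body M) = dim_row (dsum ?A ?D)" "dim_col (body M) = dim_col (dsum ?A ?D)"
    using c by (auto simp: body_def)
  fix i k assume "i < dim_row (dsum ?A ?D)" "k < dim_col (dsum ?A ?D)"
  then have ik: "i < m + 2 * n" "k < m + 2 * n" using c by auto
  have z: "gcoeff (M $$ (i, k)) {} = 0" if "(i < m) \<noteq> (k < m)"
  proof (rule ccontr)
    assume "gcoeff (M $$ (i, k)) {} \<noteq> 0"
    moreover have "parity_supported N ((i < m) = (k < m)) (M $$ (i, k))"
      using M ik unfolding SMat_iff by blast
    ultimately show False using that unfolding parity_supported_def by fastforce
  qed
  show "body M $$ (i, k) = dsum ?A ?D $$ (i, k)"
    unfolding dsum_entry[OF A D ik] body_entry[OF c(3) ik] using ik z by auto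
qed

lemma body_supertranspose:
  assumes M: "M \<in> SMat m n N"
  shows "body (supertranspose m M) = (body M)\<^sup>T"
proof (rule eq_matI)
  note c = SMat_carrier[OF M]
  note st = supertranspose_carrier[OF c]
  show "dim_row (body (supertranspose m M)) = dim_row ((body M)\<^sup>T)"
    "dim_col (body (supertranspose m M)) = dim_col ((body M)\<^sup>T)"
    using c st by (auto simp: body_def)
  fix i k assume "i < dim_row ((body M)\<^sup>T)" "k < dim_col ((body M)\<^sup>T)"
  then have ik: "i < m + 2 * n" "k < m + 2 * n" using c by (auto simp: body_def)
  have A: "mat m m (\<lambda>(i, k). gcoeff (M $$ (i, k)) {}) \<in> carrier_mat m m"
    and D: "mat (2 * n) (2 * n) (\<lambda>(i, k). gcoeff (M $$ (i + m, k + m)) {}) \<in> carrier_mat (2 * n) (2 * n)"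
    by auto
  have "body M $$ (k, i) = 0" if "\<not> i < m" "k < m"
    unfolding body_SMat[OF M] dsum_entry[OF A D ik(2) ik(1)] using that by simp
  then have "gcoeff (M $$ (k, i)) {} = 0" if "\<not> i < m" "k < m"
    using that body_entry[OF c ik(2) ik(1)] by simp
  then show "body (supertranspose m M) $$ (i, k) = (body M)\<^sup>T $$ (i, k)"
    using ik c body_entry[OF c ik(2) ik(1)]
    unfolding body_entry[OF st ik] supertranspose_entry[OF c ik]
    by (auto simp: uminus_grassmann.rep_eq body_def)
qed

text \<open>
  The matrix \<open>Qmat\<close> before its entries are embedded into the Grassmann algebra.
\<close>

definition real_Q :: "nat \<Rightarrow> nat \<Rightarrow> real mat" where
  "real_Q m n = dsum (1\<^sub>m m) ((- 1 / 2) \<cdot>\<^sub>m Omega n)"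

lemma Qmat_eq: "Qmat m n = real_mat (real_Q m n)"
  unfolding Qmat_def real_Q_def
  by (subst dsum_eq[of _ m _ "2 * n"]) simp_all

lemma real_Q_carrier: "real_Q m n \<in> carrier_mat (m + 2 * n) (m + 2 * n)"
  unfolding real_Q_def by (intro dsum_carrier) auto

lemma smult_smult_mat: "a \<cdot>\<^sub>m (b \<cdot>\<^sub>m X) = (a * b :: 'a :: semiring_1) \<cdot>\<^sub>m X"
  by (rule eq_matI) (auto simp: mult.assoc)

lemma real_Q_inverse:
  obtains R where "R \<in> carrier_mat (m + 2 * n) (m + 2 * n)"
    "real_Q m n * R = 1\<^sub>m (m + 2 * n)" "R * real_Q m n = 1\<^sub>m (m + 2 * n)"
proof (rule that[of "dsum (1\<^sub>m m) (2 \<cdot>\<^sub>m Omega n)"])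
  have O: "a \<cdot>\<^sub>m Omega n \<in> carrier_mat (2 * n) (2 * n)" for a by simp
  show "dsum (1\<^sub>m m) (2 \<cdot>\<^sub>m Omega n) \<in> carrier_mat (m + 2 * n) (m + 2 * n)"
    by (intro dsum_carrier O) simp
  have p: "(a \<cdot>\<^sub>m Omega n) * (b \<cdot>\<^sub>m Omega n) = (- (a * b)) \<cdot>\<^sub>m 1\<^sub>m (2 * n)" for a b
  proof -
    have "(a \<cdot>\<^sub>m Omega n) * (b \<cdot>\<^sub>m Omega n) = a \<cdot>\<^sub>m (Omega n * (b \<cdot>\<^sub>m Omega n))"
      by (rule mult_smult_assoc_mat[OF Omega_carrier O])
    also have "Omega n * (b \<cdot>\<^sub>m Omega n) = b \<cdot>\<^sub>m (Omega n * Omega n)"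
      by (rule mult_smult_distrib[OF Omega_carrier Omega_carrier])
    finally have "(a \<cdot>\<^sub>m Omega n) * (b \<cdot>\<^sub>m Omega n) = (a * b) \<cdot>\<^sub>m (Omega n * Omega n)"
      by (simp add: smult_smult_mat)
    then show ?thesis unfolding Omega_square by (auto intro!: eq_matI)
  qed
  show "real_Q m n * dsum (1\<^sub>m m) (2 \<cdot>\<^sub>m Omega n) = 1\<^sub>m (m + 2 * n)"
    "dsum (1\<^sub>m m) (2 \<cdot>\<^sub>m Omega n) * real_Q m n = 1\<^sub>m (m + 2 * n)"
    unfolding real_Q_def dsum_mult[OF one_carrier_mat O one_carrier_mat O] p
    by (simp_all add: smult_one_mat dsum_one)
qed

lemma dsum_inj:
  assumes "A \<in> carrier_mat p p" "B \<in> carrier_mat q q" "A' \<in> carrier_mat p p" "B' \<in> carrier_mat q q"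
    and eq: "dsum A B = dsum A' B'"
  shows "A = A'" "B = B'"
proof -
  have e: "dsum A B $$ (i, k) = dsum A' B' $$ (i, k)" for i k by (simp add: eq)
  show "A = A'"
  proof (rule eq_matI)
    fix i k assume "i < dim_row A'" "k < dim_col A'"
    then show "A $$ (i, k) = A' $$ (i, k)"
      using e[of i k] dsum_entry[OF assms(1,2), of i k] dsum_entry[OF assms(3,4), of i k] assms by auto
  qed (use assms in auto)
  show "B = B'"
  proof (rule eq_matI)
    fix i k assume "i < dim_row B'" "k < dim_col B'"
    then show "B $$ (i, k) = B' $$ (i, k)"
      using e[of "i + p" "k + p"] dsum_entry[OF assms(1,2), of "i + p" "k + p"]
        dsum_entry[OF assms(3,4), of "i + p" "k + p"] assms by auto
  qed (use assms in auto)
qed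

section \<open>The superdeterminant\<close>

text \<open>
  After multiplication by the inverse of its body, \<open>D\<close> has body \<open>1\<close> and is an exponential, so
  it has an inverse within the same algebra.
\<close>

lemma SMat_even_inverse:
  assumes D: "D \<in> SMat 0 n N" and V: "V \<in> carrier_mat (2 * n) (2 * n)"
    and DV: "body D * V = 1\<^sub>m (2 * n)" "V * body D = 1\<^sub>m (2 * n)"
  obtains E where "E \<in> SMat 0 n N" "D * E = 1\<^sub>m (2 * n)" "E * D = 1\<^sub>m (2 * n)"
proof -
  let ?d = "2 * n"
  note as = assoc_mult_mat[of _ ?d ?d _ ?d _ ?d] mult_carrier_mat[of _ ?d ?d]
  have DC: "D \<in> carrier_mat ?d ?d" using SMat_carrier[OF D] by simp
  have RV: "real_mat V \<in> SMat 0 n N"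
    using V unfolding SMat_iff parity_supported_def by (auto simp: real_mat_def gcoeff_of_real split: if_splits)
  define L where "L = real_mat V * D"
  have L: "L \<in> SMat 0 n N" unfolding L_def by (rule SMat_mult[OF RV D])
  have LC: "L \<in> carrier_mat ?d ?d" using SMat_carrier[OF L] by simp
  have "body L = 1\<^sub>m ?d" unfolding L_def using V DC by (simp add: body_mult[of _ ?d ?d _ ?d] DV)
  then have "bodiless ?d (L - 1\<^sub>m ?d)" by (rule bodiless_minus_one[OF LC])
  then obtain Z where Z: "Z \<in> SMat 0 n N" "mexp Z = L"
    using mexp_log[OF L] by auto
  have ZC: "Z \<in> carrier_mat ?d ?d" using SMat_carrier[OF Z(1)] by simp
  note ex = mexp_uminus[OF ZC, unfolded Z(2)]
  have eC: "mexp (- Z) \<in> carrier_mat ?d ?d" using ZC by simp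
  define E where "E = mexp (- Z) * real_mat V"
  have VB: "real_mat (body D) * real_mat V = 1\<^sub>m ?d"
    using V DC DV by (simp add: real_mat_one flip: real_mat_mult[of _ ?d ?d _ ?d])
  have DL: "D = real_mat (body D) * L"
    unfolding L_def using V DC by (simp add: as mat_mult_eq_one_cancel[OF VB])
  show ?thesis
  proof (rule that)
    show "E \<in> SMat 0 n N"
      unfolding E_def by (intro SMat_mult SMat_mexp SMat_uminus Z RV)
    show "E * D = 1\<^sub>m ?d"
      unfolding E_def using eC V DC ex(1) by (simp add: as flip: L_def)
    have "D * E = real_mat (body D) * L * (mexp (- Z) * real_mat V)"
      unfolding E_def using DL by simp
    also have "\<dots> = 1\<^sub>m ?d"
      using LC eC V DC by (simp add: as mat_mult_eq_one_cancel[OF ex(2)] VB)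
    finally show "D * E = 1\<^sub>m ?d" .
  qed
qed

lemma mat_inv_eq:
  assumes D: "D \<in> carrier_mat d d" and E: "E \<in> carrier_mat d d" and "D * E = 1\<^sub>m d" "E * D = 1\<^sub>m d"
  shows "mat_inv D = E"
  unfolding mat_inv_def
proof (rule the_equality)
  show "E \<in> carrier_mat (dim_row D) (dim_row D) \<and> inverts_mat D E \<and> inverts_mat E D"
    using assms by (auto simp: inverts_mat_def)
  fix F assume "F \<in> carrier_mat (dim_row D) (dim_row D) \<and> inverts_mat D F \<and> inverts_mat F D"
  then have F: "F \<in> carrier_mat d d" "D * F = 1\<^sub>m d" using D by (auto simp: inverts_mat_def)
  have "F = E * D * F" using F assms by simp
  also have "\<dots> = E * (D * F)" by (rule assoc_mult_mat[OF E D F(1)])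
  finally show "F = E" using F E by simp
qed

text \<open>
  The body as a homomorphism of commutative rings; it commutes with determinants.
\<close>

definition ev_body :: "grassmann_ev \<Rightarrow> real" where
  "ev_body x = gcoeff (Rep_grassmann_ev x) {}"

lemma ev_body_even_part: "ev_body (even_part x) = gcoeff x {}"
  by (simp add: ev_body_def even_part.rep_eq Abs_grassmann_inverse)

lemma ev_body_hom: "comm_ring_hom ev_body"
  by unfold_locales
    (auto simp: ev_body_def times_grassmann_ev.rep_eq plus_grassmann_ev.rep_eq
      zero_grassmann_ev.rep_eq one_grassmann_ev.rep_eq gcoeff_mult_empty plus_grassmann.rep_eq
      zero_grassmann.rep_eq one_grassmann.rep_eq)

lemma map_ev_body_even_part: "map_mat ev_body (map_mat even_part X) = body X"
  by (rule eq_matI) (auto simp: ev_body_even_part body_def)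

lemma even_part_mat_mult_eq_one:
  assumes D: "D \<in> SMat 0 n N" and E: "E \<in> SMat 0 n N" and DE: "D * E = 1\<^sub>m (2 * n)"
  shows "map_mat even_part D * map_mat even_part E = 1\<^sub>m (2 * n)"
proof -
  interpret semiring_hom Rep_grassmann_ev
    by unfold_locales (auto simp: times_grassmann_ev.rep_eq plus_grassmann_ev.rep_eq
      zero_grassmann_ev.rep_eq one_grassmann_ev.rep_eq)
  let ?d = "2 * n"
  have Rep: "map_mat Rep_grassmann_ev (map_mat even_part X) = X" if X: "X \<in> SMat 0 n N" for X
  proof (rule eq_matI)
    fix i k assume "i < dim_row X" "k < dim_col X"
    then have ik: "i < ?d" "k < ?d" using SMat_carrier[OF X] by auto
    have "parity_supported N True (X $$ (i, k))" using X ik unfolding SMat_iff by auto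
    then have "Rep_grassmann_ev (even_part (X $$ (i, k))) = X $$ (i, k)"
      unfolding parity_supported_def by (intro Rep_even_part) blast
    then show "map_mat Rep_grassmann_ev (map_mat even_part X) $$ (i, k) = X $$ (i, k)"
      using ik SMat_carrier[OF X] by auto
  qed auto
  have C: "map_mat even_part D \<in> carrier_mat ?d ?d" "map_mat even_part E \<in> carrier_mat ?d ?d"
    using SMat_carrier[OF D] SMat_carrier[OF E] by auto
  have "map_mat Rep_grassmann_ev (map_mat even_part D * map_mat even_part E) = map_mat Rep_grassmann_ev (1\<^sub>m ?d)"
    unfolding mat_hom_mult[OF C] Rep[OF D] Rep[OF E] DE mat_hom_one by simp
  then show ?thesis
  proof (intro eq_matI)
    fix i k assume eq: "map_mat Rep_grassmann_ev (map_mat even_part D * map_mat even_part E) =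
        map_mat Rep_grassmann_ev (1\<^sub>m ?d)"
      and ik: "i < dim_row (1\<^sub>m ?d :: grassmann_ev mat)" "k < dim_col (1\<^sub>m ?d :: grassmann_ev mat)"
    have "Rep_grassmann_ev ((map_mat even_part D * map_mat even_part E) $$ (i, k)) = Rep_grassmann_ev (1\<^sub>m ?d $$ (i, k))"
      using arg_cong[OF eq, of "\<lambda>M. M $$ (i, k)"] ik C by (simp del: index_mult_mat(1) index_one_mat(1))
    then show "(map_mat even_part D * map_mat even_part E) $$ (i, k) = 1\<^sub>m ?d $$ (i, k)"
      by (simp only: Rep_grassmann_ev_inject)
  qed (use C in auto)
qed

text \<open>
  The block \<open>B D\<^sup>-\<^sup>1 C\<close> has no body, so the body of the superdeterminant is
  \<open>det A / det D\<close>.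
\<close>

lemma sdet_one_imp_body_det_eq:
  assumes M: "M \<in> SMat m n N" and sd: "sdet m M = 1"
    and A: "A \<in> carrier_mat m m" and D: "D \<in> carrier_mat (2 * n) (2 * n)" and bM: "body M = dsum A D"
    and V: "V \<in> carrier_mat (2 * n) (2 * n)" "D * V = 1\<^sub>m (2 * n)" "V * D = 1\<^sub>m (2 * n)"
  shows "det A = det D"
proof -
  interpret ev_body: comm_ring_hom ev_body by (rule ev_body_hom)
  note MC = SMat_carrier[OF M]
  obtain A1 B1 C1 D1 where sp: "split_block M m m = (A1, B1, C1, D1)" by (metis prod_cases4)
  from MC have "dim_row M = m + 2 * n" "dim_col M = m + 2 * n" by auto
  note s = split_block[OF sp this]
  have el: "A1 = mat m m (\<lambda>ij. M $$ ij)" "B1 = mat m (2 * n) (\<lambda>(i, j). M $$ (i, j + m))"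
    "D1 = mat (2 * n) (2 * n) (\<lambda>(i, j). M $$ (i + m, j + m))"
    using sp MC unfolding split_block_def Let_def by auto
  have be: "gcoeff (M $$ (i, k)) {} = dsum A D $$ (i, k)" if "i < m + 2 * n" "k < m + 2 * n" for i k
    using body_entry[OF MC that] by (simp add: bM)
  have bA: "body A1 = A"
    using A D by (intro eq_matI) (auto simp: el body_def be dsum_entry[OF A D])
  have bB: "body B1 = 0\<^sub>m m (2 * n)"
    using A D by (intro eq_matI) (auto simp: el body_def be dsum_entry[OF A D])
  have bD: "body D1 = D"
    using A D by (intro eq_matI) (auto simp: el body_def be dsum_entry[OF A D])
  have D1: "D1 \<in> SMat 0 n N"
    unfolding SMat_iff
  proof (intro conjI allI impI)
    show "D1 \<in> carrier_mat (0 + 2 * n) (0 + 2 * n)" using s by simp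
    fix i k assume ik: "i < 0 + 2 * n" "k < 0 + 2 * n"
    then have "parity_supported N ((i + m < m) = (k + m < m)) (M $$ (i + m, k + m))"
      using M[unfolded SMat_iff, THEN conjunct2, rule_format, of "i + m" "k + m"] by simp
    then show "parity_supported N ((i < 0) = (k < 0)) (D1 $$ (i, k))" using ik by (simp add: el)
  qed
  obtain E where E: "E \<in> SMat 0 n N" "D1 * E = 1\<^sub>m (2 * n)" "E * D1 = 1\<^sub>m (2 * n)"
    using SMat_even_inverse[OF D1 V(1)] V(2,3) unfolding bD by blast
  have EC: "E \<in> carrier_mat (2 * n) (2 * n)" using SMat_carrier[OF E(1)] by simp
  have inv: "mat_inv D1 = E" by (rule mat_inv_eq[OF s(4) EC E(2,3)])
  have C: "map_mat even_part D1 \<in> carrier_mat (2 * n) (2 * n)" "map_mat even_part E \<in> carrier_mat (2 * n) (2 * n)"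
    using s EC by auto
  have dd: "det (map_mat even_part D1) * det (map_mat even_part E) = 1"
    using det_mult[OF C] by (simp add: even_part_mat_mult_eq_one[OF D1 E(1,2)])
  have ei: "ev_inv (det (map_mat even_part D1)) = det (map_mat even_part E)"
    unfolding ev_inv_def
  proof (rule the_equality)
    show "det (map_mat even_part D1) * det (map_mat even_part E) = 1" by (rule dd)
    fix e assume "det (map_mat even_part D1) * e = 1"
    then show "e = det (map_mat even_part E)"
      using dd by (metis mult.assoc mult.commute mult_1)
  qed
  have detbody: "ev_body (det (map_mat even_part X)) = det (body X)" for X
    unfolding ev_body.hom_det[symmetric] map_ev_body_even_part ..
  have BEC: "B1 * E * C1 \<in> carrier_mat m m" using s EC by simp
  have "body (B1 * E * C1) = 0\<^sub>m m m"
    using s EC by (simp add: body_mult[of _ m "2 * n" _ m] body_mult[of _ m "2 * n" _ "2 * n"] bB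
      mult_carrier_mat[of _ m "2 * n"] left_mult_zero_mat[of _ "2 * n"])
  then have z: "gcoeff ((B1 * E * C1) $$ (i, k)) {} = 0" if "i < m" "k < m" for i k
    using body_entry[OF BEC that] that by simp
  have "body (A1 - B1 * E * C1) = A"
  proof (rule eq_matI)
    fix i k assume "i < dim_row A" "k < dim_col A"
    then have ik: "i < m" "k < m" using A by auto
    have AC: "A1 - B1 * E * C1 \<in> carrier_mat m m" using BEC by (rule minus_carrier_mat)
    have "(A1 - B1 * E * C1) $$ (i, k) = A1 $$ (i, k) - (B1 * E * C1) $$ (i, k)"
      using ik carrier_matD[OF BEC] by (intro index_minus_mat) auto
    then show "body (A1 - B1 * E * C1) $$ (i, k) = A $$ (i, k)"
      unfolding body_entry[OF AC ik] using z[OF ik] body_entry[OF s(1) ik] by (simp add: minus_grassmann.rep_eq bA)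
  qed (use A carrier_matD[OF BEC] in \<open>auto simp: body_def\<close>)
  then have "ev_body (sdet m M) = det A * det (body E)"
    unfolding sdet_def sp by (simp add: inv ei ev_body.hom_mult detbody)
  then have AE: "det A * det (body E) = 1" by (simp add: sd)
  have "det D * det (body E) = 1"
  proof -
    have "D * body E = 1\<^sub>m (2 * n)"
      using body_mult[OF s(4) EC] by (simp add: E(2) body_one bD)
    then show ?thesis using det_mult[OF D, of "body E"] EC by simp
  qed
  then show ?thesis using AE by (metis mult.assoc mult.commute mult_1)
qed

section \<open>The decomposition\<close>

lemma bodiless_supertranspose:
  assumes Z: "Z \<in> SMat m n N" "bodiless (m + 2 * n) Z"
  shows "body (supertranspose m Z) = 0\<^sub>m (m + 2 * n) (m + 2 * n)"
  using body_supertranspose[OF Z(1)] bodiless_iff[OF SMat_carrier[OF Z(1)]] Z(2) by simp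

text \<open>
  Let \<open>W = Q\<^sup>-\<^sup>1 Z\<^sup>S\<^sup>T Q\<close>.  The equation for \<open>e\<^sup>Z\<close> says that \<open>e\<^sup>W\<close> is inverse to \<open>e\<^sup>Z\<close>, so
  \<open>W\<close> and \<open>- Z\<close> have the same exponential, and injectivity gives \<open>W = - Z\<close>.
\<close>

lemma log_in_so0:
  assumes Z: "Z \<in> SMat m n N" "bodiless (m + 2 * n) Z"
    and L: "supertranspose m (mexp Z) * Qmat m n * mexp Z = Qmat m n"
  shows "Z \<in> so0 m n N"
proof -
  let ?d = "m + 2 * n"
  note as = assoc_mult_mat[of _ ?d ?d _ ?d _ ?d] mult_carrier_mat[of _ ?d ?d]
  obtain R where R: "R \<in> carrier_mat ?d ?d" "real_Q m n * R = 1\<^sub>m ?d" "R * real_Q m n = 1\<^sub>m ?d"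
    by (rule real_Q_inverse)
  define Qi where "Qi = real_mat R"
  have Qi: "Qi \<in> carrier_mat ?d ?d" using R by (simp add: Qi_def)
  have Q: "Qmat m n \<in> carrier_mat ?d ?d" by (simp add: Qmat_eq real_Q_carrier)
  have QQ: "Qmat m n * Qi = 1\<^sub>m ?d" "Qi * Qmat m n = 1\<^sub>m ?d"
    unfolding Qmat_eq Qi_def using R real_Q_carrier[of m n]
    by (simp_all add: real_mat_one flip: real_mat_mult[of _ ?d ?d _ ?d])
  note ZC = SMat_carrier[OF Z(1)]
  note st = supertranspose_carrier[OF ZC]
  define W where "W = Qi * supertranspose m Z * Qmat m n"
  have W: "W \<in> carrier_mat ?d ?d" unfolding W_def using Qi st Q by simp
  have "body W = 0\<^sub>m ?d ?d"
    unfolding W_def using Qi st Q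
    by (simp add: body_mult[of _ ?d ?d _ ?d] bodiless_supertranspose[OF Z] mult_carrier_mat[of _ ?d ?d]
      right_mult_zero_mat[of _ ?d ?d] left_mult_zero_mat[of _ ?d ?d])
  then have bW: "bodiless ?d W" using bodiless_iff[OF W] by simp
  have mZ: "- Z \<in> carrier_mat ?d ?d" "bodiless ?d (- Z)"
    using ZC Z(2) by (auto simp: bodiless_def uminus_grassmann.rep_eq)
  have eZ: "mexp Z \<in> carrier_mat ?d ?d" "mexp (- Z) \<in> carrier_mat ?d ?d" using ZC by auto
  note ste = supertranspose_carrier[OF eZ(1)]
  have eW: "mexp W = Qi * supertranspose m (mexp Z) * Qmat m n"
    unfolding W_def using mexp_conj[OF st Qi Q QQ(2) QQ(1)] by (simp add: supertranspose_mexp[OF Z(1)])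
  have eWC: "mexp W \<in> carrier_mat ?d ?d" using W by simp
  have "mexp W * mexp Z = Qi * (supertranspose m (mexp Z) * Qmat m n * mexp Z)"
    unfolding eW using Qi Q ste eZ by (simp add: as)
  then have one: "mexp W * mexp Z = 1\<^sub>m ?d" unfolding L QQ .
  have "mexp W = mexp W * (mexp Z * mexp (- Z))"
    using eWC by (simp add: mexp_uminus[OF ZC])
  also have "\<dots> = mexp (- Z)"
    using mat_mult_eq_one_cancel[OF one eWC eZ(1) eZ(2)] .
  finally have WZ: "W = - Z" by (rule mexp_inj_bodiless[OF W mZ(1) bW mZ(2)])
  have "supertranspose m Z * Qmat m n = Qmat m n * W"
    unfolding W_def using Qi Q st by (simp add: as mat_mult_eq_one_cancel[OF QQ(1)])
  also have "\<dots> = - (Qmat m n * Z)" unfolding WZ using Q ZC by simp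
  finally have "supertranspose m Z * Qmat m n + Qmat m n * Z = 0\<^sub>m ?d ?d"
    using Q ZC by (simp add: uminus_l_inv_mat[of _ ?d ?d])
  with Z show ?thesis by (simp add: so0_def)
qed

lemma SMat_plus_iff: "Z \<in> SMat_plus m n N \<longleftrightarrow> Z \<in> SMat m n N \<and> bodiless (m + 2 * n) Z"
proof (cases "Z \<in> SMat m n N")
  case True
  note ZC = SMat_carrier[OF True]
  have "elements_mat Z \<subseteq> Lambda_plus N \<longleftrightarrow> (\<forall>i < m + 2 * n. \<forall>k < m + 2 * n. Z $$ (i, k) \<in> Lambda_plus N)"
    using ZC by (auto dest!: elements_matD intro: elements_matI)
  also have "\<dots> \<longleftrightarrow> bodiless (m + 2 * n) Z"
    using True unfolding bodiless_def Lambda_plus_iff SMat_iff parity_supported_def by blast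
  finally show ?thesis using True by (simp add: SMat_plus_def)
qed (simp add: SMat_plus_def)

lemma so0_plusD: "Z \<in> so0_plus m n N \<Longrightarrow> Z \<in> SMat m n N \<and> bodiless (m + 2 * n) Z"
  by (auto simp: so0_plus_def SMat_plus_iff)

lemma O0_body:
  assumes "M \<in> O0 m n N"
  shows "(body M)\<^sup>T * real_Q m n * body M = real_Q m n"
    "supertranspose m M * Qmat m n * M = Qmat m n"
proof -
  let ?d = "m + 2 * n"
  have M: "M \<in> SMat m n N" and eq: "supertranspose m M * Qmat m n * M - Qmat m n = 0\<^sub>m ?d ?d"
    using assms by (auto simp: O0_def)
  note MC = SMat_carrier[OF M]
  note st = supertranspose_carrier[OF MC]
  have Q: "Qmat m n \<in> carrier_mat ?d ?d" by (simp add: Qmat_eq real_Q_carrier)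
  have P: "supertranspose m M * Qmat m n * M \<in> carrier_mat ?d ?d" using st Q MC by simp
  show e: "supertranspose m M * Qmat m n * M = Qmat m n"
  proof (rule eq_matI)
    fix i k assume "i < dim_row (Qmat m n)" "k < dim_col (Qmat m n)"
    then have ik: "i < ?d" "k < ?d" using Q by auto
    have "(supertranspose m M * Qmat m n * M - Qmat m n) $$ (i, k) =
        (supertranspose m M * Qmat m n * M) $$ (i, k) - Qmat m n $$ (i, k)"
      using ik Q by (intro index_minus_mat) auto
    then show "(supertranspose m M * Qmat m n * M) $$ (i, k) = Qmat m n $$ (i, k)"
      unfolding eq using ik by simp
  qed (use P Q in auto)
  have "body (supertranspose m M * Qmat m n * M) = (body M)\<^sup>T * real_Q m n * body M"
    using st Q MC by (simp add: body_mult[of _ ?d ?d _ ?d] mult_carrier_mat[of _ ?d ?d]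
      body_supertranspose[OF M] Qmat_eq)
  then show "(body M)\<^sup>T * real_Q m n * body M = real_Q m n"
    unfolding e by (simp add: Qmat_eq)
qed

lemma body_blocks_of_O0:
  assumes A: "A \<in> carrier_mat m m" and D: "D \<in> carrier_mat (2 * n) (2 * n)"
    and eq: "(dsum A D)\<^sup>T * real_Q m n * dsum A D = real_Q m n"
  shows "A\<^sup>T * A = 1\<^sub>m m" "D\<^sup>T * Omega n * D = Omega n"
proof -
  have O: "(- 1 / 2) \<cdot>\<^sub>m Omega n \<in> carrier_mat (2 * n) (2 * n)" by simp
  have T: "A\<^sup>T \<in> carrier_mat m m" "D\<^sup>T \<in> carrier_mat (2 * n) (2 * n)" using A D by auto
  have "dsum (A\<^sup>T * 1\<^sub>m m * A) (D\<^sup>T * ((- 1 / 2) \<cdot>\<^sub>m Omega n) * D) = dsum (1\<^sub>m m) ((- 1 / 2) \<cdot>\<^sub>m Omega n)"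
    using eq T O A D unfolding real_Q_def dsum_transpose[OF A D]
    by (simp only: dsum_mult[OF T one_carrier_mat O] dsum_mult[OF _ _ A D] mult_carrier_mat one_carrier_mat)
  note dsum_inj[OF _ _ one_carrier_mat O this]
  then have *: "A\<^sup>T * 1\<^sub>m m * A = 1\<^sub>m m" "D\<^sup>T * ((- 1 / 2) \<cdot>\<^sub>m Omega n) * D = (- 1 / 2) \<cdot>\<^sub>m Omega n"
    using A D T O by (simp_all only: mult_carrier_mat[of _ m m] mult_carrier_mat[of _ "2 * n" "2 * n"] one_carrier_mat simp_thms)
  from *(1) A show "A\<^sup>T * A = 1\<^sub>m m" by simp
  have "D\<^sup>T * ((- 1 / 2) \<cdot>\<^sub>m Omega n) * D = (- 1 / 2) \<cdot>\<^sub>m (D\<^sup>T * Omega n * D)"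
    using T D by (simp add: mult_smult_distrib[OF T(2) Omega_carrier]
      mult_smult_assoc_mat[OF mult_carrier_mat[OF T(2) Omega_carrier] D])
  with *(2) have "(- 2) \<cdot>\<^sub>m ((- 1 / 2) \<cdot>\<^sub>m (D\<^sup>T * Omega n * D)) = (- 2) \<cdot>\<^sub>m ((- 1 / 2) \<cdot>\<^sub>m Omega n)"
    by simp
  then show "D\<^sup>T * Omega n * D = Omega n" by (simp add: smult_smult_mat smult_one_mat)
qed

lemma block_prod_skew:
  assumes "X \<in> block_prod (so_alg m) (sp_alg n \<inter> so_alg (2 * n))"
  obtains x where "X = real_mat x" "x \<in> carrier_mat (m + 2 * n) (m + 2 * n)" "x\<^sup>T = - x"
proof -
  obtain a b where ab: "X = real_mat (dsum a b)" and a: "a \<in> carrier_mat m m" "a\<^sup>T = - a"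
    and b: "b \<in> carrier_mat (2 * n) (2 * n)" "b\<^sup>T = - b"
    using assms by (auto simp: block_prod_def so_alg_def dsum_def simp del: diag_block_mat.simps)
  have ab': "- a \<in> carrier_mat m m" "- b \<in> carrier_mat (2 * n) (2 * n)" using a b by auto
  have "dsum (- a) (- b) = - dsum a b"
    using a b by (auto simp: dsum_eq[OF a(1) b(1)] dsum_eq[OF ab'] intro!: eq_matI)
  then have "(dsum a b)\<^sup>T = - dsum a b" by (simp add: dsum_transpose[OF a(1) b(1)] a b)
  with that ab dsum_carrier[OF a(1) b(1)] show ?thesis by blast
qed

lemma block_prod_symmetric:
  assumes "Y \<in> block_prod {0\<^sub>m m m} (sp_alg n \<inter> Sym (2 * n))"
  obtains y where "Y = real_mat y" "y \<in> carrier_mat (m + 2 * n) (m + 2 * n)" "y\<^sup>T = y"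
proof -
  obtain b where b: "Y = real_mat (dsum (0\<^sub>m m m) b)" "b \<in> carrier_mat (2 * n) (2 * n)" "b\<^sup>T = b"
    using assms by (auto simp: block_prod_def Sym_def dsum_def simp del: diag_block_mat.simps)
  have z: "(0\<^sub>m m m :: real mat) \<in> carrier_mat m m" by simp
  have "(dsum (0\<^sub>m m m) b)\<^sup>T = dsum (0\<^sub>m m m) b" by (simp add: dsum_transpose[OF z b(2)] b(3))
  with that b(1) dsum_carrier[OF z b(2)] show ?thesis by blast
qed

text \<open>
  The body \<open>B = e\<^sup>x e\<^sup>y\<close> of \<open>M\<close> satisfies \<open>B\<^sup>T B = e\<^sup>y e\<^sup>-\<^sup>x e\<^sup>x e\<^sup>y = e\<^sup>2\<^sup>y\<close>, which determines the symmetric \<open>y\<close>;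
  and \<open>e\<^sup>Z\<close> is \<open>B\<^sup>-\<^sup>1 M\<close>.
\<close>

lemma decomposition_unique:
  assumes M: "M \<in> carrier_mat d d"
    and "x \<in> carrier_mat d d" "x\<^sup>T = - x" "x' \<in> carrier_mat d d" "x'\<^sup>T = - x'"
    and y: "y \<in> carrier_mat d d" "y\<^sup>T = y" and y': "y' \<in> carrier_mat d d" "y'\<^sup>T = y'"
    and Z: "Z \<in> carrier_mat d d" "bodiless d Z" and Z': "Z' \<in> carrier_mat d d" "bodiless d Z'"
    and eq: "M = mexp (real_mat x) * mexp (real_mat y) * mexp Z"
      "M = mexp (real_mat x') * mexp (real_mat y') * mexp Z'"
  shows "y = y'" "Z = Z'"
proof -
  note as = assoc_mult_mat[of _ d d _ d _ d] mult_carrier_mat[of _ d d]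
  have b: "M = real_mat (body M) * mexp Z \<and> rexp y * rexp y = (body M)\<^sup>T * body M \<and>
      body M * (rexp (- y) * rexp (- x)) = 1\<^sub>m d"
    if x: "x \<in> carrier_mat d d" "x\<^sup>T = - x" and y: "y \<in> carrier_mat d d" "y\<^sup>T = y"
      and Z: "Z \<in> carrier_mat d d" "bodiless d Z"
      and eq: "M = mexp (real_mat x) * mexp (real_mat y) * mexp Z" for x y Z
  proof -
    have e: "rexp x \<in> carrier_mat d d" "rexp y \<in> carrier_mat d d" "rexp (- x) \<in> carrier_mat d d"
      "rexp (- y) \<in> carrier_mat d d" "mexp Z \<in> carrier_mat d d" using x y Z by auto
    have xy: "mexp (real_mat x) * mexp (real_mat y) = real_mat (rexp x * rexp y)"
      using x y e by (simp add: mexp_real_mat[of _ d] real_mat_mult[of _ d d _ d])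
    have bM: "body M = rexp x * rexp y"
      unfolding eq xy using e by (simp add: body_mult[of _ d d _ d] as body_mexp_bodiless[OF Z])
    have "(body M)\<^sup>T * body M = (rexp y)\<^sup>T * ((rexp x)\<^sup>T * rexp x) * rexp y"
      unfolding bM using e by (simp add: transpose_mult[of _ d d _ d] as)
    also have "(rexp x)\<^sup>T = rexp (- x)" using rexp_transpose[OF x(1)] by (simp add: x(2))
    also have "(rexp y)\<^sup>T = rexp y" using rexp_transpose[OF y(1)] by (simp add: y(2))
    also have "rexp y * (rexp (- x) * rexp x) * rexp y = rexp y * rexp y"
      unfolding rexp_uminus(1)[OF x(1)] using e by simp
    finally have "rexp y * rexp y = (body M)\<^sup>T * body M" ..
    moreover have "body M * (rexp (- y) * rexp (- x)) = 1\<^sub>m d"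
      unfolding bM using e
      by (simp add: as mat_mult_eq_one_cancel[OF rexp_uminus(2)[OF y(1)]] rexp_uminus(2)[OF x(1)])
    ultimately show ?thesis using eq xy bM by simp
  qed
  note b1 = b[OF assms(2,3) y Z eq(1)] and b2 = b[OF assms(4,5) y' Z' eq(2)]
  show "y = y'" using b1 b2 by (intro rexp_square_symmetric_inj[OF y y']) simp
  let ?V = "rexp (- y) * rexp (- x)"
  have V: "?V \<in> carrier_mat d d" by (intro mult_carrier_mat[of _ d d]) (use assms in auto)
  have bM: "body M \<in> carrier_mat d d" using M by simp
  have "?V * body M = 1\<^sub>m d" using mat_mult_left_right_inverse[OF bM V] b1 by blast
  then have VM: "real_mat ?V * real_mat (body M) = 1\<^sub>m d"
    using V bM by (simp add: real_mat_one flip: real_mat_mult[of _ d d _ d])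
  have "mexp Z = real_mat ?V * (real_mat (body M) * mexp Z)"
    using V bM Z by (intro mat_mult_eq_one_cancel[OF VM, symmetric]) auto
  also have "\<dots> = real_mat ?V * (real_mat (body M) * mexp Z')" using b1 b2 by simp
  also have "\<dots> = mexp Z'"
    using V bM Z' by (intro mat_mult_eq_one_cancel[OF VM]) auto
  finally show "Z = Z'" by (rule mexp_inj_bodiless[OF Z(1) Z'(1) Z(2) Z'(2)])
qed

text \<open>
  The logarithms of the body supply \<open>X\<close> and \<open>Y\<close>.  Multiplying \<open>M\<close> by the inverse \<open>W\<close> of its body
  stays inside \<open>O0\<close> and leaves a matrix \<open>L\<close> with body \<open>1\<close>, whose logarithm is \<open>Z\<close>.
\<close>

lemma decomposition_exists:
  assumes "M \<in> SO0 m n N"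
  shows "\<exists>X \<in> block_prod (so_alg m) (sp_alg n \<inter> so_alg (2 * n)).
    \<exists>Y \<in> block_prod {0\<^sub>m m m} (sp_alg n \<inter> Sym (2 * n)).
    \<exists>Z \<in> so0_plus m n N. M = mexp X * mexp Y * mexp Z"
proof -
  let ?d = "m + 2 * n"
  note as = assoc_mult_mat[of _ ?d ?d _ ?d _ ?d] mult_carrier_mat[of _ ?d ?d]
  have O: "M \<in> O0 m n N" and sd: "sdet m M = 1" and M: "M \<in> SMat m n N"
    using assms by (auto simp: SO0_def O0_def)
  note MC = SMat_carrier[OF M]
  obtain A D where A: "A \<in> carrier_mat m m" and D: "D \<in> carrier_mat (2 * n) (2 * n)"
    and bM: "body M = dsum A D"
    using body_SMat[OF M] by (metis mat_carrier)
  note AD = body_blocks_of_O0[OF A D O0_body(1)[OF O, unfolded bM]]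
  obtain U Y2 where U: "U \<in> carrier_mat (2 * n) (2 * n)" "U\<^sup>T * U = 1\<^sub>m (2 * n)" "Omega n * U = U * Omega n"
    and Y2: "Y2 \<in> carrier_mat (2 * n) (2 * n)" "Y2\<^sup>T = Y2"
      "Y2 * Omega n + Omega n * Y2 = 0\<^sub>m (2 * n) (2 * n)" and DU: "D = U * rexp Y2"
    using symplectic_polar[OF D Omega_carrier Omega_skew Omega_orthogonal AD(2)] .
  obtain X2 where X2: "X2 \<in> carrier_mat (2 * n) (2 * n)" "X2\<^sup>T = - X2" "Omega n * X2 = X2 * Omega n"
    and UX: "rexp X2 = U"
    using unitary_log[OF U(1,2) Omega_carrier Omega_skew Omega_orthogonal U(3)] .
  have e2: "rexp X2 \<in> carrier_mat (2 * n) (2 * n)" "rexp Y2 \<in> carrier_mat (2 * n) (2 * n)" using X2 Y2 by auto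
  have detD: "det D > 0"
    unfolding DU UX[symmetric] det_mult[OF e2] using det_rexp_pos[OF X2(1)] det_rexp_pos[OF Y2(1)] by simp
  define V where "V = rexp (- Y2) * U\<^sup>T"
  have V: "V \<in> carrier_mat (2 * n) (2 * n)" 
    unfolding V_def using Y2 U by (intro mult_carrier_mat[of _ "2 * n" "2 * n"]) auto
  have VD: "V * D = 1\<^sub>m (2 * n)"
    unfolding V_def DU using U(1) Y2(1) e2
    by (simp add: assoc_mult_mat[of _ "2 * n" "2 * n" _ "2 * n" _ "2 * n"] mult_carrier_mat[of _ "2 * n" "2 * n"]
      mat_mult_eq_one_cancel[OF U(2)] rexp_uminus)
  have DV: "D * V = 1\<^sub>m (2 * n)" by (rule mat_mult_left_right_inverse[OF V D VD])
  have "det A > 0" using sdet_one_imp_body_det_eq[OF M sd A D bM V DV VD] detD by simp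
  then obtain X1 where X1: "X1 \<in> carrier_mat m m" "X1\<^sup>T = - X1" "rexp X1 = A"
    using special_orthogonal_log[OF A AD(1)] by blast
  define X where "X = real_mat (dsum X1 X2)"
  define Y where "Y = real_mat (dsum (0\<^sub>m m m) Y2)"
  have z: "(0\<^sub>m m m :: real mat) \<in> carrier_mat m m" by simp
  have X2sp: "X2\<^sup>T * Omega n + Omega n * X2 = 0\<^sub>m (2 * n) (2 * n)"
  proof -
    have "- X2 * Omega n = - (X2 * Omega n)"
      by (rule uminus_mult_left_mat) (use X2(1) carrier_matD[OF Omega_carrier] in auto)
    then show ?thesis
      unfolding X2(2,3) using mult_carrier_mat[OF X2(1) Omega_carrier] by (simp add: uminus_l_inv_mat)
  qed
  have Xin: "X \<in> block_prod (so_alg m) (sp_alg n \<inter> so_alg (2 * n))"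
    unfolding block_prod_def X_def dsum_def so_alg_def sp_alg_def using X1 X2 X2sp by blast
  have Yin: "Y \<in> block_prod {0\<^sub>m m m} (sp_alg n \<inter> Sym (2 * n))"
    unfolding block_prod_def Y_def dsum_def Sym_def sp_alg_def using Y2 by fastforce
  have "rexp (dsum X1 X2) * rexp (dsum (0\<^sub>m m m) Y2) = body M"
    unfolding rexp_dsum[OF X1(1) X2(1)] rexp_dsum[OF z Y2(1)] bM DU UX rexp_zero X1(3)
      dsum_mult[OF A U(1) one_carrier_mat e2(2)] using A by simp
  then have G: "mexp X * mexp Y = real_mat (body M)"
    unfolding X_def Y_def using dsum_carrier[OF X1(1) X2(1)] dsum_carrier[OF z Y2(1)]
    by (simp add: mexp_real_mat[of _ ?d] flip: real_mat_mult[of _ ?d ?d _ ?d])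
  have AT: "A\<^sup>T \<in> carrier_mat m m" using A by simp
  have AA: "A * A\<^sup>T = 1\<^sub>m m" by (rule mat_mult_left_right_inverse[OF AT A AD(1)])
  define g where "g = real_mat (body M)"
  define W where "W = real_mat (dsum A\<^sup>T V)"
  have W: "W \<in> SMat m n N" unfolding W_def by (rule real_mat_dsum_SMat[OF AT V])
  have g: "g \<in> SMat m n N" unfolding g_def bM by (rule real_mat_dsum_SMat[OF A D])
  note WC = SMat_carrier[OF W] and gC = SMat_carrier[OF g]
  have Wg: "W * g = 1\<^sub>m ?d" and gW: "g * W = 1\<^sub>m ?d"
    unfolding W_def g_def bM using dsum_carrier[OF AT V] dsum_carrier[OF A D]
    by (simp_all add: dsum_mult[OF AT V A D] dsum_mult[OF A D AT V] AD AA VD DV dsum_one real_mat_one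
      flip: real_mat_mult[of _ ?d ?d _ ?d])
  have Q: "Qmat m n \<in> carrier_mat ?d ?d" by (simp add: Qmat_eq real_Q_carrier)
  have gst: "supertranspose m g * Qmat m n * g = Qmat m n"
  proof -
    have "supertranspose m g = real_mat ((body M)\<^sup>T)"
    proof (rule eq_matI)
      have bC: "body M \<in> carrier_mat ?d ?d" using MC by simp
      show "dim_row (supertranspose m g) = dim_row (real_mat ((body M)\<^sup>T))"
        "dim_col (supertranspose m g) = dim_col (real_mat ((body M)\<^sup>T))"
        using carrier_matD[OF supertranspose_carrier[OF gC]] bC by (auto simp: real_mat_def)
      fix i k assume "i < dim_row (real_mat ((body M)\<^sup>T))" "k < dim_col (real_mat ((body M)\<^sup>T))"
      then have ik: "i < ?d" "k < ?d" using bC by (auto simp: real_mat_def)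
      have "body M $$ (k, i) = 0" if "\<not> i < m" "k < m"
        unfolding bM dsum_entry[OF A D ik(2) ik(1)] using that by simp
      then show "supertranspose m g $$ (i, k) = real_mat ((body M)\<^sup>T) $$ (i, k)"
        unfolding supertranspose_entry[OF gC ik] using ik bC by (auto simp: g_def real_mat_def)
    qed
    then show ?thesis
      unfolding Qmat_eq g_def using O0_body(1)[OF O] MC real_Q_carrier[of m n]
      by (simp add: mult_carrier_mat[of _ ?d ?d] flip: real_mat_mult[of _ ?d ?d _ ?d])
  qed
  note st = supertranspose_carrier[OF WC] supertranspose_carrier[OF gC] supertranspose_carrier[OF MC]
  have Wst: "supertranspose m W * Qmat m n * W = Qmat m n"
  proof -
    have "supertranspose m W * Qmat m n * W = supertranspose m W * (supertranspose m g * Qmat m n * g) * W"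
      unfolding gst ..
    also have "\<dots> = (supertranspose m W * supertranspose m g) * Qmat m n * (g * W)"
      using st Q WC gC by (simp add: as)
    also have "supertranspose m W * supertranspose m g = 1\<^sub>m ?d"
      using supertranspose_mult[OF g W] by (simp add: gW supertranspose_one)
    finally show ?thesis using Q by (simp add: gW)
  qed
  define L where "L = W * M"
  have L: "L \<in> SMat m n N" unfolding L_def by (rule SMat_mult[OF W M])
  note LC = SMat_carrier[OF L]
  have Lst: "supertranspose m L * Qmat m n * L = Qmat m n"
  proof -
    have "supertranspose m L * Qmat m n * L = supertranspose m M * (supertranspose m W * Qmat m n * W) * M"
      unfolding L_def supertranspose_mult[OF W M] using st Q WC MC by (simp add: as)
    then show ?thesis unfolding Wst O0_body(2)[OF O] .
  qed
  have "body L = body (W * g)"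
    unfolding L_def using WC gC MC by (simp add: body_mult[of _ ?d ?d _ ?d] g_def)
  then have bL: "body L = 1\<^sub>m ?d" by (simp add: Wg body_one)
  have "bodiless ?d (L - 1\<^sub>m ?d)" by (rule bodiless_minus_one[OF LC bL])
  then obtain Z where Z: "Z \<in> SMat m n N" "bodiless ?d Z" "mexp Z = L"
    by (rule mexp_log[OF L])
  have "Z \<in> so0 m n N" by (rule log_in_so0[OF Z(1,2)]) (simp add: Z(3) Lst)
  then have Zin: "Z \<in> so0_plus m n N" using Z by (simp add: so0_plus_def SMat_plus_iff)
  have "M = g * (W * M)" using mat_mult_eq_one_cancel[OF gW gC WC MC] by simp
  then have "M = mexp X * mexp Y * mexp Z" unfolding G Z(3) L_def g_def .
  with Xin Yin Zin show ?thesis by blast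
qed

theorem theorem3:
  fixes m n N :: nat and M :: "grassmann mat"
  assumes "m \<ge> 1" and "n \<ge> 1" and "N \<ge> 1"
    and "M \<in> SO0 m n N"
  shows "(\<exists>X \<in> block_prod (so_alg m) (sp_alg n \<inter> so_alg (2 * n)).
          \<exists>Y \<in> block_prod {0\<^sub>m m m} (sp_alg n \<inter> Sym (2 * n)).
          \<exists>Z \<in> so0_plus m n N. M = mexp X * mexp Y * mexp Z) \<and>
    (\<forall>X \<in> block_prod (so_alg m) (sp_alg n \<inter> so_alg (2 * n)).
     \<forall>X' \<in> block_prod (so_alg m) (sp_alg n \<inter> so_alg (2 * n)).
     \<forall>Y \<in> block_prod {0\<^sub>m m m} (sp_alg n \<inter> Sym (2 * n)).
     \<forall>Y' \<in> block_prod {0\<^sub>m m m} (sp_alg n \<inter> Sym (2 * n)).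
     \<forall>Z \<in> so0_plus m n N. \<forall>Z' \<in> so0_plus m n N.
       M = mexp X * mexp Y * mexp Z \<longrightarrow> M = mexp X' * mexp Y' * mexp Z' \<longrightarrow>
       Y = Y' \<and> Z = Z')"
proof (intro conjI[OF decomposition_exists[OF assms(4)]] ballI impI)
  fix X X' Y Y' Z Z'
  assume XX: "X \<in> block_prod (so_alg m) (sp_alg n \<inter> so_alg (2 * n))"
      "X' \<in> block_prod (so_alg m) (sp_alg n \<inter> so_alg (2 * n))"
    and YY: "Y \<in> block_prod {0\<^sub>m m m} (sp_alg n \<inter> Sym (2 * n))"
      "Y' \<in> block_prod {0\<^sub>m m m} (sp_alg n \<inter> Sym (2 * n))"
    and ZZ: "Z \<in> so0_plus m n N" "Z' \<in> so0_plus m n N"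
    and eq: "M = mexp X * mexp Y * mexp Z" "M = mexp X' * mexp Y' * mexp Z'"
  obtain x where x: "X = real_mat x" "x \<in> carrier_mat (m + 2 * n) (m + 2 * n)" "x\<^sup>T = - x"
    by (rule block_prod_skew[OF XX(1)])
  obtain x' where x': "X' = real_mat x'" "x' \<in> carrier_mat (m + 2 * n) (m + 2 * n)" "x'\<^sup>T = - x'"
    by (rule block_prod_skew[OF XX(2)])
  obtain y where y: "Y = real_mat y" "y \<in> carrier_mat (m + 2 * n) (m + 2 * n)" "y\<^sup>T = y"
    by (rule block_prod_symmetric[OF YY(1)])
  obtain y' where y': "Y' = real_mat y'" "y' \<in> carrier_mat (m + 2 * n) (m + 2 * n)" "y'\<^sup>T = y'"
    by (rule block_prod_symmetric[OF YY(2)])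
  have M: "M \<in> carrier_mat (m + 2 * n) (m + 2 * n)"
    using assms(4) by (auto simp: SO0_def O0_def intro: SMat_carrier)
  have Z: "Z \<in> carrier_mat (m + 2 * n) (m + 2 * n)" "bodiless (m + 2 * n) Z"
    "Z' \<in> carrier_mat (m + 2 * n) (m + 2 * n)" "bodiless (m + 2 * n) Z'"
    using so0_plusD[OF ZZ(1)] so0_plusD[OF ZZ(2)] by (auto intro: SMat_carrier)
  note u = decomposition_unique[OF M x(2,3) x'(2,3) y(2,3) y'(2,3) Z eq[unfolded x(1) x'(1) y(1) y'(1)]]
  show "Y = Y' \<and> Z = Z'" using u by (simp add: y(1) y'(1))
qed

end
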